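(* Let $\mathcal{W}$ be a standard sequence of generating words with cutting parameters $(q_n)_{n\ge0}$ and bounded spacers such that the minimal Ferenczi subshift $(X_{\mathcal{W}}, S)$ is aperiodic. Let $\widetilde{\boldsymbol{z}}$ be the unique vector collinear to $\boldsymbol{z}$ such that $u_{\mathcal{W}} \cdot \widetilde{\boldsymbol{z}} = 1$, and define $\mathcal{J}_{\mathcal{W}} = \{x \cdot \widetilde{\boldsymbol{z}} : x \in \mathcal{G}_{\mathcal{W}}\} \subseteq \mathbb{R}$. Then the dimension group $K^0(X_{\mathcal{W}}, S)/\operatorname{Inf} K^0(X_{\mathcal{W}}, S)$ is unital order isomorphic to $$(\mathcal{J}_{\mathcal{W}},\ \{y \in \mathcal{J}_{\mathcal{W}} : y \ge 0\},\ 1).$$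
   Context: $S$ is the shift; a subshift is aperiodic if it is nonempty and contains no shift-periodic point. Ferenczi subshifts. Given nonnegative integers $(q_n)_{n \ge 0}$ (cutting parameters) and $(a_{n,i} : n \ge 0, 0 \le i < q_n)$ (spacer parameters), the sequence of generating words $\mathcal{W} = (w_n)_{n \ge 0}$ over $\{0,1\}$ is $w_0 = 0$, $w_{n+1} = w_n 1^{a_{n,0}} w_n 1^{a_{n,1}} \cdots w_n 1^{a_{n,q_n-1}} w_n$. $X_{\mathcal{W}}$ is the set of $x \in \{0,1\}^{\mathbb{Z}}$ every finite factor of which is a factor of some $w_n$. $\mathcal{W}$ is standard if $q_n \ge 2$ for all $n$. If the spacers are bounded, $(X_{\mathcal{W}},S)$ is minimal. Directive sequence. $\mathcal{A}_0=\{0,1\}$ and $\mathcal{A}_n = \{a_{N,i} : N \ge n-1, 0 \le i < q_N\}$ for $n \ge 1$; $\tau_0(a)=01^a$ for $a \in \mathcal{A}_1$ and $\tau_n(a) = a_{n-1,1} \cdots a_{n-1,q_{n-1}-1}\, a\, a_{n-1,0}$ for $n \ge 1$, $a \in \mathcal{A}_{n+1}$. $n_0 \ge 1$ is an integer with $\mathcal{A}_n = \mathcal{A}_{n_0}$ for all $n \ge n_0$, and $\mathcal{A}_{\mathcal{W}} = \mathcal{A}_{n_0}$. Let $a' = \min \mathcal{A}_{\mathcal{W}}$ and $\mathcal{B}_{\mathcal{W}} = \mathcal{A}_{\mathcal{W}} \setminus \{a'\}$. Vectors in $\mathbb{R}^{\mathcal{A}_{\mathcal{W}}}$ are viewed in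 $\mathbb{R}^{\mathcal{B}_{\mathcal{W}}} \times \mathbb{R}$, the last coordinate being indexed by $a'$. The vector $\boldsymbol{z}$. Let $\widehat{\boldsymbol{\tau}}_{\mathcal{W}} = (\tau_{n+n_0} : \mathcal{A}_{\mathcal{W}}^* \to \mathcal{A}_{\mathcal{W}}^* )_{n \ge 0}$; the subshift it generates (the $x \in \mathcal{A}_{\mathcal{W}}^{\mathbb{Z}}$ all of whose finite factors occur in $\tau_{n_0} \circ \cdots \circ \tau_{N-1}(a)$ for some $N > n_0$, $a \in \mathcal{A}_{\mathcal{W}}$) is uniquely ergodic with invariant probability measure $\widehat\mu$. Put $\widehat{\boldsymbol{\mu}}(a) = \widehat\mu(\{x : x_0=a\})$; explicitly $\widehat{\boldsymbol{\mu}}(a) = \sum_{k=n_0}^\infty \frac{f_k(a)}{Q_{n_0-1,k}}$, with $f_k(a) = \#\{0 \le i < q_{k-1} : a_{k-1,i} = a\}$ and $Q_{m,n} = \prod_{j=m}^{n-1}(q_j+1)$. Then $\boldsymbol{z}(b) = \widehat{\boldsymbol{\mu}}(b)$ for $b \in \mathcal{B}_{\mathcal{W}}$ and $\boldsymbol{z}(a') = 1$. $\mathcal{G}_{\mathcal{W}} = \mathbb{Z}^{\mathcal{B}_{\mathcal{W}}} \times \mathbb{Z}[(q_n+1)_{n \ge n_0-1}]$, where $\mathbb{Z}[(c_n)_{n \ge N}] = \{ m/(c_N c_{N+1} \cdots c_n) : m \in \mathbb{Z}, n \ge N\}$; and $u_{\mathcal{W}} \in \mathcal{G}_{\mathcal{W}}$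 is given by $u_{\mathcal{W}}(b) = b - a'$ for $b \in \mathcal{B}_{\mathcal{W}}$, $u_{\mathcal{W}}(a') = a' + |w_{n_0-1}|$. Dimension group. For a minimal Cantor system $(X,T)$, $K^0(X,T) = (H(X,T), H^+(X,T), [\mathbf{1}_X])$, where $H(X,T) = C(X,\mathbb{Z})/\{f\circ T - f : f \in C(X,\mathbb{Z})\}$, $H^+(X,T)$ is the image of $C(X,\mathbb{N})$ ($\mathbb{N}\ni 0$), and $[\mathbf{1}_X]$ is the class of the constant function $1$. The infinitesimals are $\operatorname{Inf} H(X,T) = \{[f] : \int f\,d\mu = 0 \text{ for every } T\text{-invariant probability measure } \mu\}$, and $K^0(X,T)/\operatorname{Inf} K^0(X,T)$ is the quotient group $H(X,T)/\operatorname{Inf} H(X,T)$ with the image of $H^+(X,T)$ as positive cone and the image of $[\mathbf{1}_X]$ as unit. Unital order isomorphic means: there is a group isomorphism mapping positive cone onto positive cone and unit to unit. *)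

theory Defs
  imports
    "HOL-Probability.Probability"
    "HOL-Library.Sublist"
    "HOL-Algebra.Coset"
begin

section \<open>Unital ordered groups\<close>

text \<open>A unital ordered group is a triple of an (abelian) group, its positive cone and its
  order unit. Abelian groups are written as monoid records, so that HOL-Algebra's quotients apply;
  \<open>mult\<close> is the group addition and \<open>one\<close> is the zero element.\<close>

type_synonym 'g unital_group = "'g monoid \<times> 'g set \<times> 'g"

fun unital_quotient :: "'g unital_group \<Rightarrow> 'g set \<Rightarrow> 'g set unital_group" where
  "unital_quotient (G, P, u) N = (G Mod N, (\<lambda>g. N #>\<^bsub>G\<^esub> g) ` P, N #>\<^bsub>G\<^esub> u)"

fun unital_order_isomorphic :: "'g unital_group \<Rightarrow> 'h unital_group \<Rightarrow> bool" where
  "unital_order_isomorphic (G, P, u) (H, Q, v) \<longleftrightarrow> (\<exists>\<phi>\<in>iso G H. \<phi> ` P = Q \<and> \<phi> u = v)"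

definition real_unital_group :: "real set \<Rightarrow> real unital_group" where
  "real_unital_group J = (\<lparr>carrier = J, mult = (+), one = 0\<rparr>, {y \<in> J. y \<ge> 0}, 1)"

section \<open>Dimension groups of topological dynamical systems\<close>

text \<open>A system is a subset \<open>X\<close> of a topological space with a self-map \<open>T\<close>. Functions on \<open>X\<close> are
  extensional, so that equality of elements of \<open>C(X,\<int>)\<close> is equality on \<open>X\<close>.\<close>

definition cont_int :: "'x::topological_space set \<Rightarrow> ('x \<Rightarrow> int) monoid" where
  "cont_int X = \<lparr>carrier = {f \<in> extensional X. continuous_on X f},
     mult = (\<lambda>f g. \<lambda>x\<in>X. f x + g x), one = (\<lambda>x\<in>X. 0)\<rparr>"

definition cont_nonneg :: "'x::topological_space set \<Rightarrow> ('x \<Rightarrow> int) set" where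
  "cont_nonneg X = {f \<in> carrier (cont_int X). \<forall>x\<in>X. f x \<ge> 0}"

definition coboundaries :: "'x::topological_space set \<Rightarrow> ('x \<Rightarrow> 'x) \<Rightarrow> ('x \<Rightarrow> int) set" where
  "coboundaries X T = (\<lambda>f. \<lambda>x\<in>X. f (T x) - f x) ` carrier (cont_int X)"

definition K0 :: "'x::topological_space set \<Rightarrow> ('x \<Rightarrow> 'x) \<Rightarrow> ('x \<Rightarrow> int) set unital_group" where
  "K0 X T = unital_quotient (cont_int X, cont_nonneg X, (\<lambda>x\<in>X. 1)) (coboundaries X T)"

definition invariant_measures :: "'x::topological_space set \<Rightarrow> ('x \<Rightarrow> 'x) \<Rightarrow> 'x measure set" where
  "invariant_measures X T = {\<mu>. prob_space \<mu> \<and> sets \<mu> = sets (restrict_space borel X) \<and>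
     T \<in> measurable \<mu> \<mu> \<and> distr \<mu> \<mu> T = \<mu>}"

definition infinitesimals :: "'x::topological_space set \<Rightarrow> ('x \<Rightarrow> 'x) \<Rightarrow> ('x \<Rightarrow> int) set set" where
  "infinitesimals X T = (\<lambda>f. coboundaries X T #>\<^bsub>cont_int X\<^esub> f) `
     {f \<in> carrier (cont_int X). \<forall>\<mu>\<in>invariant_measures X T. (\<integral>x. real_of_int (f x) \<partial>\<mu>) = 0}"

definition K0_mod_Inf ::
    "'x::topological_space set \<Rightarrow> ('x \<Rightarrow> 'x) \<Rightarrow> ('x \<Rightarrow> int) set set unital_group" where
  "K0_mod_Inf X T = unital_quotient (K0 X T) (infinitesimals X T)"

section \<open>Subshifts\<close>

text \<open>Letters are natural numbers; bi-infinite sequences carry the product topology of the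
  discrete topology on \<^typ>\<open>nat\<close>.\<close>

definition shift_map :: "(int \<Rightarrow> nat) \<Rightarrow> int \<Rightarrow> nat" where
  "shift_map x = (\<lambda>i. x (i + 1))"

definition window :: "(int \<Rightarrow> nat) \<Rightarrow> int \<Rightarrow> nat \<Rightarrow> nat list" where
  "window x i k = map (\<lambda>j. x (i + int j)) [0..<k]"

definition subshift_of_words :: "nat set \<Rightarrow> nat list set \<Rightarrow> (int \<Rightarrow> nat) set" where
  "subshift_of_words A L = {x. range x \<subseteq> A \<and> (\<forall>i k. \<exists>u\<in>L. sublist (window x i k) u)}"

definition aperiodic_subshift :: "(int \<Rightarrow> nat) set \<Rightarrow> bool" where
  "aperiodic_subshift X \<longleftrightarrow> X \<noteq> {} \<and> (\<forall>x\<in>X. \<forall>p>0. (shift_map ^^ p) x \<noteq> x)"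

section \<open>Ferenczi subshifts\<close>

text \<open>Throughout, \<open>q n\<close> are the cutting parameters and \<open>a n i\<close>, for \<open>i < q n\<close>, the spacer
  parameters; values \<open>a n i\<close> with \<open>i \<ge> q n\<close> play no role.\<close>

fun gen_word :: "(nat \<Rightarrow> nat) \<Rightarrow> (nat \<Rightarrow> nat \<Rightarrow> nat) \<Rightarrow> nat \<Rightarrow> nat list" where
  "gen_word q a 0 = [0]"
| "gen_word q a (Suc n) =
     concat (map (\<lambda>i. gen_word q a n @ replicate (a n i) 1) [0..<q n]) @ gen_word q a n"

definition ferenczi_subshift :: "(nat \<Rightarrow> nat) \<Rightarrow> (nat \<Rightarrow> nat \<Rightarrow> nat) \<Rightarrow> (int \<Rightarrow> nat) set" where
  "ferenczi_subshift q a = subshift_of_words {0, 1} (range (gen_word q a))"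

definition standard_cuts :: "(nat \<Rightarrow> nat) \<Rightarrow> bool" where
  "standard_cuts q \<longleftrightarrow> (\<forall>n. q n \<ge> 2)"

definition bounded_spacers :: "(nat \<Rightarrow> nat) \<Rightarrow> (nat \<Rightarrow> nat \<Rightarrow> nat) \<Rightarrow> bool" where
  "bounded_spacers q a \<longleftrightarrow> (\<exists>M. \<forall>n. \<forall>i<q n. a n i \<le> M)"

subsection \<open>The directive sequence\<close>

fun alphabet :: "(nat \<Rightarrow> nat) \<Rightarrow> (nat \<Rightarrow> nat \<Rightarrow> nat) \<Rightarrow> nat \<Rightarrow> nat set" where
  "alphabet q a 0 = {0, 1}"
| "alphabet q a (Suc n) = {a N i | N i. N \<ge> n \<and> i < q N}"

fun tau :: "(nat \<Rightarrow> nat) \<Rightarrow> (nat \<Rightarrow> nat \<Rightarrow> nat) \<Rightarrow> nat \<Rightarrow> nat \<Rightarrow> nat list" where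
  "tau q a 0 c = 0 # replicate c 1"
| "tau q a (Suc n) c = map (a n) [1..<q n] @ [c, a n 0]"

definition tau_word ::
    "(nat \<Rightarrow> nat) \<Rightarrow> (nat \<Rightarrow> nat \<Rightarrow> nat) \<Rightarrow> nat \<Rightarrow> nat list \<Rightarrow> nat list" where
  "tau_word q a n w = concat (map (tau q a n) w)"

text \<open>\<open>tau_comp q a m N\<close> is \<open>\<tau>\<^sub>m \<circ> \<dots> \<circ> \<tau>\<^bsub>N-1\<^esub>\<close>.\<close>

definition tau_comp ::
    "(nat \<Rightarrow> nat) \<Rightarrow> (nat \<Rightarrow> nat \<Rightarrow> nat) \<Rightarrow> nat \<Rightarrow> nat \<Rightarrow> nat list \<Rightarrow> nat list" where
  "tau_comp q a m N = foldr (tau_word q a) [m..<N]"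

text \<open>From here on \<open>n0 \<ge> 1\<close> is an index from which the alphabets are constant, so that
  \<open>alphabet q a n0\<close> is the eventual alphabet.\<close>

definition stable_index :: "(nat \<Rightarrow> nat) \<Rightarrow> (nat \<Rightarrow> nat \<Rightarrow> nat) \<Rightarrow> nat \<Rightarrow> bool" where
  "stable_index q a n0 \<longleftrightarrow> n0 \<ge> 1 \<and> (\<forall>n\<ge>n0. alphabet q a n = alphabet q a n0)"

definition derived_subshift ::
    "(nat \<Rightarrow> nat) \<Rightarrow> (nat \<Rightarrow> nat \<Rightarrow> nat) \<Rightarrow> nat \<Rightarrow> (int \<Rightarrow> nat) set" where
  "derived_subshift q a n0 = subshift_of_words (alphabet q a n0)
     {tau_comp q a n0 N [c] | N c. N > n0 \<and> c \<in> alphabet q a n0}"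

text \<open>The derived subshift is uniquely ergodic, which makes the definite description meaningful.\<close>

definition mu_hat :: "(nat \<Rightarrow> nat) \<Rightarrow> (nat \<Rightarrow> nat \<Rightarrow> nat) \<Rightarrow> nat \<Rightarrow> (int \<Rightarrow> nat) measure" where
  "mu_hat q a n0 = (THE \<mu>. \<mu> \<in> invariant_measures (derived_subshift q a n0) shift_map)"

subsection \<open>The subgroup of the reals\<close>

text \<open>Vectors indexed by the eventual alphabet are functions on \<^typ>\<open>nat\<close> of which only the values
  on the alphabet matter. The distinguished last coordinate is the least letter.\<close>

definition min_letter :: "(nat \<Rightarrow> nat) \<Rightarrow> (nat \<Rightarrow> nat \<Rightarrow> nat) \<Rightarrow> nat \<Rightarrow> nat" where
  "min_letter q a n0 = Min (alphabet q a n0)"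

definition dot :: "nat set \<Rightarrow> (nat \<Rightarrow> real) \<Rightarrow> (nat \<Rightarrow> real) \<Rightarrow> real" where
  "dot A x y = (\<Sum>c\<in>A. x c * y c)"

definition z_vec :: "(nat \<Rightarrow> nat) \<Rightarrow> (nat \<Rightarrow> nat \<Rightarrow> nat) \<Rightarrow> nat \<Rightarrow> nat \<Rightarrow> real" where
  "z_vec q a n0 c = (if c = min_letter q a n0 then 1
     else measure (mu_hat q a n0) {x \<in> derived_subshift q a n0. x 0 = c})"

definition u_vec :: "(nat \<Rightarrow> nat) \<Rightarrow> (nat \<Rightarrow> nat \<Rightarrow> nat) \<Rightarrow> nat \<Rightarrow> nat \<Rightarrow> real" where
  "u_vec q a n0 c = (if c = min_letter q a n0
     then real (min_letter q a n0) + real (length (gen_word q a (n0 - 1)))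
     else real c - real (min_letter q a n0))"

definition z_tilde :: "(nat \<Rightarrow> nat) \<Rightarrow> (nat \<Rightarrow> nat \<Rightarrow> nat) \<Rightarrow> nat \<Rightarrow> nat \<Rightarrow> real" where
  "z_tilde q a n0 = (THE v. (\<exists>r. v = (\<lambda>c. r * z_vec q a n0 c)) \<and>
     dot (alphabet q a n0) (u_vec q a n0) v = 1)"

text \<open>\<open>fraction_group c N\<close> is \<open>\<int>[(c\<^sub>n)\<^bsub>n \<ge> N\<^esub>]\<close>.\<close>

definition fraction_group :: "(nat \<Rightarrow> nat) \<Rightarrow> nat \<Rightarrow> real set" where
  "fraction_group c N = {real_of_int m / (\<Prod>j=N..n. real (c j)) | m n. n \<ge> N}"

definition G_group :: "(nat \<Rightarrow> nat) \<Rightarrow> (nat \<Rightarrow> nat \<Rightarrow> nat) \<Rightarrow> nat \<Rightarrow> (nat \<Rightarrow> real) set" where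
  "G_group q a n0 = (\<Pi>\<^sub>E c\<in>alphabet q a n0.
     if c = min_letter q a n0 then fraction_group (\<lambda>n. q n + 1) (n0 - 1) else \<int>)"

definition J_group :: "(nat \<Rightarrow> nat) \<Rightarrow> (nat \<Rightarrow> nat \<Rightarrow> nat) \<Rightarrow> nat \<Rightarrow> real set" where
  "J_group q a n0 = (\<lambda>x. dot (alphabet q a n0) x (z_tilde q a n0)) ` G_group q a n0"

end

theory Submission
  imports Defs
begin

text \<open>Every point of the Ferenczi subshift is, at each level \<open>n\<close>, a concatenation of copies of
  \<open>w\<^sub>n\<close> separated by spacers, and in terms of the spacers at level \<open>0\<close> the cutting points at
  level \<open>n\<close> form a residue class modulo \<open>Q\<^sub>n = (q\<^sub>0 + 1) \<cdots> (q\<^bsub>n-1\<^esub> + 1)\<close>. Two different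
  residue classes would force the point to be periodic, so aperiodicity gives clopen tower bases
  \<open>B\<^sub>n(c)\<close>, indexed by the spacer \<open>c\<close> that follows \<open>w\<^sub>n\<close>. Summing along the towers, the integral of a
  continuous integer function is an integer combination of the numbers \<open>\<mu>(B\<^sub>n(c))\<close> for all large
  \<open>n\<close>, and the relations \<open>\<mu>(B\<^sub>m) = Q\<^bsub>m,n\<^esub> \<mu>(B\<^sub>n)\<close> and
  \<open>\<mu>(B\<^sub>m(c)) = K\<^bsub>m,n\<^esub>(c) \<mu>(B\<^sub>n) + \<mu>(B\<^sub>n(c))\<close>, where \<open>K\<^bsub>m,n\<^esub>(c)\<close> counts spacers \<open>c\<close>, determine
  these numbers. Points of the derived subshift have the same hierarchical structure, whence its
  unique ergodicity and \<open>\<mu>(B\<^sub>m(c)) / \<mu>(B\<^sub>m)\<close> as the measure of the letter \<open>c\<close>. The isomorphism sends a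
  class to its integral.\<close>

section \<open>Limits of probability measures on sequences\<close>

text \<open>With \<open>n0 = Suc m\<close>, Kac's formula for the constant 1 says that the class
  measures at level \<open>m\<close>, weighted by the tower heights
  \<open>word_length m + c\<close>, sum to 1. Divided by \<open>base_measure \<mu> m\<close> this is
  the scalar product of \<open>u_vec\<close> and \<open>z_vec\<close>, so \<open>z_tilde\<close> has
  the entry \<open>base_measure \<mu> m\<close> at the least letter and
  \<open>class_measure \<mu> m c\<close> at every other letter \<open>c\<close>. One class may be
  dropped because the class measures add up to the measure of the base. Passing to a deeper level
  \<open>n\<close> changes a class measure by an integer multiple of
  \<open>base_measure \<mu> n = base_measure \<mu> m / Q m n\<close>; hence only the last coordinate
  carries denominators, and they are the partial products of the numbers \<open>q j + 1\<close>. The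
  delicate point is the order: a function with positive integral can take negative values, and it
  must be replaced by a nonnegative one with the same integral. Infinitesimals are the kernel of
  integration against a single invariant measure because the integrals of continuous integer
  functions do not depend on the measure.\<close>

lemma compact_PiE_UNIV:
  fixes K :: "'i \<Rightarrow> 'a::topological_space set"
  assumes "\<And>i. compact (K i)"
  shows "compact (PiE UNIV K)"
proof -
  have "compactin (product_topology (\<lambda>i. euclidean) UNIV) (PiE UNIV K)"
    using assms by (simp add: compactin_PiE)
  then show ?thesis
    by (simp add: euclidean_product_topology)
qed

text \<open>A common finite support keeps mass from escaping, so the pointwise limit still sums to
  1; the probability of any event is then a finite sum of convergent terms.\<close>

lemma pmf_limit:
  fixes p :: "nat \<Rightarrow> 'b pmf"
  assumes fin: "finite S" and supp: "\<And>n. set_pmf (p n) \<subseteq> S"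
    and conv: "\<And>x. x \<in> S \<Longrightarrow> convergent (\<lambda>n. pmf (p n) x)"
  obtains P where "set_pmf P \<subseteq> S" "\<And>E. (\<lambda>n. measure (p n) E) \<longlonglongrightarrow> measure P E"
proof -
  define f where "f x = (if x \<in> S then lim (\<lambda>n. pmf (p n) x) else 0)" for x
  have lim: "(\<lambda>n. pmf (p n) x) \<longlonglongrightarrow> f x" for x
  proof (cases "x \<in> S")
    case True
    then show ?thesis using conv[OF True] by (simp add: f_def convergent_LIMSEQ_iff)
  next
    case False
    then have "pmf (p n) x = 0" for n
      using supp[of n] by (auto simp: pmf_eq_0_set_pmf)
    then show ?thesis using False by (simp add: f_def)
  qed
  have nonneg: "0 \<le> f x" for x
    by (rule LIMSEQ_le_const[OF lim]) (auto intro!: exI[of _ 0])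
  have "(\<lambda>n. \<Sum>x\<in>S. pmf (p n) x) \<longlonglongrightarrow> (\<Sum>x\<in>S. f x)"
    by (intro tendsto_sum lim)
  moreover have "(\<Sum>x\<in>S. pmf (p n) x) = 1" for n
    using sum_pmf_eq_1[OF fin supp] .
  ultimately have sum1: "(\<Sum>x\<in>S. f x) = 1"
    using LIMSEQ_unique[of "\<lambda>n. \<Sum>x\<in>S. pmf (p n) x" 1] by simp
  have nn: "(\<integral>\<^sup>+x. ennreal (f x) \<partial>count_space UNIV) = 1"
  proof -
    have "(\<integral>\<^sup>+x. ennreal (f x) \<partial>count_space UNIV) = (\<Sum>x\<in>S. ennreal (f x))"
      by (rule nn_integral_count_space') (auto simp: f_def fin)
    also have "\<dots> = ennreal (\<Sum>x\<in>S. f x)"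
      by (rule sum_ennreal) (rule nonneg)
    finally show ?thesis by (simp add: sum1)
  qed
  define P where "P = embed_pmf f"
  have pmfP: "pmf P x = f x" for x
    unfolding P_def by (rule pmf_embed_pmf[OF nonneg nn])
  have suppP: "set_pmf P \<subseteq> S"
    by (auto simp: set_pmf_eq pmfP f_def split: if_splits)
  have meas: "measure (p' :: 'b pmf) E = (\<Sum>x\<in>S \<inter> E. pmf p' x)" if "set_pmf p' \<subseteq> S" for p' E
  proof -
    have "measure p' E = measure p' (S \<inter> E)"
      using that by (intro measure_eq_AE) (auto simp: AE_measure_pmf_iff)
    then show ?thesis using fin by (simp add: measure_measure_pmf_finite)
  qed
  have "(\<lambda>n. measure (p n) E) \<longlonglongrightarrow> measure P E" for E
    unfolding meas[OF supp] meas[OF suppP] pmfP by (intro tendsto_sum lim)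
  with suppP show ?thesis by (rule that)
qed

text \<open>Kolmogorov's extension theorem for integer-indexed sequences of naturals. The marginals
  are carried to real sequences by \<open>real\<close>, extended there, and the limit measure is
  brought back by rounding down each coordinate.\<close>

lemma projective_family_of_pmfs:
  fixes Q :: "int set \<Rightarrow> (int \<Rightarrow> nat) pmf"
  assumes supp: "\<And>J. finite J \<Longrightarrow> set_pmf (Q J) \<subseteq> extensional J"
    and consistent: "\<And>J H. finite H \<Longrightarrow> J \<subseteq> H \<Longrightarrow> map_pmf (\<lambda>g. restrict g J) (Q H) = Q J"
  shows "\<exists>M. prob_space M \<and> sets M = sets (PiM UNIV (\<lambda>_. count_space UNIV)) \<and>
    (\<forall>J S. finite J \<longrightarrow> measure M {x. restrict x J \<in> S} = measure (Q J) S)"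
proof -
  define P where "P J = distr (measure_pmf (Q J)) (PiM J (\<lambda>_. borel :: real measure))
    (\<lambda>g. \<lambda>i\<in>J. real (g i))" for J
  have meas_emb: "(\<lambda>g. \<lambda>i\<in>J. real (g i)) \<in> measurable (measure_pmf p) (PiM J (\<lambda>_. borel :: real measure))"
    for J and p :: "(int \<Rightarrow> nat) pmf"
    by (intro measurable_restrict) simp
  interpret polish_projective UNIV P
  proof (intro polish_projective.intro projective_family.intro)
    show "P J = distr (P H) (PiM J (\<lambda>_. borel)) (\<lambda>f. restrict f J)"
      if "J \<subseteq> H" "finite H" for J H
    proof -
      have "distr (P H) (PiM J (\<lambda>_. borel)) (\<lambda>f. restrict f J)
          = distr (measure_pmf (Q H)) (PiM J (\<lambda>_. borel)) ((\<lambda>f. restrict f J) \<circ> (\<lambda>g. \<lambda>i\<in>H. real (g i)))"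
        unfolding P_def using that
        by (intro distr_distr meas_emb measurable_restrict_subset) auto
      also have "(\<lambda>f. restrict f J) \<circ> (\<lambda>g. \<lambda>i\<in>H. real (g i))
          = (\<lambda>g. \<lambda>i\<in>J. real (g i)) \<circ> (\<lambda>g::int \<Rightarrow> nat. restrict g J)"
        using that by (auto simp: fun_eq_iff restrict_def)
      also have "distr (measure_pmf (Q H)) (PiM J (\<lambda>_. borel :: real measure)) \<dots> = P J"
        unfolding P_def consistent[OF that(2,1), symmetric] map_pmf_rep_eq
        by (subst distr_distr) (auto intro!: measurable_restrict simp: space_PiM)
      finally show ?thesis by (rule sym)
    qed
    show "prob_space (P J)" if "finite J" for J
      unfolding P_def by (intro measure_pmf.prob_space_distr meas_emb)
  qed
  define M where "M = distr lim (PiM UNIV (\<lambda>_. count_space UNIV)) (\<lambda>x i. nat \<lfloor>x i\<rfloor>)"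
  have floor_meas: "(\<lambda>x::int \<Rightarrow> real. nat \<lfloor>x i\<rfloor>) \<in> measurable (PiM J (\<lambda>_. borel)) (count_space UNIV)"
    if "i \<in> J" for i J
  proof -
    have "(\<lambda>x::int \<Rightarrow> real. \<lfloor>x i\<rfloor>) \<in> measurable (PiM J (\<lambda>_. borel)) (count_space UNIV)"
      using that by measurable
    then show ?thesis by measurable
  qed
  have meas1: "(\<lambda>x i. nat \<lfloor>x i\<rfloor>) \<in> measurable lim (PiM UNIV (\<lambda>_. count_space UNIV))"
    unfolding measurable_cong_sets[OF sets_lim refl]
    using floor_meas by (intro measurable_PiM_single') (auto simp: space_PiM)
  have "prob_space M"
    unfolding M_def by (intro P.prob_space_distr meas1)
  moreover have "sets M = sets (PiM UNIV (\<lambda>_. count_space UNIV))"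
    by (simp add: M_def)
  moreover have "measure M {x. restrict x J \<in> S} = measure (Q J) S" if J: "finite J" for J S
  proof -
    have fmJ: "(\<lambda>x::int \<Rightarrow> real. \<lambda>i\<in>J. nat \<lfloor>x i\<rfloor>) \<in> measurable (PiM J (\<lambda>_. borel)) (PiM J (\<lambda>_. count_space UNIV))"
      by (intro measurable_restrict floor_meas)
    have SJ: "S \<inter> PiE J (\<lambda>_. UNIV) \<in> sets (PiM J (\<lambda>_. count_space (UNIV :: nat set)))"
      by (subst count_space_PiM_finite[OF J]) auto
    define Y where "Y = (\<lambda>x. \<lambda>i\<in>J. nat \<lfloor>x i\<rfloor>) -` (S \<inter> PiE J (\<lambda>_. UNIV)) \<inter> space (PiM J (\<lambda>_. borel :: real measure))"
    have Y: "Y \<in> sets (PiM J (\<lambda>_. borel))"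
      unfolding Y_def by (rule measurable_sets[OF fmJ SJ])
    have restr: "(\<lambda>x. restrict x J) \<in> measurable (PiM UNIV (\<lambda>_. count_space UNIV)) (PiM J (\<lambda>_. count_space (UNIV :: nat set)))"
      by (intro measurable_restrict_subset) auto
    have E: "{x. restrict x J \<in> S} \<in> sets (PiM UNIV (\<lambda>_. count_space (UNIV::nat set)))"
      using measurable_sets[OF restr SJ] by (simp add: space_PiM vimage_def Int_def) 
    have "measure M {x. restrict x J \<in> S} = measure lim (emb UNIV J Y)"
      unfolding M_def
      by (subst measure_distr[OF meas1 E])
         (auto intro!: arg_cong[where f="measure lim"] simp: Y_def prod_emb_def space_PiM PiE_def extensional_def restrict_def cong: if_cong)
    also have "\<dots> = measure (P J) Y"
      by (rule measure_lim_emb) (use J Y in auto)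
    also have "\<dots> = measure (Q J) ((\<lambda>g. \<lambda>i\<in>J. real (g i)) -` Y)"
      unfolding P_def by (subst measure_distr[OF meas_emb Y]) simp
    also have "\<dots> = measure (Q J) S"
    proof (rule measure_eq_AE)
      show "AE x in measure_pmf (Q J). (x \<in> (\<lambda>g. \<lambda>i\<in>J. real (g i)) -` Y) = (x \<in> S)"
      proof (rule AE_pmfI)
        fix g assume "g \<in> set_pmf (Q J)"
        then have "g \<in> extensional J" using supp[OF J] by auto
        then have "(\<lambda>i\<in>J. nat \<lfloor>(\<lambda>i\<in>J. real (g i)) i\<rfloor>) = g"
          by (auto simp: fun_eq_iff extensional_def)
        then show "(g \<in> (\<lambda>g. \<lambda>i\<in>J. real (g i)) -` Y) = (g \<in> S)"
          using \<open>g \<in> extensional J\<close> by (simp add: Y_def space_PiM PiE_def Pi_def)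
      qed
    qed auto
    finally show ?thesis .
  qed
  ultimately show ?thesis by blast
qed

text \<open>The cylinder probabilities of one measure form a point of a power of the unit interval
  with a countable index set. Such a power is sequentially compact, and the limit along a convergent
  subsequence yields consistent marginals, supported on finite patterns over
  \<open>A\<close>.\<close>

lemma subsequential_limit_measure:
  fixes p :: "nat \<Rightarrow> (int \<Rightarrow> nat) pmf"
  assumes A: "finite A" and supp: "\<And>n. set_pmf (p n) \<subseteq> {x. range x \<subseteq> A}"
  obtains r M where "strict_mono (r :: nat \<Rightarrow> nat)" "prob_space M"
    "sets M = sets (PiM UNIV (\<lambda>_. count_space UNIV))"
    "\<And>J S. finite J \<Longrightarrow>
      (\<lambda>n. measure (p (r n)) {x. restrict x J \<in> S}) \<longlonglongrightarrow> measure M {x. restrict x J \<in> S}"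
proof -
  define F :: "nat \<Rightarrow> int list \<times> nat list \<Rightarrow> real"
    where "F n = (\<lambda>(js, us). measure (p n) {x. map x js = us})" for n
  have "compact (PiE UNIV (\<lambda>_ :: int list \<times> nat list. {0..1::real}))"
    by (rule compact_PiE_UNIV) simp
  then have "seq_compact (PiE UNIV (\<lambda>_ :: int list \<times> nat list. {0..1::real}))"
    by (rule compact_imp_seq_compact)
  moreover have "\<forall>n. F n \<in> PiE UNIV (\<lambda>_. {0..1})"
    by (auto simp: F_def)
  ultimately obtain l r where r: "strict_mono (r :: nat \<Rightarrow> nat)" and l: "(F \<circ> r) \<longlonglongrightarrow> l"
    by (rule seq_compactE)
  have conv: "(\<lambda>n. F (r n) i) \<longlonglongrightarrow> l i" for i
  proof -
    have "isCont (\<lambda>f :: int list \<times> nat list \<Rightarrow> real. f i) l"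
      by (metis continuous_on_eq_continuous_at continuous_on_product_coordinates iso_tuple_UNIV_I open_UNIV)
    from isCont_tendsto_compose[OF this l] show ?thesis by (simp add: o_def)
  qed
  define q where "q J n = map_pmf (\<lambda>x. restrict x J) (p (r n))" for J n
  have ex: "\<exists>Q. set_pmf Q \<subseteq> PiE J (\<lambda>_. A) \<and> (\<forall>E. (\<lambda>n. measure (q J n) E) \<longlonglongrightarrow> measure Q E)"
    if J: "finite J" for J
  proof -
    have sq: "set_pmf (q J n) \<subseteq> PiE J (\<lambda>_. A)" for n
      using supp[of "r n"] by (fastforce simp: q_def)
    have "convergent (\<lambda>n. pmf (q J n) g)" if g: "g \<in> PiE J (\<lambda>_. A)" for g
    proof -
      \<comment> \<open>Listing \<open>J\<close> turns the fibre of the restriction map over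
        \<open>g\<close> into one of the cylinders recorded by \<open>F\<close>.\<close>
      define js where "js = sorted_list_of_set J"
      have js: "set js = J" using J by (simp add: js_def)
      have "pmf (q J n) g = F (r n) (js, map g js)" for n
      proof -
        have "pmf (q J n) g = measure (p (r n)) ((\<lambda>x. restrict x J) -` {g})"
          by (simp add: q_def pmf_map)
        also have "(\<lambda>x. restrict x J) -` {g} = {x. map x js = map g js}"
          using g js by (fastforce simp: fun_eq_iff PiE_def extensional_def restrict_def)
        finally show ?thesis by (simp add: F_def)
      qed
      then show ?thesis
        using conv[of "(js, map g js)"] by (auto simp: convergent_def)
    qed
    note cv = this
    show ?thesis
      by (rule pmf_limit[where p = "q J", OF finite_PiE[OF J A] sq cv]) blast+
  qed
  then obtain Q where Q: "\<And>J. finite J \<Longrightarrow> set_pmf (Q J) \<subseteq> PiE J (\<lambda>_. A)"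
    "\<And>J E. finite J \<Longrightarrow> (\<lambda>n. measure (q J n) E) \<longlonglongrightarrow> measure (Q J) E"
    by metis
  have Qmap: "map_pmf (\<lambda>g. restrict g J) (Q H) = Q J" if "finite H" "J \<subseteq> H" for H J
  proof (rule pmf_eqI)
    fix g
    have "finite J" using that finite_subset by auto
    have "(\<lambda>n. measure (q H n) ((\<lambda>g. restrict g J) -` {g})) \<longlonglongrightarrow> measure (Q H) ((\<lambda>g. restrict g J) -` {g})"
      by (rule Q(2)) fact
    moreover have "measure (q H n) ((\<lambda>g. restrict g J) -` {g}) = measure (q J n) {g}" for n
      using that(2) by (simp add: q_def vimage_def Int_absorb1)
    ultimately have "measure (Q H) ((\<lambda>g. restrict g J) -` {g}) = measure (Q J) {g}"
      using Q(2)[OF \<open>finite J\<close>, of "{g}"] by (simp add: LIMSEQ_unique)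
    then show "pmf (map_pmf (\<lambda>g. restrict g J) (Q H)) g = pmf (Q J) g"
      by (simp add: pmf_map measure_pmf_single)
  qed
  have "set_pmf (Q J) \<subseteq> extensional J" if "finite J" for J
    using Q(1)[OF that] by (auto simp: PiE_def)
  from projective_family_of_pmfs[of Q, OF this Qmap] obtain M where M: "prob_space M"
    "sets M = sets (PiM UNIV (\<lambda>_. count_space UNIV))"
    "\<And>J S. finite J \<Longrightarrow> measure M {x. restrict x J \<in> S} = measure (Q J) S"
    by blast
  have "(\<lambda>n. measure (p (r n)) {x. restrict x J \<in> S}) \<longlonglongrightarrow> measure M {x. restrict x J \<in> S}"
    if "finite J" for J S
    using Q(2)[OF that, of S] by (simp add: q_def vimage_def M(3)[OF that])
  with r M(1,2) show ?thesis by (rule that)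
qed

section \<open>Local functions and invariant measures\<close>

definition agree :: "nat \<Rightarrow> (int \<Rightarrow> nat) \<Rightarrow> (int \<Rightarrow> nat) \<Rightarrow> bool" where
  "agree R x y \<longleftrightarrow> (\<forall>i. \<bar>i\<bar> \<le> int R \<longrightarrow> x i = y i)"

text \<open>The radius is uniform over \<open>X\<close>. On a compact \<open>X\<close> these are the
  continuous functions into a discrete type, and uniform radii make closure under combinations and
  shifts immediate.\<close>

definition local_on :: "(int \<Rightarrow> nat) set \<Rightarrow> ((int \<Rightarrow> nat) \<Rightarrow> 'b) \<Rightarrow> bool" where
  "local_on X f \<longleftrightarrow> (\<exists>R. \<forall>x\<in>X. \<forall>y\<in>X. agree R x y \<longrightarrow> f x = f y)"

definition shiftz :: "int \<Rightarrow> (int \<Rightarrow> nat) \<Rightarrow> int \<Rightarrow> nat" where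
  "shiftz k x = (\<lambda>i. x (i + k))"

lemma shiftz_apply [simp]: "shiftz k x i = x (i + k)"
  by (simp add: shiftz_def)

lemma shiftz_shiftz [simp]: "shiftz k (shiftz l x) = shiftz (k + l) x"
  by (simp add: shiftz_def add.assoc)

lemma shiftz_0 [simp]: "shiftz 0 x = x"
  by (simp add: shiftz_def)

lemma shift_map_eq_shiftz: "shift_map = shiftz 1"
  by (simp add: shift_map_def shiftz_def fun_eq_iff)

lemma shift_map_funpow: "(shift_map ^^ n) x = shiftz (int n) x"
  by (induction n) (simp_all add: shift_map_def shiftz_def ac_simps)

lemma window_shiftz: "window (shiftz k x) i l = window x (i + k) l"
  by (simp add: window_def algebra_simps)

lemma shiftz_in_subshift: "x \<in> subshift_of_words A L \<Longrightarrow> shiftz k x \<in> subshift_of_words A L"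
  by (auto simp: subshift_of_words_def window_shiftz)

lemma agree_mono: "agree R x y \<Longrightarrow> R' \<le> R \<Longrightarrow> agree R' x y"
  by (auto simp: agree_def)

lemma agree_refl [simp]: "agree R x x"
  by (simp add: agree_def)

lemma agree_trans: "agree R x y \<Longrightarrow> agree R y z \<Longrightarrow> agree R x z"
  by (simp add: agree_def)

lemma local_onI: "(\<And>x y. x \<in> X \<Longrightarrow> y \<in> X \<Longrightarrow> agree R x y \<Longrightarrow> f x = f y) \<Longrightarrow> local_on X f"
  unfolding local_on_def by blast

lemma local_on_const [simp, intro]: "local_on X (\<lambda>x. c)"
  by (simp add: local_on_def)

lemma local_on_coord [simp, intro]: "local_on X (\<lambda>x. x i)"
  by (rule local_onI[of X "nat \<bar>i\<bar>"]) (auto simp: agree_def)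

lemma local_on_comp2:
  assumes "local_on X f" "local_on X g"
  shows "local_on X (\<lambda>x. h (f x) (g x))"
proof -
  from assms obtain R1 R2 where
    R: "\<And>x y. x \<in> X \<Longrightarrow> y \<in> X \<Longrightarrow> agree R1 x y \<Longrightarrow> f x = f y"
       "\<And>x y. x \<in> X \<Longrightarrow> y \<in> X \<Longrightarrow> agree R2 x y \<Longrightarrow> g x = g y"
    unfolding local_on_def by blast
  show ?thesis
  proof (rule local_onI[of X "max R1 R2"])
    fix x y assume "x \<in> X" "y \<in> X" "agree (max R1 R2) x y"
    with R[of x y] show "h (f x) (g x) = h (f y) (g y)"
      using agree_mono by (metis max.cobounded1 max.cobounded2)
  qed
qed

lemma local_on_comp: "local_on X f \<Longrightarrow> local_on X (\<lambda>x. h (f x))"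
  using local_on_comp2[of X f f "\<lambda>a _. h a"] by simp

lemma local_on_shiftz:
  assumes "local_on X f" "\<And>x. x \<in> X \<Longrightarrow> shiftz k x \<in> X"
  shows "local_on X (\<lambda>x. f (shiftz k x))"
proof -
  from assms(1) obtain R where
    R: "\<And>x y. x \<in> X \<Longrightarrow> y \<in> X \<Longrightarrow> agree R x y \<Longrightarrow> f x = f y"
    unfolding local_on_def by blast
  show ?thesis
    by (rule local_onI[of X "R + nat \<bar>k\<bar>"]) (auto intro!: R assms(2) simp: agree_def)
qed

lemma local_on_window [simp, intro]: "local_on X (\<lambda>x. window x i l)"
  by (rule local_onI[of X "nat \<bar>i\<bar> + l"]) (auto simp: window_def agree_def)

lemma open_agree: "open {y. agree R x y}"
proof -
  have "open ((\<lambda>y::int \<Rightarrow> nat. y i) -` {x i})" for i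
    by (rule open_vimage) (simp_all add: Topological_Spaces.open_discrete)
  then have "open (\<Inter>i\<in>{- int R..int R}. (\<lambda>y. y i) -` {x i})"
    by (intro open_INT) auto
  also have "(\<Inter>i\<in>{- int R..int R}. (\<lambda>y. y i) -` {x i}) = {y. agree R x y}"
    by (auto simp: agree_def abs_le_iff)
  finally show ?thesis .
qed

lemma local_on_vimage_open:
  assumes "local_on X f"
  shows "\<exists>U. open U \<and> f -` V \<inter> X = U \<inter> X"
proof -
  from assms obtain R where
    R: "\<And>x y. x \<in> X \<Longrightarrow> y \<in> X \<Longrightarrow> agree R x y \<Longrightarrow> f x = f y"
    unfolding local_on_def by blast
  let ?U = "\<Union>x\<in>f -` V \<inter> X. {y. agree R x y}"
  have "open ?U"
    by (intro open_UN ballI open_agree)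
  moreover have "f -` V \<inter> X = ?U \<inter> X"
  proof (intro equalityI subsetI)
    fix y assume "y \<in> ?U \<inter> X"
    then obtain x where "x \<in> X" "f x \<in> V" "agree R x y" "y \<in> X" by blast
    with R[of x y] show "y \<in> f -` V \<inter> X" by simp
  qed (use agree_refl in blast)
  ultimately show ?thesis by blast
qed

lemma local_on_measurable:
  assumes "local_on X f"
  shows "f \<in> measurable (restrict_space borel X) (count_space UNIV)"
proof (rule measurableI)
  fix V
  obtain U where U: "open U" "f -` V \<inter> X = U \<inter> X"
    using local_on_vimage_open[OF assms] by blast
  have "X \<inter> U \<in> sets (restrict_space borel X)"
    using U(1) by (auto simp: sets_restrict_space)
  then show "f -` V \<inter> space (restrict_space borel X) \<in> sets (restrict_space borel X)"
    using U(2) by (simp add: space_restrict_space Int_commute)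
qed simp

section \<open>Measures determined by events on finitely many coordinates\<close>

lemma local_event_measurable: "local_on UNIV P \<Longrightarrow> {x. P x} \<in> sets borel"
  using local_on_vimage_open[of UNIV P "{True}"] by (auto simp: vimage_def)

lemma sets_PiM_sequences: "sets (PiM UNIV (\<lambda>_. count_space UNIV)) = sets (borel :: (int \<Rightarrow> nat) measure)"
  unfolding sets_PiM_equal_borel[symmetric]
  by (rule sets_PiM_cong) (auto simp: sets_borel_eq_count_space)

lemma local_on_restrict:
  assumes "finite J"
  shows "local_on UNIV (\<lambda>x. restrict x J \<in> S)"
proof -
  have "local_on UNIV (\<lambda>x. restrict x J)"
  proof (rule local_onI[of _ "nat (\<Sum>j\<in>J. \<bar>j\<bar>)"])
    fix x y :: "int \<Rightarrow> nat" assume a: "agree (nat (\<Sum>j\<in>J. \<bar>j\<bar>)) x y"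
    have "\<bar>i\<bar> \<le> (\<Sum>j\<in>J. \<bar>j\<bar>)" if "i \<in> J" for i
      using assms that by (intro member_le_sum) auto
    then show "restrict x J = restrict y J"
      using a by (auto simp: agree_def fun_eq_iff sum_nonneg)
  qed
  from local_on_comp[OF this, of "\<lambda>g. g \<in> S"] show ?thesis .
qed

lemma local_event_eq_restrict:
  assumes "local_on UNIV P"
  obtains J S where "finite J" "{x. P x} = {x. restrict x J \<in> S}"
proof -
  from assms obtain R where R: "\<And>x y. agree R x y \<Longrightarrow> P x = P y"
    unfolding local_on_def by blast
  let ?J = "{- int R..int R}"
  have "{x. P x} = {x. restrict x ?J \<in> (\<lambda>x. restrict x ?J) ` {x. P x}}"
  proof (intro equalityI subsetI)
    fix x assume "x \<in> {x. restrict x ?J \<in> (\<lambda>x. restrict x ?J) ` {x. P x}}"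
    then obtain y where y: "P y" "restrict x ?J = restrict y ?J" by auto
    have "agree R x y"
      unfolding agree_def
    proof (intro allI impI)
      fix i assume "\<bar>i\<bar> \<le> int R"
      then show "x i = y i" using fun_cong[OF y(2), of i] by (auto simp: restrict_def split: if_splits)
    qed
    with R y show "x \<in> {x. P x}" by auto
  qed auto
  then show ?thesis by (intro that[of ?J]) auto
qed

lemma measure_eqI_local:
  assumes M: "prob_space M" "sets M = sets borel" and N: "prob_space N" "sets N = sets borel"
    and eq: "\<And>P. local_on UNIV P \<Longrightarrow> measure M {x. P x} = measure N {x. P x}"
  shows "M = (N :: (int \<Rightarrow> nat) measure)"
proof -
  interpret M: prob_space M by (rule M)
  interpret N: prob_space N by (rule N)
  show ?thesis
  proof (rule measure_eqI_PiM_infinite[of M UNIV "\<lambda>_ :: int. count_space (UNIV :: nat set)"])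
    show "sets M = sets (PiM UNIV (\<lambda>_. count_space UNIV))" "sets N = sets (PiM UNIV (\<lambda>_. count_space UNIV))"
      by (simp_all add: M N sets_PiM_sequences)
    show "finite_measure M" by unfold_locales
    fix A :: "int \<Rightarrow> nat set" and J :: "int set" assume "finite J"
    have "prod_emb UNIV (\<lambda>_. count_space UNIV) J (Pi\<^sub>E J A) = {x. restrict x J \<in> PiE J A}"
      by (auto simp: prod_emb_def)
    then show "emeasure M (prod_emb UNIV (\<lambda>_. count_space UNIV) J (Pi\<^sub>E J A))
      = emeasure N (prod_emb UNIV (\<lambda>_. count_space UNIV) J (Pi\<^sub>E J A))"
      using eq[OF local_on_restrict[OF \<open>finite J\<close>, of "PiE J A"]]
      by (simp add: M.emeasure_eq_measure N.emeasure_eq_measure)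
  qed
qed

text \<open>Both measures are pushed forward along the inclusion into the space of all sequences,
  where the cylinders form an intersection-stable generator. A measurable subset of \<open>X\<close>
  is the trace of a Borel set, so nothing is lost on the way back.\<close>

lemma invariant_measures_eqI:
  assumes mu: "\<mu> \<in> invariant_measures X T" and nu: "\<nu> \<in> invariant_measures X T"
    and eq: "\<And>P. local_on UNIV P \<Longrightarrow> measure \<mu> {x \<in> X. P x} = measure \<nu> {x \<in> X. P x}"
  shows "\<mu> = (\<nu> :: (int \<Rightarrow> nat) measure)"
proof -
  have sp: "space \<mu>' = X" "sets \<mu>' = sets (restrict_space borel X)" "prob_space \<mu>'"
    if "\<mu>' \<in> invariant_measures X T" for \<mu>' :: "(int \<Rightarrow> nat) measure"
    using that sets_eq_imp_space_eq[of \<mu>' "restrict_space borel X"]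
    by (auto simp: invariant_measures_def space_restrict_space)
  have id: "(\<lambda>x. x) \<in> measurable \<mu>' borel" if "\<mu>' \<in> invariant_measures X T"
    for \<mu>' :: "(int \<Rightarrow> nat) measure"
    unfolding measurable_cong_sets[OF sp(2)[OF that] refl] by (rule measurable_restrict_space1) simp
  have em: "emeasure (distr \<mu>' borel (\<lambda>x. x)) B = emeasure \<mu>' (B \<inter> X)"
    if "\<mu>' \<in> invariant_measures X T" "B \<in> sets borel" for \<mu>' :: "(int \<Rightarrow> nat) measure" and B
    using emeasure_distr[OF id[OF that(1)] that(2)] sp(1)[OF that(1)] by simp
  have "distr \<mu> borel (\<lambda>x. x) = distr \<nu> borel (\<lambda>x. x)"
  proof (rule measure_eqI_local)
    show "prob_space (distr \<mu> borel (\<lambda>x. x))" "prob_space (distr \<nu> borel (\<lambda>x. x))"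
      using mu nu sp(3) id by (auto intro!: prob_space.prob_space_distr)
    fix P :: "(int \<Rightarrow> nat) \<Rightarrow> bool" assume P: "local_on UNIV P"
    show "measure (distr \<mu> borel (\<lambda>x. x)) {x. P x} = measure (distr \<nu> borel (\<lambda>x. x)) {x. P x}"
      using eq[OF P] em[OF mu local_event_measurable[OF P]] em[OF nu local_event_measurable[OF P]]
      by (simp add: measure_def Int_def conj_commute)
  qed simp_all
  then have "emeasure \<mu> (B \<inter> X) = emeasure \<nu> (B \<inter> X)" if "B \<in> sets borel" for B
    using em[OF mu that] em[OF nu that] by simp
  then show ?thesis
    by (intro measure_eqI) (auto simp: sp(2)[OF mu] sp(2)[OF nu] sets_restrict_space Int_commute)
qed

lemma restrict_invariant_measure:
  assumes M: "prob_space M" "sets M = sets borel" and inv: "distr M borel shift_map = M"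
    and X: "X \<in> sets borel" "AE x in M. x \<in> X" "\<And>x. x \<in> X \<Longrightarrow> shift_map x \<in> X"
  shows "restrict_space M X \<in> invariant_measures X shift_map"
proof -
  interpret M: prob_space M by (rule M)
  have spM: "space M = UNIV" using sets_eq_imp_space_eq[OF M(2)] by simp
  have XM: "X \<in> sets M" using X M by simp
  have Xn: "X \<inter> space M \<in> sets M" using X M by auto
  let ?N = "restrict_space M X"
  have spN: "space ?N = X" by (simp add: space_restrict_space spM)
  have setsN: "sets ?N = sets (restrict_space borel X)"
    by (simp add: sets_restrict_space M)
  have emX: "emeasure M X = 1"
    using X(2) XM by (simp add: M.emeasure_eq_1_AE)
  have shM: "shift_map \<in> measurable M borel"
    unfolding measurable_cong_sets[OF M(2) refl] shift_map_def
    by (intro borel_measurable_continuous_onI continuous_intros continuous_on_product_coordinates)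
  have shN: "shift_map \<in> measurable ?N ?N"
  proof (rule measurable_restrict_space3)
    show "shift_map \<in> measurable M M" using shM M(2) by (simp cong: measurable_cong_sets)
  qed (use X in auto)
  have "distr ?N ?N shift_map = ?N"
  proof (rule measure_eqI)
    fix B assume "B \<in> sets (distr ?N ?N shift_map)"
    then have B: "B \<in> sets ?N" by simp
    then have BM: "B \<in> sets M" "B \<subseteq> X" using XM by (auto simp: sets_restrict_space_iff)
    have "emeasure (distr ?N ?N shift_map) B = emeasure ?N (shift_map -` B \<inter> X)"
      using emeasure_distr[OF shN B] spN by simp
    also have "\<dots> = emeasure M (shift_map -` B \<inter> X)"
      by (rule emeasure_restrict_space[OF Xn]) auto
    \<comment> \<open>The two preimages differ only outside \<open>X\<close>, a null set.\<close>
    also have "\<dots> = emeasure M (shift_map -` B \<inter> space M)"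
      using X(2) XM measurable_sets[OF shM, of B] BM M(2) spM
      by (intro emeasure_eq_AE) (auto intro!: sets.Int)
    also have "\<dots> = emeasure (distr M borel shift_map) B"
      using BM M by (intro emeasure_distr[OF shM, symmetric]) auto
    also have "\<dots> = emeasure M B" by (simp add: inv)
    also have "\<dots> = emeasure ?N B"
      using BM by (intro emeasure_restrict_space[OF Xn, symmetric])
    finally show "emeasure (distr ?N ?N shift_map) B = emeasure ?N B" .
  qed simp
  moreover have "prob_space ?N"
    using emX emeasure_restrict_space[OF Xn, of X] spN by (intro prob_spaceI) simp
  ultimately show ?thesis
    using setsN shN by (simp add: invariant_measures_def)
qed

lemma subshift_in_borel: "subshift_of_words A L \<in> sets borel"
proof -
  have "subshift_of_words A L =
      (\<Inter>i. {x. x i \<in> A}) \<inter> (\<Inter>i k. {x. \<exists>u\<in>L. sublist (window x i k) u})"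
    by (auto simp: subshift_of_words_def)
  moreover have "{x. x i \<in> A} \<in> sets borel" for i :: int
    by (rule local_event_measurable, rule local_on_comp[of _ "\<lambda>x. x i" "\<lambda>c. c \<in> A"]) simp
  moreover have "{x. \<exists>u\<in>L. sublist (window x i k) u} \<in> sets borel" for i k
    by (rule local_event_measurable, rule local_on_comp[of _ "\<lambda>x. window x i k"]) simp
  ultimately show ?thesis
    by (auto intro!: sets.Int sets.countable_INT')
qed

text \<open>Krylov-Bogoliubov: the invariant measure is a limit of the empirical measures of ever longer
  words of the language.\<close>

lemma invariant_measure_exists:
  assumes A: "finite A" "\<And>u. u \<in> L \<Longrightarrow> set u \<subseteq> A" and long: "\<And>n. \<exists>u\<in>L. n \<le> length u"
  shows "invariant_measures (subshift_of_words A L) shift_map \<noteq> {}"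
proof -
  have "\<forall>n. \<exists>u. u \<in> L \<and> Suc n \<le> length u" using long by blast
  then obtain v where v: "\<And>n. v n \<in> L" "\<And>n. Suc n \<le> length (v n)" by metis
  define l where "l n = length (v n)" for n
  have l: "Suc n \<le> l n" for n using v(2) by (simp add: l_def)
  then have lpos: "0 < l n" for n using less_le_trans by blast
  \<comment> \<open>The word is padded by its first letter on both sides. Only windows that leave
    the word see the padding, and for a fixed shape of window their number stays bounded while
    \<open>l n\<close> grows.\<close>
  define y where "y n = (\<lambda>i::int. if 0 \<le> i \<and> i < int (l n) then v n ! nat i else v n ! 0)" for n
  have yA: "y n i \<in> A" for n i
    using A(2)[OF v(1)[of n]] lpos[of n] by (auto simp: y_def l_def subset_iff)
  define p where "p n = map_pmf (\<lambda>k. shiftz (int k) (y n)) (pmf_of_set {..<l n})" for n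
  have ne: "{..<l n} \<noteq> {}" for n using lpos[of n] by auto
  have meas_p: "measure (p n) {x. P x} = (\<Sum>k<l n. of_bool (P (shiftz (int k) (y n)))) / real (l n)" for n P
    using ne[of n] by (simp add: p_def measure_pmf_of_set vimage_def sum.If_cases of_bool_def Int_def)
  have supp: "set_pmf (p n) \<subseteq> {x. range x \<subseteq> A}" for n
    using ne[of n] yA by (auto simp: p_def)
  obtain r M where r: "strict_mono (r :: nat \<Rightarrow> nat)" and M: "prob_space M"
    and setsM': "sets M = sets (PiM UNIV (\<lambda>_. count_space UNIV))"
    and lim': "\<And>J S. finite J \<Longrightarrow>
      (\<lambda>n. measure (p (r n)) {x. restrict x J \<in> S}) \<longlonglongrightarrow> measure M {x. restrict x J \<in> S}"
    by (rule subsequential_limit_measure[where p = p, OF A(1) supp]) blast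
  interpret M: prob_space M by (rule M)
  have setsM: "sets M = sets borel" using setsM' sets_PiM_sequences by simp
  have spM: "space M = UNIV" using sets_eq_imp_space_eq[OF setsM] by simp
  have lim: "(\<lambda>n. measure (p (r n)) {x. P x}) \<longlonglongrightarrow> measure M {x. P x}" if "local_on UNIV P" for P
    using local_event_eq_restrict[OF that] lim' by metis
  have l_inf: "filterlim (\<lambda>n. real (l (r n))) at_top sequentially"
  proof (rule filterlim_at_top_mono[OF filterlim_real_sequentially])
    have "n \<le> l (r n)" for n
      using seq_suble[OF r, of n] l[of "r n"] by linarith
    then show "\<forall>\<^sub>F n in sequentially. real n \<le> real (l (r n))" by simp
  qed
  have vanish: "(\<lambda>n. C / real (l (r n))) \<longlonglongrightarrow> 0" for C :: real
    by (rule real_tendsto_divide_at_top[OF tendsto_const l_inf])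
  have shift_local: "local_on UNIV (\<lambda>x. P (shift_map x))" if "local_on UNIV P" for P :: "(int \<Rightarrow> nat) \<Rightarrow> bool"
    using local_on_shiftz[OF that, of 1] by (simp add: shift_map_eq_shiftz)
  have inv_local: "measure M {x. P (shift_map x)} = measure M {x. P x}" if P: "local_on UNIV P" for P
  proof -
    have "\<bar>measure (p n) {x. P (shift_map x)} - measure (p n) {x. P x}\<bar> \<le> 1 / real (l n)" for n
    proof -
      define f :: "nat \<Rightarrow> real" where "f k = of_bool (P (shiftz (int k) (y n)))" for k
      have "measure (p n) {x. P (shift_map x)} = (\<Sum>k<l n. f (Suc k)) / real (l n)"
        by (simp only: meas_p f_def shift_map_eq_shiftz shiftz_shiftz of_nat_Suc)
      moreover have "measure (p n) {x. P x} = (\<Sum>k<l n. f k) / real (l n)"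
        by (simp only: meas_p f_def)
      \<comment> \<open>Shifting the average by one place changes only its two end terms, since the
        sums telescope.\<close>
      ultimately have "measure (p n) {x. P (shift_map x)} - measure (p n) {x. P x} = (f (l n) - f 0) / real (l n)"
        by (simp only: diff_divide_distrib[symmetric] sum_subtractf[symmetric] sum_lessThan_telescope)
      moreover have "\<bar>f (l n) - f 0\<bar> \<le> 1"
        by (simp add: f_def of_bool_def)
      ultimately show ?thesis by (simp add: divide_right_mono)
    qed
    then have "(\<lambda>n. measure (p (r n)) {x. P (shift_map x)} - measure (p (r n)) {x. P x}) \<longlonglongrightarrow> 0"
      by (intro Lim_null_comparison[OF _ vanish[of 1]]) simp
    moreover have "(\<lambda>n. measure (p (r n)) {x. P (shift_map x)} - measure (p (r n)) {x. P x})
        \<longlonglongrightarrow> measure M {x. P (shift_map x)} - measure M {x. P x}"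
      by (intro tendsto_diff lim P shift_local)
    ultimately show ?thesis using LIMSEQ_unique by fastforce
  qed
  have shM: "shift_map \<in> measurable M borel"
    unfolding measurable_cong_sets[OF setsM refl] shift_map_def
    by (intro borel_measurable_continuous_onI continuous_intros continuous_on_product_coordinates)
  have inv: "distr M borel shift_map = M"
  proof (rule measure_eqI_local)
    show "prob_space (distr M borel shift_map)" by (rule M.prob_space_distr[OF shM])
    fix P :: "(int \<Rightarrow> nat) \<Rightarrow> bool" assume P: "local_on UNIV P"
    show "measure (distr M borel shift_map) {x. P x} = measure M {x. P x}"
      using inv_local[OF P] by (simp add: measure_distr[OF shM local_event_measurable[OF P]] vimage_def spM)
  qed (simp_all add: M setsM)
  have null: "AE x in M. P x" if P: "local_on UNIV P"
    and C: "\<And>n. measure (p n) {x. \<not> P x} \<le> C / real (l n)" for P and C :: real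
  proof -
    have nP: "local_on UNIV (\<lambda>x. \<not> P x)" by (rule local_on_comp[OF P])
    have "(\<lambda>n. measure (p (r n)) {x. \<not> P x}) \<longlonglongrightarrow> 0"
      by (intro Lim_null_comparison[OF _ vanish[of C]]) (simp add: C)
    then have "measure M {x. \<not> P x} = 0"
      using lim[OF nP] LIMSEQ_unique by fastforce
    moreover have "{x. \<not> P x} \<in> sets M" using local_event_measurable[OF nP] setsM by simp
    ultimately show ?thesis
      by (intro AE_I[of _ _ "{x. \<not> P x}"]) (auto simp: M.emeasure_eq_measure)
  qed
  have letters: "AE x in M. x i \<in> A" for i
    using yA by (intro null[of _ 0] local_on_comp[of _ "\<lambda>x. x i" "\<lambda>c. c \<in> A"]) (auto simp: meas_p)
  \<comment> \<open>The window at offset \<open>j\<close> lies inside the word \<open>v n\<close>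
    unless \<open>j\<close> is among the first \<open>nat \<bar>i\<bar>\<close> or the last
    \<open>nat \<bar>i\<bar> + k\<close> positions, and these have vanishing proportion.\<close>
  have words: "AE x in M. \<exists>u\<in>L. sublist (window x i k) u" for i k
  proof (rule null[of _ "real (2 * nat \<bar>i\<bar> + k)"])
    show "local_on UNIV (\<lambda>x. \<exists>u\<in>L. sublist (window x i k) u)"
      by (rule local_on_comp[of _ "\<lambda>x. window x i k"]) simp
    fix n
    let ?P = "\<lambda>j. \<not> (\<exists>u\<in>L. sublist (window (shiftz (int j) (y n)) i k) u)"
    have good: "\<not> ?P j" if "nat \<bar>i\<bar> \<le> j" "j + nat \<bar>i\<bar> + k \<le> l n" for j
    proof -
      have "window (shiftz (int j) (y n)) i k = take k (drop (nat (i + int j)) (v n))"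
        using that by (intro nth_equalityI)
          (auto simp: window_def y_def l_def nat_add_distrib intro!: arg_cong[where f = "(!) (v n)"])
      then show ?thesis
        using v(1) by (metis sublist_take sublist_drop sublist_order.order.trans)
    qed
    have "(\<Sum>j<l n. of_bool (?P j) :: real) = real (card {j. j < l n \<and> ?P j})"
      by (simp add: of_bool_def sum.If_cases Int_def)
    also have "card {j. j < l n \<and> ?P j} \<le> card ({..<nat \<bar>i\<bar>} \<union> {l n - (nat \<bar>i\<bar> + k)..<l n})"
    proof (rule card_mono)
      show "{j. j < l n \<and> ?P j} \<subseteq> {..<nat \<bar>i\<bar>} \<union> {l n - (nat \<bar>i\<bar> + k)..<l n}"
      proof
        fix j assume "j \<in> {j. j < l n \<and> ?P j}"
        then have "j < l n" "\<not> (nat \<bar>i\<bar> \<le> j \<and> j + nat \<bar>i\<bar> + k \<le> l n)" using good by blast+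
        then show "j \<in> {..<nat \<bar>i\<bar>} \<union> {l n - (nat \<bar>i\<bar> + k)..<l n}" by auto
      qed
    qed simp
    also have "\<dots> \<le> nat \<bar>i\<bar> + (nat \<bar>i\<bar> + k)"
      by (rule order.trans[OF card_Un_le], simp, linarith)
    finally show "measure (p n) {x. \<not> (\<exists>u\<in>L. sublist (window x i k) u)} \<le> real (2 * nat \<bar>i\<bar> + k) / real (l n)"
      unfolding meas_p by (intro divide_right_mono) simp_all
  qed
  have "AE x in M. x \<in> subshift_of_words A L"
  proof -
    have "AE x in M. \<forall>i. x i \<in> A" using letters by (simp add: AE_all_countable)
    moreover have "AE x in M. \<forall>i k. \<exists>u\<in>L. sublist (window x i k) u"
      using words by (simp add: AE_all_countable)
    ultimately show ?thesis
      by eventually_elim (auto simp: subshift_of_words_def)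
  qed
  from restrict_invariant_measure[OF M setsM inv subshift_in_borel this]
  have "restrict_space M (subshift_of_words A L) \<in> invariant_measures (subshift_of_words A L) shift_map"
    using shiftz_in_subshift by (auto simp: shift_map_eq_shiftz)
  then show ?thesis by blast
qed

section \<open>Locality and continuity on compact sets of sequences\<close>

lemma local_on_if_locally_constant:
  assumes "compact X" and "\<And>x. x \<in> X \<Longrightarrow> \<exists>R. \<forall>y\<in>X. agree R x y \<longrightarrow> f y = f x"
  shows "local_on X f"
proof -
  from assms(2) obtain R where R: "\<And>x y. x \<in> X \<Longrightarrow> y \<in> X \<Longrightarrow> agree (R x) x y \<Longrightarrow> f y = f x"
    by metis
  obtain F where F: "F \<subseteq> X" "finite F" "X \<subseteq> (\<Union>x\<in>F. {y. agree (R x) x y})"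
  proof (rule compactE_image[OF assms(1), of X "\<lambda>x. {y. agree (R x) x y}"])
    show "X \<subseteq> (\<Union>x\<in>X. {y. agree (R x) x y})" by force
  qed (auto simp: open_agree)
  \<comment> \<open>The sum of the radii over the finite subcover bounds each of them and makes
    sense for an empty subcover.\<close>
  have mx: "R z \<le> (\<Sum>x\<in>F. R x)" if "z \<in> F" for z
    using F(2) that by (intro member_le_sum) auto
  show ?thesis
  proof (rule local_onI[of _ "\<Sum>x\<in>F. R x"])
    fix x y assume xy: "x \<in> X" "y \<in> X" "agree (\<Sum>x\<in>F. R x) x y"
    then obtain z where z: "z \<in> F" "agree (R z) z x" using F(3) by auto
    then have "agree (R z) z y" using agree_trans agree_mono[OF xy(3) mx] by blast
    then show "f x = f y" using R[of z x] R[of z y] z F(1) xy by (metis subsetD)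
  qed
qed

lemma local_on_imp_continuous:
  fixes f :: "(int \<Rightarrow> nat) \<Rightarrow> 'b::topological_space"
  assumes "local_on X f"
  shows "continuous_on X f"
  unfolding continuous_on_open_invariant
proof (intro allI impI)
  fix V :: "'b set"
  show "\<exists>U. open U \<and> U \<inter> X = f -` V \<inter> X"
    using local_on_vimage_open[OF assms, of V] by metis
qed

lemma open_contains_agree:
  assumes "open U" "x \<in> U"
  shows "\<exists>R. {y. agree R x y} \<subseteq> U"
proof -
  have "openin (product_topology (\<lambda>_. euclidean) UNIV) U"
    using assms(1) by (simp add: euclidean_product_topology)
  then obtain K where K: "x \<in> PiE UNIV K" "finite {i. K i \<noteq> topspace euclidean}" "PiE UNIV K \<subseteq> U"
    using product_topology_open_contains_basis[OF _ assms(2)] by blast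
  let ?R = "nat (\<Sum>i\<in>{i. K i \<noteq> UNIV}. \<bar>i\<bar>)"
  have fin: "finite {i. K i \<noteq> UNIV}" using K(2) by simp
  have "{y. agree ?R x y} \<subseteq> PiE UNIV K"
  proof
    fix y assume "y \<in> {y. agree ?R x y}"
    then have y: "agree ?R x y" by simp
    have "y i \<in> K i" for i
    proof (cases "K i = UNIV")
      case False
      then have "\<bar>i\<bar> \<le> (\<Sum>i\<in>{i. K i \<noteq> UNIV}. \<bar>i\<bar>)"
        using fin by (intro member_le_sum) auto
      then have "y i = x i" using y by (auto simp: agree_def sum_nonneg)
      then show ?thesis using K(1) by (auto simp: PiE_def)
    qed simp
    then show "y \<in> PiE UNIV K" by auto
  qed
  with K(3) show ?thesis by blast
qed

lemma local_on_iff_continuous: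
  fixes f :: "(int \<Rightarrow> nat) \<Rightarrow> 'b::discrete_topology"
  assumes "compact X"
  shows "local_on X f \<longleftrightarrow> continuous_on X f"
proof
  assume f: "continuous_on X f"
  show "local_on X f"
  proof (rule local_on_if_locally_constant[OF assms])
    fix x assume "x \<in> X"
    obtain U where U: "open U" "U \<inter> X = f -` {f x} \<inter> X"
      using f unfolding continuous_on_open_invariant by (metis Topological_Spaces.open_discrete)
    with \<open>x \<in> X\<close> have "x \<in> U" by blast
    from open_contains_agree[OF U(1) this] U(2)
    show "\<exists>R. \<forall>y\<in>X. agree R x y \<longrightarrow> f y = f x" by blast
  qed
qed (rule local_on_imp_continuous)

text \<open>The condition on a single window is clopen, so the subshift is closed in the compact
  power of the finite alphabet.\<close>

lemma compact_subshift:
  assumes "finite A"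
  shows "compact (subshift_of_words A L)"
proof -
  have cl: "closed {x. P x}" if P: "local_on UNIV P" for P :: "(int \<Rightarrow> nat) \<Rightarrow> bool"
  proof -
    obtain U where "open U" "P -` {False} = U"
      using local_on_vimage_open[OF P, of "{False}"] by auto
    then have "open (- {x. P x})" by (auto simp: vimage_def Collect_neg_eq[symmetric])
    then show ?thesis by (simp add: closed_def)
  qed
  have "subshift_of_words A L =
      PiE UNIV (\<lambda>_. A) \<inter> (\<Inter>i k. {x. \<exists>u\<in>L. sublist (window x i k) u})"
    by (auto simp: subshift_of_words_def)
  moreover have "closed (\<Inter>i k. {x. \<exists>u\<in>L. sublist (window x i k) u})"
    by (intro closed_INT ballI cl, rule local_on_comp[of _ "\<lambda>x. window x i k" for i k]) simp
  moreover have "compact (PiE UNIV (\<lambda>_ :: int. A))"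
    using assms by (intro compact_PiE_UNIV finite_imp_compact)
  ultimately show ?thesis by (auto intro: compact_Int_closed)
qed

section \<open>Spacers and generating words\<close>

text \<open>The \<open>k\<close>-th spacer between consecutive copies of \<open>w\<^sub>m\<close> in any \<open>w\<^sub>n\<close> that is long enough.
  As \<open>w\<^sub>n\<close> is a prefix of \<open>w\<^bsub>n+1\<^esub>\<close>, this does not depend on \<open>n\<close>. The case \<open>q m = 0\<close>
  only serves termination.\<close>

function spacer_seq :: "(nat \<Rightarrow> nat) \<Rightarrow> (nat \<Rightarrow> nat \<Rightarrow> nat) \<Rightarrow> nat \<Rightarrow> nat \<Rightarrow> nat" where
  "spacer_seq q a m k =
    (if q m = 0 \<or> k mod (q m + 1) < q m then a m (k mod (q m + 1))
     else spacer_seq q a (Suc m) (k div (q m + 1)))"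
  by pat_completeness auto
termination
proof (relation "Wellfounded.measure (\<lambda>(q, a, m, k). k)")
  fix q :: "nat \<Rightarrow> nat" and a :: "nat \<Rightarrow> nat \<Rightarrow> nat" and m k
  assume "\<not> (q m = 0 \<or> k mod (q m + 1) < q m)"
  then have "0 < k" "1 < q m + 1" by (auto intro: Nat.gr0I)
  then have "k div (q m + 1) < k" by (rule div_less_dividend[rotated])
  then show "((q, a, Suc m, k div (q m + 1)), q, a, m, k) \<in> Wellfounded.measure (\<lambda>(q, a, m, k). k)" by simp
qed simp

declare spacer_seq.simps [simp del]

lemma alphabet_Suc_antimono: "m \<le> n \<Longrightarrow> alphabet q a (Suc n) \<subseteq> alphabet q a (Suc m)"
  by (auto intro: order.trans)

text \<open>Meant for the zeros of two sequences that are known to agree on one window only, which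
  is why the ranges are compared no further than \<open>u k\<close>. The next element of either
  enumeration occurs in the other, so neither can overtake.\<close>

lemma enumeration_eqI:
  fixes u v :: "nat \<Rightarrow> int"
  assumes u: "strict_mono u" and v: "strict_mono v" and 0: "u 0 = v 0"
    and rng: "\<And>p. u 0 < p \<Longrightarrow> p \<le> u k \<Longrightarrow> p \<in> range u \<longleftrightarrow> p \<in> range v"
  shows "n \<le> k \<Longrightarrow> u n = v n"
proof (induction n)
  case (Suc n)
  then have eq: "u n = v n" by simp
  have up: "u 0 < u (Suc n)" "u (Suc n) \<le> u k"
    using u Suc.prems by (auto simp: strict_mono_less strict_mono_less_eq)
  then obtain l where l: "u (Suc n) = v l" using rng[of "u (Suc n)"] by auto
  have "v n < v l" using l eq u by (metis lessI strict_mono_less)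
  then have "v (Suc n) \<le> u (Suc n)" using v l by (simp add: strict_mono_less strict_mono_less_eq)
  moreover have "u 0 < v (Suc n)"
    using v 0 by (simp add: strict_mono_less)
  ultimately obtain l' where l': "v (Suc n) = u l'" using rng[of "v (Suc n)"] up by auto
  have "u n < u l'" using l' eq v by (metis lessI strict_mono_less)
  then have "u (Suc n) \<le> v (Suc n)" using u l' by (simp add: strict_mono_less strict_mono_less_eq)
  with \<open>v (Suc n) \<le> u (Suc n)\<close> show ?case by simp
qed (simp add: 0)

locale ferenczi =
  fixes q :: "nat \<Rightarrow> nat" and a :: "nat \<Rightarrow> nat \<Rightarrow> nat" and M :: nat
  assumes q_ge_2: "2 \<le> q n" and spacer_le: "i < q n \<Longrightarrow> a n i \<le> M"
begin

abbreviation X :: "(int \<Rightarrow> nat) set" where "X \<equiv> ferenczi_subshift q a"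

abbreviation sp :: "nat \<Rightarrow> nat \<Rightarrow> nat" where "sp \<equiv> spacer_seq q a"

section \<open>Toeplitz structure of the spacer sequence\<close>

definition Q :: "nat \<Rightarrow> nat \<Rightarrow> nat" where "Q m n = (\<Prod>j = m..<n. q j + 1)"

lemma Q_refl [simp]: "Q m m = 1"
  by (simp add: Q_def)

lemma Q_Suc: "m \<le> n \<Longrightarrow> Q m (Suc n) = Q m n * (q n + 1)"
  by (simp add: Q_def prod.atLeastLessThan_Suc)

lemma Q_step: "m < n \<Longrightarrow> Q m n = (q m + 1) * Q (Suc m) n"
  by (simp add: Q_def prod.atLeast_Suc_lessThan)

lemma Q_mult: "m \<le> k \<Longrightarrow> k \<le> n \<Longrightarrow> Q m k * Q k n = Q m n"
  by (simp add: Q_def prod.atLeastLessThan_concat)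

lemma Q_pos [simp]: "0 < Q m n"
  by (simp add: Q_def prod_pos)

lemma Q_ge: "n \<le> Q m (m + n)"
proof (induction n)
  case (Suc n)
  have "Suc n \<le> Q m (m + n) * 2"
    using Suc Q_pos[of m "m + n"] by linarith
  also have "\<dots> \<le> Q m (m + n) * (q (m + n) + 1)"
    using q_ge_2[of "m + n"] by (intro mult_le_mono2) simp
  finally show ?case by (simp add: Q_Suc)
qed simp

lemma sp_low: "r < q m \<Longrightarrow> sp m (j * (q m + 1) + r) = a m r"
proof -
  assume "r < q m"
  then have "(j * (q m + 1) + r) mod (q m + 1) = r" by (simp only: mod_mult_self3) simp
  with \<open>r < q m\<close> show ?thesis by (subst spacer_seq.simps) (simp only: simp_thms if_True)
qed

lemma sp_high: "sp m (j * (q m + 1) + q m) = sp (Suc m) j"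
proof -
  have "(j * (q m + 1) + q m) mod (q m + 1) = q m" by (simp only: mod_mult_self3) simp
  moreover have "(j * (q m + 1) + q m) div (q m + 1) = j" by (simp add: div_mult_self3 del: mult_Suc_right)
  moreover have "q m \<noteq> 0" using q_ge_2[of m] by simp
  ultimately show ?thesis by (subst spacer_seq.simps) (simp only: simp_thms if_False less_irrefl)
qed

text \<open>Together with \<open>sp_fill\<close> this is the Toeplitz structure of
  \<open>sp m\<close>: in each block of \<open>Q m n\<close> indices all but the last are filled
  periodically by the spacers inside \<open>w\<^sub>n\<close>, and the last ones, read in order,
  form the sequence \<open>sp n\<close>.\<close>

lemma sp_hole: "m \<le> n \<Longrightarrow> sp m (j * Q m n + (Q m n - 1)) = sp n j"
proof (induction "n - m" arbitrary: m)
  case (Suc d)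
  then have mn: "m < n" and IH: "sp (Suc m) (j * Q (Suc m) n + (Q (Suc m) n - 1)) = sp n j"
    by auto
  have "j * Q m n + (Q m n - 1) = (j * Q (Suc m) n + (Q (Suc m) n - 1)) * (q m + 1) + q m"
    using Q_pos[of "Suc m" n] Q_step[OF mn] by (cases "Q (Suc m) n") (auto simp: algebra_simps)
  then show ?case using IH sp_high[of m] by simp
qed simp

lemma sp_fill: "m \<le> n \<Longrightarrow> i + 1 < Q m n \<Longrightarrow> sp m (j * Q m n + i) = sp m i"
proof (induction "n - m" arbitrary: m i)
  case (Suc d)
  then have mn: "m < n" by auto
  define i' r where "i' = i div (q m + 1)" and "r = i mod (q m + 1)"
  have i: "i = i' * (q m + 1) + r" and r: "r < q m + 1"
    unfolding i'_def r_def by (simp_all only: div_mult_mod_eq) simp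
  have eq: "j * Q m n + i = (j * Q (Suc m) n + i') * (q m + 1) + r"
    by (simp add: Q_step[OF mn] i algebra_simps)
  show ?case
  proof (cases "r < q m")
    case True
    then have "sp m i = a m r" by (subst i) (rule sp_low)
    moreover have "sp m (j * Q m n + i) = a m r" unfolding eq using True by (rule sp_low)
    ultimately show ?thesis by simp
  next
    case False
    then have rq: "r = q m" using r by simp
    have "(i' + 1) * (q m + 1) < Q (Suc m) n * (q m + 1)"
      using Suc.prems(2) by (simp add: Q_step[OF mn] i rq algebra_simps)
    then have "i' + 1 < Q (Suc m) n" by (simp only: mult_less_cancel2)
    then have "sp (Suc m) (j * Q (Suc m) n + i') = sp (Suc m) i'"
      using Suc.hyps(2) mn by (intro Suc.hyps(1)) auto
    moreover have "sp m i = sp (Suc m) i'" by (subst i) (simp only: rq sp_high)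
    moreover have "sp m (j * Q m n + i) = sp (Suc m) (j * Q (Suc m) n + i')"
      unfolding eq by (simp only: rq sp_high)
    ultimately show ?thesis by simp
  qed
qed simp

lemma sp_mod: "m \<le> n \<Longrightarrow> k mod Q m n + 1 < Q m n \<Longrightarrow> sp m k = sp m (k mod Q m n)"
  using sp_fill[of m n "k mod Q m n" "k div Q m n"] by simp

lemma sp_hole_mod: "m \<le> n \<Longrightarrow> \<not> k mod Q m n + 1 < Q m n \<Longrightarrow> sp m k = sp n (k div Q m n)"
proof -
  assume "m \<le> n" and "\<not> k mod Q m n + 1 < Q m n"
  then have "k mod Q m n = Q m n - 1"
    using mod_less_divisor[OF Q_pos, of k m n] by linarith
  then show ?thesis
    using sp_hole[OF \<open>m \<le> n\<close>, of "k div Q m n"] by (metis div_mult_mod_eq)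
qed

lemma sp_alphabet: "sp m k \<in> alphabet q a (Suc m)"
proof (induction k arbitrary: m rule: less_induct)
  case (less k)
  show ?case
  proof (cases "k mod (q m + 1) < q m")
    case True
    then show ?thesis by (subst spacer_seq.simps) auto
  next
    case False
    then have "0 < k" using q_ge_2[of m] by (cases k) auto
    then have "k div (q m + 1) < k" using q_ge_2[of m] by (intro div_less_dividend) auto
    from less[OF this, of "Suc m"] have "sp (Suc m) (k div (q m + 1)) \<in> alphabet q a (Suc m)"
      using alphabet_Suc_antimono[of m "Suc m" q a, OF le_SucI[OF order.refl]] by blast
    then show ?thesis using False q_ge_2[of m] by (subst spacer_seq.simps) simp
  qed
qed

lemma alphabet_le: "c \<in> alphabet q a (Suc n) \<Longrightarrow> c \<le> M"
  using spacer_le by auto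

lemma finite_alphabet: "finite (alphabet q a (Suc n))"
  by (rule finite_subset[of _ "{..M}"]) (use alphabet_le in auto)

lemma sp_le: "sp m k \<le> M"
  using sp_alphabet alphabet_le by blast

section \<open>The one-sided limit of the generating words\<close>

definition zero_pos :: "nat \<Rightarrow> nat" where "zero_pos k = (\<Sum>i<k. sp 0 i + 1)"

text \<open>The infinite word that has every \<open>w\<^sub>n\<close> as a prefix, encoded by the
  positions of its zeros.\<close>

definition spaced_letter :: "nat \<Rightarrow> nat" where "spaced_letter t = (if t \<in> range zero_pos then 0 else 1)"

lemma zero_pos_0 [simp]: "zero_pos 0 = 0" and zero_pos_Suc: "zero_pos (Suc k) = zero_pos k + sp 0 k + 1"
  by (simp_all add: zero_pos_def)

lemma strict_mono_zero_pos: "strict_mono zero_pos"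
  by (simp add: strict_mono_Suc_iff zero_pos_Suc)

lemma zero_pos_between: "zero_pos k < t \<Longrightarrow> t < zero_pos (Suc k) \<Longrightarrow> t \<notin> range zero_pos"
  using strict_mono_zero_pos by (auto simp: strict_mono_less)

definition spaced :: "nat \<Rightarrow> nat list" where
  "spaced k = concat (map (\<lambda>i. 0 # replicate (sp 0 i) 1) [0..<k])"

lemma spaced_simps [simp]: "spaced 0 = []" "spaced (Suc k) = spaced k @ 0 # replicate (sp 0 k) 1"
  by (simp_all add: spaced_def)

lemma length_spaced: "length (spaced k) = zero_pos k"
  by (induction k) (simp_all add: zero_pos_Suc)

lemma spaced_nth: "t \<le> zero_pos k \<Longrightarrow> (spaced k @ [0]) ! t = spaced_letter t"
proof (induction k)
  case 0
  have "0 \<in> range zero_pos" by (metis rangeI zero_pos_0)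
  with 0 show ?case by (simp add: spaced_letter_def)
next
  case (Suc k)
  consider "t < zero_pos k" | "t = zero_pos k" | "zero_pos k < t" "t < zero_pos (Suc k)" | "t = zero_pos (Suc k)"
    using Suc.prems by linarith
  then show ?case
  proof cases
    case 1
    then show ?thesis using Suc.IH by (simp add: nth_append length_spaced)
  next
    case 2
    then show ?thesis by (simp add: nth_append length_spaced spaced_letter_def)
  next
    case 3
    then have "spaced_letter t = 1" using zero_pos_between by (simp add: spaced_letter_def)
    then show ?thesis using 3 by (simp add: nth_append length_spaced nth_Cons' zero_pos_Suc)
  next
    case 4
    then have "spaced_letter t = 0" by (simp add: spaced_letter_def)
    then show ?thesis using 4 by (simp add: nth_append length_spaced nth_Cons' zero_pos_Suc)
  qed
qed

lemma spaced_add: "spaced (k + l) = spaced k @ concat (map (\<lambda>i. 0 # replicate (sp 0 (k + i)) 1) [0..<l])"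
  by (induction l) simp_all

text \<open>With \<open>r < Q 0 n\<close> the spacers that enter after index
  \<open>l * Q 0 n\<close> stop short of the hole, whose index is
  \<open>l * Q 0 n + (Q 0 n - 1)\<close>; they are those of the initial block.\<close>

lemma spaced_block:
  assumes "l * Q 0 n + r < Suc l * Q 0 n"
  shows "spaced (l * Q 0 n + r) = spaced (l * Q 0 n) @ spaced r"
proof -
  have "map (\<lambda>i. (0 :: nat) # replicate (sp 0 (l * Q 0 n + i)) 1) [0..<r] = map (\<lambda>i. 0 # replicate (sp 0 i) 1) [0..<r]"
    using assms by (auto intro!: sp_fill)
  then show ?thesis unfolding spaced_add by (simp only: spaced_def add_0)
qed

text \<open>\<open>w\<^sub>n\<close> has \<open>Q 0 n\<close> zeros and ends with the last of them,
  hence the \<open>- 1\<close>. In the next word the hole closing block \<open>l\<close> is filled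
  by \<open>a n l\<close>.\<close>

lemma gen_word_eq: "gen_word q a n = spaced (Q 0 n - 1) @ [0]"
proof (induction n)
  case (Suc n)
  let ?Q = "Q 0 n"
  have blocks: "concat (map (\<lambda>i. gen_word q a n @ replicate (a n i) 1) [0..<l]) = spaced (l * ?Q)"
    if "l \<le> q n" for l
    using that
  proof (induction l)
    case (Suc l)
    have a: "sp 0 (l * ?Q + (?Q - 1)) = a n l"
      using sp_hole[of 0 n l] sp_low[of l n 0] Suc.prems by simp
    have "spaced (Suc l * ?Q) = spaced (Suc (l * ?Q + (?Q - 1)))"
      using Q_pos[of 0 n] by (intro arg_cong[where f = spaced]) (simp add: algebra_simps del: Q_pos)
    also have "\<dots> = spaced (l * ?Q) @ spaced (?Q - 1) @ 0 # replicate (a n l) 1"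
    proof -
      have "spaced (l * ?Q + (?Q - 1)) = spaced (l * ?Q) @ spaced (?Q - 1)"
        by (rule spaced_block) simp
      then show ?thesis by (simp only: spaced_simps a append.assoc)
    qed
    finally show ?case using Suc Suc_leD[of l "q n"] by (simp add: \<open>gen_word q a n = _\<close>)
  qed simp
  have "Q 0 (Suc n) - 1 = q n * ?Q + (?Q - 1)"
    using Q_pos[of 0 n] by (cases ?Q) (simp_all add: Q_Suc algebra_simps)
  then have "spaced (Q 0 (Suc n) - 1) = spaced (q n * ?Q) @ spaced (?Q - 1)"
    using spaced_block[of "q n" n "?Q - 1"] by simp
  then show ?case using blocks[of "q n"] by (simp add: Suc)
qed simp

lemma length_gen_word: "length (gen_word q a n) = zero_pos (Q 0 n - 1) + 1"
  by (simp add: gen_word_eq length_spaced)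

text \<open>All generating words are prefixes of one infinite word, so a window of \<open>x\<close>
  is located by a single offset \<open>t\<close>.\<close>

lemma X_window:
  assumes "x \<in> X"
  shows "\<exists>t. \<forall>l<L. x (i + int l) = spaced_letter (t + l)"
proof -
  from assms have "\<exists>u\<in>range (gen_word q a). sublist (window x i L) u"
    unfolding ferenczi_subshift_def subshift_of_words_def by blast
  then obtain N where "sublist (window x i L) (gen_word q a N)" by blast
  then obtain ps ss where eq: "gen_word q a N = ps @ window x i L @ ss" by (auto simp: sublist_def)
  have "x (i + int l) = spaced_letter (length ps + l)" if "l < L" for l
  proof -
    have len: "length (window x i L) = L" by (simp add: window_def)
    have "x (i + int l) = gen_word q a N ! (length ps + l)"
      using that unfolding eq by (simp add: nth_append len) (simp add: window_def)
    also have "length ps + l < length (gen_word q a N)" using that unfolding eq by (simp add: len)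
    then have "gen_word q a N ! (length ps + l) = spaced_letter (length ps + l)"
      unfolding length_gen_word by (simp add: gen_word_eq spaced_nth)
    finally show ?thesis .
  qed
  then show ?thesis by blast
qed

lemma spaced_letter_zero_in_window: "\<exists>l\<le>M. spaced_letter (t + l) = 0"
proof -
  \<comment> \<open>The first zero at or after \<open>t\<close>: the preceding zero, if any, lies
    before \<open>t\<close>, and at most \<open>M\<close> ones separate consecutive zeros.\<close>
  define k where "k = (LEAST k. t \<le> zero_pos k)"
  have "t \<le> zero_pos t" using strict_mono_imp_increasing[OF strict_mono_zero_pos] .
  then have k: "t \<le> zero_pos k" unfolding k_def by (rule LeastI)
  have "zero_pos k \<le> t + M"
  proof (cases k)
    case (Suc k')
    then have "\<not> t \<le> zero_pos k'" using not_less_Least[of k' "\<lambda>k. t \<le> zero_pos k"] by (simp add: k_def)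
    then show ?thesis using Suc sp_le[of 0 k'] by (simp add: zero_pos_Suc)
  qed simp
  with k show ?thesis by (intro exI[of _ "zero_pos k - t"]) (auto simp: spaced_letter_def)
qed

lemma X_zero_in_window:
  assumes "x \<in> X"
  shows "\<exists>p. i \<le> p \<and> p \<le> i + int M \<and> x p = 0"
proof -
  obtain t where t: "\<forall>l<Suc M. x (i + int l) = spaced_letter (t + l)" using X_window[OF assms] by blast
  obtain l where "l \<le> M" "spaced_letter (t + l) = 0" using spaced_letter_zero_in_window by blast
  with t show ?thesis by (intro exI[of _ "i + int l"]) auto
qed

section \<open>Enumeration of the zeros of a bi-infinite point\<close>

definition zenum :: "(int \<Rightarrow> nat) \<Rightarrow> (int \<Rightarrow> int) \<Rightarrow> bool" where
  "zenum x z \<longleftrightarrow> strict_mono z \<and> range z = {p. x p = 0} \<and> z (-1) < 0 \<and> 0 \<le> z 0"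

text \<open>\<open>Z x\<close> enumerates the zeros of \<open>x\<close> in increasing order, \<open>Z x 0\<close> being the first nonnegative
  one; \<open>gap x j\<close> is the number of ones between the zeros \<open>j\<close> and \<open>j + 1\<close>.\<close>

definition Z :: "(int \<Rightarrow> nat) \<Rightarrow> int \<Rightarrow> int" where "Z x = (SOME z. zenum x z)"

definition gap :: "(int \<Rightarrow> nat) \<Rightarrow> int \<Rightarrow> nat" where "gap x j = nat (Z x (j + 1) - Z x j - 1)"

lemma zenum_exists:
  assumes "x \<in> X"
  shows "\<exists>z. zenum x z"
proof -
  define P N where "P = {n. x (int n) = 0}" and "N = {n. x (- 1 - int n) = 0}"
  have "\<exists>n>k. n \<in> P" for k
  proof -
    obtain p where "int k + 1 \<le> p" "x p = 0" using X_zero_in_window[OF assms] by blast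
    then show ?thesis by (intro exI[of _ "nat p"]) (auto simp: P_def)
  qed
  then have P: "infinite P" by (meson infinite_nat_iff_unbounded)
  have "\<exists>n>k. n \<in> N" for k
  proof -
    obtain p where "p \<le> - 2 - int k - int M + int M" "x p = 0" using X_zero_in_window[OF assms] by blast
    then show ?thesis by (intro exI[of _ "nat (- 1 - p)"]) (auto simp: N_def)
  qed
  then have N: "infinite N" by (meson infinite_nat_iff_unbounded)
  \<comment> \<open>Negative positions are listed through \<open>- 1 - n\<close>, so that index
    \<open>-1\<close> receives the largest negative zero.\<close>
  define z where "z j = (if 0 \<le> j then int (enumerate P (nat j)) else - 1 - int (enumerate N (nat (- 1 - j))))" for j
  have "strict_mono z"
  proof (rule strict_monoI)
    fix i j :: int assume "i < j"
    then consider "0 \<le> i" "i < j" | "i < 0" "0 \<le> j" | "j < 0" "i < j" by linarith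
    then show "z i < z j"
      by cases (auto simp: z_def enumerate_mono_iff P N)
  qed
  moreover have "range z = {p. x p = 0}"
  proof (intro equalityI subsetI)
    fix p assume "p \<in> range z"
    then obtain j where "p = z j" by blast
    then show "p \<in> {p. x p = 0}"
      using enumerate_in_set[OF P, of "nat j"] enumerate_in_set[OF N, of "nat (- 1 - j)"]
      by (auto simp: z_def P_def N_def)
  next
    fix p assume p: "p \<in> {p. x p = 0}"
    show "p \<in> range z"
    proof (cases "0 \<le> p")
      case True
      then have "nat p \<in> P" using p by (simp add: P_def)
      then obtain n where "enumerate P n = nat p" using range_enumerate[OF P] by (metis rangeE)
      then have "p = z (int n)" using True by (simp add: z_def)
      then show ?thesis by blast
    next
      case False
      then have "nat (- 1 - p) \<in> N" using p by (simp add: N_def)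
      then obtain n where "enumerate N n = nat (- 1 - p)" using range_enumerate[OF N] by (metis rangeE)
      then have "p = z (- 1 - int n)" using False by (simp add: z_def)
      then show ?thesis by blast
    qed
  qed
  ultimately show ?thesis by (intro exI[of _ z]) (auto simp: zenum_def z_def)
qed

lemma zenum_Z: "x \<in> X \<Longrightarrow> zenum x (Z x)"
  unfolding Z_def by (rule someI_ex[OF zenum_exists])

lemma strict_mono_Z: "x \<in> X \<Longrightarrow> strict_mono (Z x)"
  and range_Z: "x \<in> X \<Longrightarrow> range (Z x) = {p. x p = 0}"
  and Z_minus_1: "x \<in> X \<Longrightarrow> Z x (-1) < 0"
  and Z_0: "x \<in> X \<Longrightarrow> 0 \<le> Z x 0"
  using zenum_Z by (auto simp: zenum_def)

lemma Z_less_iff: "x \<in> X \<Longrightarrow> Z x i < Z x j \<longleftrightarrow> i < j"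
  and Z_le_iff: "x \<in> X \<Longrightarrow> Z x i \<le> Z x j \<longleftrightarrow> i \<le> j"
  using strict_mono_Z by (auto simp: strict_mono_less strict_mono_less_eq strict_mono_eq)

lemma x_Z [simp]: "x \<in> X \<Longrightarrow> x (Z x j) = 0"
  using range_Z by blast

lemma zero_obtains_Z:
  assumes "x \<in> X" "x p = 0"
  obtains j where "p = Z x j"
  using assms range_Z by blast

text \<open>The normalisation at the origin fixes the indexing, so agreement on a stretch of zeros
  suffices. The stretch starts at index \<open>- J - 1\<close> in order to contain all coordinates
  from 0 to \<open>z 0\<close> even if \<open>J = 0\<close>.\<close>

lemma zenum_local:
  assumes z: "zenum x z" and z': "zenum x' z'"
    and eq: "\<And>p. z (- int J - 1) \<le> p \<Longrightarrow> p \<le> z (int J) \<Longrightarrow> x p = x' p" and j: "\<bar>j\<bar> \<le> int J"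
  shows "z j = z' j"
proof -
  have mono: "strict_mono z" "strict_mono z'" and rng: "range z = {p. x p = 0}" "range z' = {p. x' p = 0}"
    and sgn: "z (-1) < 0" "0 \<le> z 0" "z' (-1) < 0" "0 \<le> z' 0"
    using z z' by (auto simp: zenum_def)
  have bnd: "z (- int J - 1) \<le> z (-1)" "z 0 \<le> z (int J)"
    using mono(1) by (auto simp: strict_mono_less_eq)
  have "x (z 0) = x' (z 0)" using bnd sgn by (intro eq) auto
  moreover have "x (z 0) = 0" using rng(1) by blast
  ultimately have "z 0 \<in> range z'" unfolding rng(2) by simp
  then obtain l where l: "z 0 = z' l" by (rule rangeE)
  have "\<not> l \<le> - 1"
  proof
    assume "l \<le> - 1"
    then have "z' l \<le> z' (- 1)" using mono(2) by (simp add: strict_mono_less_eq)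
    then show False using l sgn by simp
  qed
  then have le: "z' 0 \<le> z 0" using l mono(2) by (simp add: strict_mono_less_eq)
  have "x (z' 0) = x' (z' 0)" using bnd sgn le by (intro eq) auto
  moreover have "x' (z' 0) = 0" using rng(2) by blast
  ultimately have "z' 0 \<in> range z" unfolding rng(1) by simp
  then obtain l' where l': "z' 0 = z l'" by (rule rangeE)
  have "\<not> l' \<le> - 1"
  proof
    assume "l' \<le> - 1"
    then have "z l' \<le> z (- 1)" using mono(1) by (simp add: strict_mono_less_eq)
    then show False using l' sgn by simp
  qed
  then have "z 0 \<le> z' 0" using l' mono(1) by (simp add: strict_mono_less_eq)
  with le have eq0: "z 0 = z' 0" by simp
  show ?thesis
  proof (cases "0 \<le> j")
    case True
    have "z (int n) = z' (int n)" if "n \<le> J" for n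
    proof (rule enumeration_eqI[of "\<lambda>n. z (int n)" "\<lambda>n. z' (int n)" J n, OF _ _ _ _ that])
      show "strict_mono (\<lambda>n. z (int n))" "strict_mono (\<lambda>n. z' (int n))"
        using mono by (auto simp: strict_mono_def)
      fix p assume p: "z (int 0) < p" "p \<le> z (int J)"
      have "p \<in> range (\<lambda>n. z (int n)) \<longleftrightarrow> p \<in> range z"
      proof
        assume "p \<in> range z"
        then obtain i where i: "p = z i" by blast
        with p mono(1) have "0 < i" by (simp add: strict_mono_less)
        then show "p \<in> range (\<lambda>n. z (int n))" using i by (intro image_eqI[of _ _ "nat i"]) auto
      qed auto
      moreover have "p \<in> range (\<lambda>n. z' (int n)) \<longleftrightarrow> p \<in> range z'"
      proof
        assume "p \<in> range z'"
        then obtain i where i: "p = z' i" by blast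
        with p mono(2) eq0 have "0 < i" by (simp add: strict_mono_less)
        then show "p \<in> range (\<lambda>n. z' (int n))" using i by (intro image_eqI[of _ _ "nat i"]) auto
      qed auto
      moreover have "x p = x' p" using p bnd sgn by (intro eq) auto
      ultimately show "p \<in> range (\<lambda>n. z (int n)) \<longleftrightarrow> p \<in> range (\<lambda>n. z' (int n))"
        using rng by auto
    qed (simp add: eq0)
    from this[of "nat j"] show ?thesis using True j by simp
  next
    case False
    \<comment> \<open>Reflection turns the descending half of the enumeration into an ascending
      one.\<close>
    have "- z (- int n) = - z' (- int n)" if "n \<le> J" for n
    proof (rule enumeration_eqI[of "\<lambda>n. - z (- int n)" "\<lambda>n. - z' (- int n)" J n, OF _ _ _ _ that])
      show "strict_mono (\<lambda>n. - z (- int n))" "strict_mono (\<lambda>n. - z' (- int n))"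
        using mono by (auto simp: strict_mono_def)
      fix p assume p: "- z (- int 0) < p" "p \<le> - z (- int J)"
      have "p \<in> range (\<lambda>n. - z (- int n)) \<longleftrightarrow> - p \<in> range z"
      proof
        assume "- p \<in> range z"
        then obtain i where i: "- p = z i" by blast
        then have "z i < z 0" using p by simp
        with mono(1) have "i < 0" by (simp add: strict_mono_less)
        then show "p \<in> range (\<lambda>n. - z (- int n))" using i by (intro image_eqI[of _ _ "nat (- i)"]) auto
      qed auto
      moreover have "p \<in> range (\<lambda>n. - z' (- int n)) \<longleftrightarrow> - p \<in> range z'"
      proof
        assume "- p \<in> range z'"
        then obtain i where i: "- p = z' i" by blast
        then have "z' i < z' 0" using p eq0 by simp
        with mono(2) have "i < 0" by (simp add: strict_mono_less)
        then show "p \<in> range (\<lambda>n. - z' (- int n))" using i by (intro image_eqI[of _ _ "nat (- i)"]) auto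
      qed auto
      moreover have "x (- p) = x' (- p)"
      proof (rule eq)
        have "z (- int J - 1) \<le> z (- int J)" using mono(1) by (simp add: strict_mono_less_eq)
        then show "z (- int J - 1) \<le> - p" using p by simp
        show "- p \<le> z (int J)" using p bnd(2) by simp
      qed
      ultimately show "p \<in> range (\<lambda>n. - z (- int n)) \<longleftrightarrow> p \<in> range (\<lambda>n. - z' (- int n))"
        using rng by auto
    qed (simp add: eq0)
    from this[of "nat (- j)"] show ?thesis using False j by simp
  qed
qed

lemma zenum_unique: "zenum x z \<Longrightarrow> zenum x z' \<Longrightarrow> z = z'"
  using zenum_local[of x z x z' "nat \<bar>j\<bar>" j for j] by (intro ext) auto

lemma Z_local: "x \<in> X \<Longrightarrow> y \<in> X \<Longrightarrow> (\<And>p. Z x (- int J - 1) \<le> p \<Longrightarrow> p \<le> Z x (int J) \<Longrightarrow> x p = y p)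
    \<Longrightarrow> \<bar>j\<bar> \<le> int J \<Longrightarrow> Z x j = Z y j"
  by (rule zenum_local[OF zenum_Z zenum_Z])

lemma Z_shiftz:
  assumes "x \<in> X"
  shows "Z (shiftz (Z x j) x) i = Z x (i + j) - Z x j"
proof -
  have X': "shiftz (Z x j) x \<in> X"
    using assms by (simp add: ferenczi_subshift_def shiftz_in_subshift)
  have "zenum (shiftz (Z x j) x) (\<lambda>i. Z x (i + j) - Z x j)"
    unfolding zenum_def
  proof (intro conjI)
    show "strict_mono (\<lambda>i. Z x (i + j) - Z x j)"
      using strict_mono_Z[OF assms] by (auto simp: strict_mono_def)
    show "range (\<lambda>i. Z x (i + j) - Z x j) = {p. shiftz (Z x j) x p = 0}"
    proof (intro equalityI subsetI)
      fix p assume "p \<in> {p. shiftz (Z x j) x p = 0}"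
      then obtain l where "p + Z x j = Z x l" using zero_obtains_Z[OF assms, of "p + Z x j"] by auto
      then show "p \<in> range (\<lambda>i. Z x (i + j) - Z x j)" by (intro image_eqI[of _ _ "l - j"]) auto
    qed (use assms in auto)
  qed (use assms Z_less_iff in auto)
  then show ?thesis using zenum_unique[OF _ zenum_Z[OF X']] by metis
qed

end

section \<open>Uniqueness of the cutting points\<close>

context ferenczi
begin

lemma X_shiftz: "x \<in> X \<Longrightarrow> shiftz k x \<in> X"
  by (simp add: ferenczi_subshift_def shiftz_in_subshift)

lemma compact_X: "compact X"
  unfolding ferenczi_subshift_def by (rule compact_subshift) simp

lemma Z_Suc:
  assumes "x \<in> X"
  shows "Z x (j + 1) = Z x j + int (gap x j) + 1"
  using Z_less_iff[OF assms, of j "j + 1"] by (simp add: gap_def)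

lemma Z_add:
  assumes "x \<in> X"
  shows "Z x (j + int k) = Z x j + (\<Sum>i<k. int (gap x (j + int i)) + 1)"
proof (induction k)
  case (Suc k)
  have "Z x (j + int (Suc k)) = Z x (j + int k) + int (gap x (j + int k)) + 1"
    using Z_Suc[OF assms, of "j + int k"] by (simp add: ac_simps)
  then show ?case using Suc by simp
qed simp

lemma gap_shiftz:
  assumes "x \<in> X"
  shows "gap (shiftz (Z x j) x) i = gap x (i + j)"
  by (simp add: gap_def Z_shiftz[OF assms] ac_simps)

text \<open>The coordinates that decide \<open>Z x j\<close> lie between two zeros of
  \<open>x\<close>, so the radius found first depends on \<open>x\<close>; compactness makes it
  uniform.\<close>

lemma local_on_Z: "local_on X (\<lambda>x. Z x j)"
proof (rule local_on_if_locally_constant[OF compact_X])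
  fix x assume x: "x \<in> X"
  let ?J = "nat \<bar>j\<bar>"
  let ?R = "nat (max \<bar>Z x (- int ?J - 1)\<bar> \<bar>Z x (int ?J)\<bar>)"
  have "Z y j = Z x j" if "y \<in> X" "agree ?R x y" for y
  proof (rule sym, rule Z_local[OF x that(1), of ?J])
    fix p assume "Z x (- int ?J - 1) \<le> p" "p \<le> Z x (int ?J)"
    then have "\<bar>p\<bar> \<le> int ?R" by linarith
    then show "x p = y p" using that(2) by (simp only: agree_def)
  qed simp
  then show "\<exists>R. \<forall>y\<in>X. agree R x y \<longrightarrow> Z y j = Z x j" by blast
qed

lemma local_on_gap: "local_on X (\<lambda>x. gap x j)"
  unfolding gap_def
  by (rule local_on_comp2[where h = "\<lambda>u v. nat (u - v - 1)"]) (rule local_on_Z)+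

text \<open>The window of letters begins and ends at zeros of \<open>x\<close>. Its first letter is
  therefore a zero of the limit word, from which both enumerations of zeros run in parallel.\<close>

lemma gap_window:
  assumes x: "x \<in> X"
  shows "\<exists>t. \<forall>i. - int K \<le> i \<longrightarrow> i < int K \<longrightarrow> 0 \<le> t + i \<and> gap x i = sp 0 (nat (t + i))"
proof -
  define lo L where "lo = Z x (- int K)" and "L = nat (Z x (int K) - lo) + 1"
  obtain t0 where t0: "\<And>l. l < L \<Longrightarrow> x (lo + int l) = spaced_letter (t0 + l)"
    using X_window[OF x, of L lo] by blast
  have "spaced_letter t0 = 0" using t0[of 0] x by (simp add: L_def lo_def)
  then obtain k0 where k0: "t0 = zero_pos k0" by (auto simp: spaced_letter_def split: if_splits)
  define u v where "u n = Z x (- int K + int n)" and "v n = int (zero_pos (k0 + n)) - int t0 + lo" for n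
  have uv: "u n = v n" if "n \<le> 2 * K" for n
  proof (rule enumeration_eqI[of u v "2 * K" n, OF _ _ _ _ that])
    show "strict_mono u"
      using strict_mono_Z[OF x] by (auto simp: strict_mono_def u_def)
    show "strict_mono v"
      using strict_mono_zero_pos by (auto simp: strict_mono_def v_def)
    show "u 0 = v 0" by (simp add: u_def v_def lo_def k0)
    fix p assume p: "u 0 < p" "p \<le> u (2 * K)"
    then have p': "lo < p" "nat (p - lo) < L" by (auto simp: u_def lo_def L_def)
    have "p \<in> range u \<longleftrightarrow> x p = 0"
    proof
      assume "x p = 0"
      then obtain j where j: "p = Z x j" by (rule zero_obtains_Z[OF x])
      then have "- int K < j" using p(1) Z_less_iff[OF x] by (simp add: u_def)
      then show "p \<in> range u" using j by (intro image_eqI[of _ _ "nat (j + int K)"]) (auto simp: u_def)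
    qed (auto simp: u_def x)
    moreover have "x p = spaced_letter (t0 + nat (p - lo))"
      using t0[OF p'(2)] p'(1) by simp
    moreover have "spaced_letter (t0 + nat (p - lo)) = 0 \<longleftrightarrow> p \<in> range v"
    proof
      assume "spaced_letter (t0 + nat (p - lo)) = 0"
      then obtain k where k: "t0 + nat (p - lo) = zero_pos k" by (auto simp: spaced_letter_def split: if_splits)
      then have "zero_pos k0 < zero_pos k" using p'(1) k0 by simp
      then have "k0 < k" using strict_mono_zero_pos by (simp add: strict_mono_less)
      then show "p \<in> range v" using k p'(1) by (intro image_eqI[of _ _ "k - k0"]) (auto simp: v_def)
    next
      assume "p \<in> range v"
      then obtain n where "p = v n" by blast
      then have "int (t0 + nat (p - lo)) = int (zero_pos (k0 + n))" using p'(1) by (simp add: v_def)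
      then have "t0 + nat (p - lo) \<in> range zero_pos" by (metis of_nat_eq_iff rangeI)
      then show "spaced_letter (t0 + nat (p - lo)) = 0" by (simp add: spaced_letter_def)
    qed
    ultimately show "p \<in> range u \<longleftrightarrow> p \<in> range v" by simp
  qed
  have "gap x (- int K + int n) = sp 0 (k0 + n)" if "n < 2 * K" for n
  proof -
    have "u (Suc n) - u n = v (Suc n) - v n" using uv[of n] uv[of "Suc n"] that by simp
    then show ?thesis by (simp add: u_def v_def gap_def zero_pos_Suc ac_simps)
  qed
  note base = this
  have "gap x i = sp 0 (nat (int k0 + int K + i))" if "- int K \<le> i" "i < int K" for i
  proof -
    have "nat (i + int K) < 2 * K" "- int K + int (nat (i + int K)) = i"
      "nat (int k0 + int K + i) = k0 + nat (i + int K)"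
      using that by linarith+
    then show ?thesis using base[of "nat (i + int K)"] by metis
  qed
  then show ?thesis by (intro exI[of _ "int k0 + int K"]) auto
qed

text \<open>The copies of \<open>w\<^sub>n\<close> in \<open>x\<close> may be taken to start at the zeros with index congruent to \<open>p\<close> modulo
  \<open>Q 0 n\<close>: every \<open>Q 0 n\<close>-th spacer is free, the others are those of \<open>w\<^sub>n\<close>.\<close>

definition fit :: "nat \<Rightarrow> int \<Rightarrow> (int \<Rightarrow> nat) \<Rightarrow> bool" where
  "fit n p x \<longleftrightarrow> (\<forall>i. let r = nat ((i - p) mod int (Q 0 n)) in
     if r + 1 < Q 0 n then gap x i = sp 0 r else gap x i \<in> alphabet q a (Suc n))"

lemma fit_filled: "fit n p x \<Longrightarrow> nat ((i - p) mod int (Q 0 n)) + 1 < Q 0 n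
    \<Longrightarrow> gap x i = sp 0 (nat ((i - p) mod int (Q 0 n)))"
  and fit_hole: "fit n p x \<Longrightarrow> \<not> nat ((i - p) mod int (Q 0 n)) + 1 < Q 0 n
    \<Longrightarrow> gap x i \<in> alphabet q a (Suc n)"
  unfolding fit_def Let_def by metis+

lemma fit_mod_cong:
  assumes "p mod int (Q 0 n) = p' mod int (Q 0 n)"
  shows "fit n p x \<longleftrightarrow> fit n p' x"
proof -
  have "(i - p) mod int (Q 0 n) = (i - p') mod int (Q 0 n)" for i
    using assms by (metis mod_diff_right_eq)
  then show ?thesis by (simp add: fit_def)
qed

lemma fit_shiftz:
  assumes "x \<in> X"
  shows "fit n p (shiftz (Z x j) x) \<longleftrightarrow> fit n (p + j) x"
proof -
  define R where "R r c \<longleftrightarrow> (if r + 1 < Q 0 n then c = sp 0 r else c \<in> alphabet q a (Suc n))" for r c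
  have F: "fit n p y \<longleftrightarrow> (\<forall>i. R (nat ((i - p) mod int (Q 0 n))) (gap y i))" for p y
    by (simp add: fit_def R_def Let_def)
  show ?thesis
    unfolding F gap_shiftz[OF assms]
  proof (intro iffI allI)
    fix i assume "\<forall>i. R (nat ((i - p) mod int (Q 0 n))) (gap x (i + j))"
    from this[rule_format, of "i - j"] show "R (nat ((i - (p + j)) mod int (Q 0 n))) (gap x i)"
      by (simp add: diff_diff_eq add.commute)
  next
    fix i assume "\<forall>i. R (nat ((i - (p + j)) mod int (Q 0 n))) (gap x i)"
    from this[rule_format, of "i + j"] show "R (nat ((i - p) mod int (Q 0 n))) (gap x (i + j))"
      by simp
  qed
qed

text \<open>Each finite stretch of gaps matches a stretch of \<open>sp 0\<close> with an offset
  \<open>t K\<close>. Only finitely many residues modulo \<open>Q 0 n\<close> are available, so one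
  of them serves arbitrarily long stretches, and its negative is the residue of the cutting
  points.\<close>

lemma fit_exists:
  assumes x: "x \<in> X"
  shows "\<exists>p. fit n p x"
proof -
  let ?Q = "int (Q 0 n)"
  obtain t where t: "\<And>K i. - int K \<le> i \<Longrightarrow> i < int K \<Longrightarrow> 0 \<le> t K + i \<and> gap x i = sp 0 (nat (t K + i))"
    using gap_window[OF x] by metis
  have "(\<lambda>K. t K mod ?Q) ` UNIV \<subseteq> {0..<?Q}" by (auto simp: of_nat_0_less_iff[THEN iffD2])
  then have "finite ((\<lambda>K. t K mod ?Q) ` (UNIV :: nat set))" by (rule finite_subset) simp
  from pigeonhole_infinite[OF infinite_UNIV_nat this]
  obtain K0 where "infinite {K \<in> UNIV. t K mod ?Q = t K0 mod ?Q}" by blast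
  then have inf: "\<exists>K>m. t K mod ?Q = t K0 mod ?Q" for m
    by (auto simp: infinite_nat_iff_unbounded)
  have "fit n (- t K0) x"
    unfolding fit_def Let_def
  proof
    fix i :: int
    obtain K where K: "nat \<bar>i\<bar> < K" "t K mod ?Q = t K0 mod ?Q" using inf by blast
    define k where "k = nat (t K + i)"
    have k: "0 \<le> t K + i" "gap x i = sp 0 k" using t[of K i] K(1) by (auto simp: k_def)
    have "(i - - t K0) mod ?Q = (t K + i) mod ?Q"
      using K(2) by (metis add.commute diff_minus_eq_add mod_add_right_eq)
    also have "\<dots> = int (k mod Q 0 n)" using k(1) by (simp add: k_def zmod_int)
    finally have "nat ((i - - t K0) mod ?Q) = k mod Q 0 n" by simp
    then show "if nat ((i - - t K0) mod ?Q) + 1 < Q 0 n then gap x i = sp 0 (nat ((i - - t K0) mod ?Q))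
        else gap x i \<in> alphabet q a (Suc n)"
      using sp_mod[of 0 n k] sp_hole_mod[of 0 n k] sp_alphabet[of n "k div Q 0 n"] k(2) by auto
  qed
  then show ?thesis by blast
qed

text \<open>\<open>Q 0 m\<close> divides \<open>Q 0 n\<close>. A free index at level
  \<open>n\<close> has residue -1 relative to \<open>p\<close> modulo \<open>Q 0 n\<close>, hence
  modulo \<open>Q 0 m\<close>, so it is free at level \<open>m\<close> too; the filled indices match
  through \<open>sp_mod\<close> and \<open>sp_hole_mod\<close>.\<close>

lemma fit_antimono:
  assumes fit: "fit n p x" and mn: "m \<le> n"
  shows "fit m p x"
  unfolding fit_def Let_def
proof
  fix i :: int
  define r where "r = nat ((i - p) mod int (Q 0 n))"
  have eq: "nat ((i - p) mod int (Q 0 m)) = r mod Q 0 m"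
  proof -
    have "int (Q 0 m) dvd int (Q 0 n)" using Q_mult[of 0 m n] mn by (metis dvd_triv_left of_nat_dvd_iff le0)
    then have "(i - p) mod int (Q 0 m) = int r mod int (Q 0 m)"
      by (simp add: r_def mod_mod_cancel)
    then show ?thesis by (simp add: zmod_int[symmetric])
  qed
  have "r < Q 0 n" by (simp add: r_def nat_less_iff)
  show "if nat ((i - p) mod int (Q 0 m)) + 1 < Q 0 m then gap x i = sp 0 (nat ((i - p) mod int (Q 0 m)))
      else gap x i \<in> alphabet q a (Suc m)"
  proof (cases "r + 1 < Q 0 n")
    case True
    then have "gap x i = sp 0 r" using fit_filled[OF fit, of i] by (simp add: r_def)
    then show ?thesis unfolding eq
      using sp_mod[of 0 m r] sp_hole_mod[of 0 m r] sp_alphabet[of m] by auto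
  next
    case False
    then have r: "r + 1 = Q 0 n" using \<open>r < Q 0 n\<close> by simp
    have "gap x i \<in> alphabet q a (Suc m)"
      using fit_hole[OF fit, of i] False alphabet_Suc_antimono[OF mn, of q a] unfolding r_def by blast
    moreover have "\<not> r mod Q 0 m + 1 < Q 0 m"
    proof
      assume "r mod Q 0 m + 1 < Q 0 m"
      then have "(r + 1) mod Q 0 m = r mod Q 0 m + 1"
        by (metis mod_add_left_eq mod_less)
      moreover have "(r + 1) mod Q 0 m = 0" unfolding r using Q_mult[of 0 m n] mn by (metis le0 mod_mult_self1_is_0)
      ultimately show False by simp
    qed
    ultimately show ?thesis unfolding eq by simp
  qed
qed

end

locale aperiodic_ferenczi = ferenczi +
  assumes aperiodic: "aperiodic_subshift (ferenczi_subshift q a)"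
begin

text \<open>If the gaps had period \<open>P\<close>, the set of zeros would be invariant under
  translation by the distance \<open>D\<close> spanned by \<open>P\<close> gaps, and over two
  letters this makes \<open>x\<close> periodic.\<close>

lemma gap_not_periodic:
  assumes x: "x \<in> X" and P: "0 < P"
  shows "\<exists>i. gap x (i + int P) \<noteq> gap x i"
proof (rule ccontr)
  assume "\<not> ?thesis"
  then have per: "gap x (i + int P) = gap x i" for i by simp
  define D where "D = Z x (int P) - Z x 0"
  have D: "0 < D" using Z_less_iff[OF x, of 0 "int P"] P by (simp add: D_def)
  have base: "Z x (i + int P) - Z x i = D" for i
  proof (induction i rule: int_induct[where k = 0])
    case (step1 i)
    show ?case using step1(2) Z_Suc[OF x, of "i + int P"] Z_Suc[OF x, of i] per[of i] by (simp add: ac_simps)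
  next
    case (step2 i)
    show ?case using step2(2) Z_Suc[OF x, of "i - 1 + int P"] Z_Suc[OF x, of "i - 1"] per[of "i - 1"]
      by (simp add: ac_simps)
  qed (simp add: D_def)
  have zero: "x (p + D) = 0 \<longleftrightarrow> x p = 0" for p
  proof
    assume "x p = 0"
    then obtain j where "p = Z x j" by (rule zero_obtains_Z[OF x])
    then have "p + D = Z x (j + int P)" using base[of j] by simp
    then show "x (p + D) = 0" using x by simp
  next
    assume "x (p + D) = 0"
    then obtain j where "p + D = Z x j" by (rule zero_obtains_Z[OF x])
    then have "p = Z x (j - int P)" using base[of "j - int P"] by simp
    then show "x p = 0" using x by simp
  qed
  have letters: "x p = 0 \<or> x p = 1" for p
    using x by (auto simp: ferenczi_subshift_def subshift_of_words_def)
  have "x (p + D) = x p" for p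
    using letters[of p] letters[of "p + D"] zero[of p] by auto
  then have "(shift_map ^^ nat D) x = x"
    using D by (auto simp: shift_map_funpow)
  moreover have "0 < nat D" using D by simp
  ultimately show False using aperiodic x by (auto simp: aperiodic_subshift_def)
qed

text \<open>Two residues would determine every hole of either from the filled positions of the other, so
  that the spacers of \<open>x\<close>, hence \<open>x\<close> itself, would be periodic.\<close>

lemma fit_unique:
  assumes x: "x \<in> X" and fit: "fit n p x" "fit n p' x"
  shows "p mod int (Q 0 n) = p' mod int (Q 0 n)"
proof (rule ccontr)
  assume neq: "p mod int (Q 0 n) \<noteq> p' mod int (Q 0 n)"
  let ?Q = "int (Q 0 n)"
  have per: "(i + ?Q - p) mod ?Q = (i - p) mod ?Q" for i p
    by (metis add_diff_eq add.commute mod_add_self1)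
  have "gap x (i + ?Q) = gap x i" for i
  proof (cases "nat ((i - p) mod ?Q) + 1 < Q 0 n")
    case True
    then show ?thesis
      using fit_filled[OF fit(1), of i] fit_filled[OF fit(1), of "i + ?Q"] by (simp add: per)
  next
    case False
    \<comment> \<open>A hole for \<open>p\<close> is filled for \<open>p'\<close>: an index free for
      both has residue -1 relative to each, which would make \<open>p\<close> and \<open>p'\<close>
      congruent.\<close>
    have "nat ((i - p') mod ?Q) + 1 < Q 0 n"
    proof (rule ccontr)
      assume "\<not> nat ((i - p') mod ?Q) + 1 < Q 0 n"
      moreover have "0 \<le> (i - p) mod ?Q" "(i - p) mod ?Q < ?Q" "0 \<le> (i - p') mod ?Q" "(i - p') mod ?Q < ?Q"
        by (auto intro: pos_mod_sign pos_mod_bound)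
      ultimately have "(i - p) mod ?Q = (i - p') mod ?Q" using False by linarith
      then have "(i - (i - p)) mod ?Q = (i - (i - p')) mod ?Q" by (metis mod_diff_right_eq)
      then show False using neq by simp
    qed
    then show ?thesis
      using fit_filled[OF fit(2), of i] fit_filled[OF fit(2), of "i + ?Q"] by (simp add: per)
  qed
  then show False using gap_not_periodic[OF x, of "Q 0 n"] by auto
qed

text \<open>Failure to fit shows at a single index and is thus an open condition, whereas fitting
  concerns all indices. Since exactly one residue fits, fitting at \<open>p\<close> amounts to
  failure at the finitely many other residues, so it is open too.\<close>

lemma local_on_fit: "local_on X (fit n p)"
proof (rule local_on_if_locally_constant[OF compact_X])
  fix x assume x: "x \<in> X"
  let ?Q = "int (Q 0 n)"
  have nofit: "\<exists>R. \<forall>y\<in>X. agree R x y \<longrightarrow> \<not> fit n p' y" if nf: "\<not> fit n p' x" for p'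
  proof -
    obtain i where i: "\<not> (let r = nat ((i - p') mod int (Q 0 n)) in
        if r + 1 < Q 0 n then gap x i = sp 0 r else gap x i \<in> alphabet q a (Suc n))"
      using nf unfolding fit_def by blast
    obtain R where "\<And>y. y \<in> X \<Longrightarrow> agree R x y \<Longrightarrow> gap x i = gap y i"
      using local_on_gap[of i] x unfolding local_on_def by blast
    then show ?thesis using i unfolding fit_def by metis
  qed
  show "\<exists>R. \<forall>y\<in>X. agree R x y \<longrightarrow> fit n p y = fit n p x"
  proof (cases "fit n p x")
    case False
    then show ?thesis using nofit[OF False] by blast
  next
    case True
    define F where "F = {0..<?Q} - {p mod ?Q}"
    have "\<not> fit n p' x" if "p' \<in> F" for p'
      using that fit_unique[OF x True, of p'] by (auto simp: F_def)
    then obtain R where R: "\<And>p' y. p' \<in> F \<Longrightarrow> y \<in> X \<Longrightarrow> agree (R p') x y \<Longrightarrow> \<not> fit n p' y"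
      using nofit by metis
    have "fit n p y" if y: "y \<in> X" "agree (\<Sum>p'\<in>F. R p') x y" for y
    proof -
      obtain p' where p': "fit n p' y" using fit_exists[OF y(1)] by blast
      then have p'': "fit n (p' mod ?Q) y" using fit_mod_cong[of p' n "p' mod ?Q"] by simp
      have "p' mod ?Q \<notin> F"
      proof
        assume "p' mod ?Q \<in> F"
        moreover from this have "R (p' mod ?Q) \<le> (\<Sum>p'\<in>F. R p')"
          by (intro member_le_sum) (auto simp: F_def)
        ultimately show False using R y p'' agree_mono by blast
      qed
      then have "p' mod ?Q = p mod ?Q" by (auto simp: F_def)
      then show ?thesis using p' fit_mod_cong by blast
    qed
    then show ?thesis using True by blast
  qed
qed

end

section \<open>Towers\<close>

context
  fixes X :: "(int \<Rightarrow> nat) set" and \<mu> :: "(int \<Rightarrow> nat) measure"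
  assumes mu: "\<mu> \<in> invariant_measures X shift_map"
begin

lemma space_invariant_measure: "space \<mu> = X"
  using mu sets_eq_imp_space_eq[of \<mu> "restrict_space borel X"]
  by (auto simp: invariant_measures_def space_restrict_space)

lemma prob_space_invariant_measure: "prob_space \<mu>"
  using mu by (simp add: invariant_measures_def)

lemma shift_map_in_space: "x \<in> X \<Longrightarrow> shift_map x \<in> X"
  using mu measurable_space[of shift_map \<mu> \<mu>] space_invariant_measure
  by (auto simp: invariant_measures_def)

lemma shiftz_nat_in_space: "x \<in> X \<Longrightarrow> shiftz (int k) x \<in> X"
proof (induction k)
  case (Suc k)
  then have "shift_map (shiftz (int k) x) \<in> X" by (intro shift_map_in_space)
  then show ?case by (simp only: shift_map_eq_shiftz shiftz_shiftz of_nat_Suc)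
qed simp

lemma local_measurable_invariant: "local_on X f \<Longrightarrow> f \<in> measurable \<mu> (count_space UNIV)"
  using local_on_measurable[of X f] mu measurable_cong_sets[of \<mu> "restrict_space borel X", OF _ refl]
  by (auto simp: invariant_measures_def)

lemma local_borel_measurable: "local_on X (f :: _ \<Rightarrow> real) \<Longrightarrow> f \<in> borel_measurable \<mu>"
  using measurable_compose[OF local_measurable_invariant, of f "\<lambda>x. x" borel] by simp

lemma local_integrable:
  fixes f :: "(int \<Rightarrow> nat) \<Rightarrow> real"
  assumes "compact X" and f: "local_on X f"
  shows "integrable \<mu> f"
proof -
  interpret prob_space \<mu> by (rule prob_space_invariant_measure)
  have "compact (f ` X)"
    by (intro compact_continuous_image local_on_imp_continuous assms)
  then obtain b where "\<And>y. y \<in> f ` X \<Longrightarrow> norm y \<le> b"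
    using compact_imp_bounded bounded_iff by metis
  then show ?thesis
    by (intro integrable_const_bound[of _ b] local_borel_measurable f)
       (auto simp: space_invariant_measure intro!: AE_I2)
qed

lemma integral_shiftz:
  fixes f :: "(int \<Rightarrow> nat) \<Rightarrow> real"
  assumes f: "local_on X f"
  shows "(LINT x|\<mu>. f (shiftz (int k) x)) = (LINT x|\<mu>. f x)"
proof (induction k)
  case (Suc k)
  have loc: "local_on X (\<lambda>x. f (shiftz (int k) x))"
    by (rule local_on_shiftz[OF f shiftz_nat_in_space])
  have "(LINT x|\<mu>. f (shiftz (int k) (shift_map x))) = (LINT x|distr \<mu> \<mu> shift_map. f (shiftz (int k) x))"
    using mu local_borel_measurable[OF loc]
    by (intro integral_distr[symmetric]) (auto simp: invariant_measures_def)
  also have "distr \<mu> \<mu> shift_map = \<mu>" using mu by (simp add: invariant_measures_def)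
  finally show ?case using Suc
    by (simp only: shift_map_eq_shiftz shiftz_shiftz of_nat_Suc add.commute)
qed simp

text \<open>A mass transport: \<open>\<phi> x\<close> counts the pieces \<open>E k\<close>, moved
  forward by \<open>d k\<close>, that contain \<open>x\<close>, and invariance moves each piece
  back. It is applied with \<open>\<phi>\<close> constant 1 for tower decompositions and with
  \<open>\<phi>\<close> the indicator of a coarser base.\<close>

lemma integral_transfer:
  fixes f :: "(int \<Rightarrow> nat) \<Rightarrow> real" and d :: "'k \<Rightarrow> nat"
  assumes X: "compact X" "\<And>k x. x \<in> X \<Longrightarrow> shiftz k x \<in> X" and K: "finite K"
    and f: "local_on X f" and E: "\<And>k. k \<in> K \<Longrightarrow> local_on X (E k)"
    and sum: "\<And>x. x \<in> X \<Longrightarrow> (\<Sum>k\<in>K. of_bool (E k (shiftz (- int (d k)) x))) = \<phi> x"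
  shows "(LINT x|\<mu>. \<phi> x * f x) = (\<Sum>k\<in>K. LINT x|\<mu>. of_bool (E k x) * f (shiftz (int (d k)) x))"
proof -
  define g where "g k x = of_bool (E k (shiftz (- int (d k)) x)) * f x" for k x
  have loc: "local_on X (g k)" if "k \<in> K" for k
    unfolding g_def
    by (rule local_on_comp2[where h = "\<lambda>b u. of_bool b * u"])
       (use E f X that in \<open>auto intro!: local_on_shiftz\<close>)
  have "(LINT x|\<mu>. \<phi> x * f x) = (LINT x|\<mu>. (\<Sum>k\<in>K. g k x))"
    by (rule Bochner_Integration.integral_cong)
       (auto simp: space_invariant_measure g_def sum_distrib_right[symmetric] sum)
  also have "\<dots> = (\<Sum>k\<in>K. LINT x|\<mu>. g k x)"
    by (rule Bochner_Integration.integral_sum) (use local_integrable X(1) loc in blast)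
  also have "\<dots> = (\<Sum>k\<in>K. LINT x|\<mu>. g k (shiftz (int (d k)) x))"
    using loc integral_shiftz by (intro sum.cong) auto
  finally show ?thesis by (simp add: g_def)
qed

end

section \<open>Kakutani-Rokhlin towers over the cutting points\<close>

context aperiodic_ferenczi
begin

definition in_base :: "nat \<Rightarrow> (int \<Rightarrow> nat) \<Rightarrow> bool" where "in_base n x \<longleftrightarrow> x 0 = 0 \<and> fit n 0 x"

text \<open>For \<open>x\<close> in the base, the gap with index \<open>Q 0 n - 1\<close> is the
  first hole, that is, the run of ones after the copy of \<open>w\<^sub>n\<close> at the
  origin.\<close>

definition next_spacer :: "nat \<Rightarrow> (int \<Rightarrow> nat) \<Rightarrow> nat" where "next_spacer n x = gap x (int (Q 0 n) - 1)"

definition word_length :: "nat \<Rightarrow> nat" where "word_length n = zero_pos (Q 0 n - 1) + 1"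

lemma local_on_in_base: "local_on X (in_base n)"
  unfolding in_base_def
  by (rule local_on_comp2[of _ "\<lambda>x. x 0" "fit n 0" "\<lambda>u v. u = 0 \<and> v"]) (auto intro: local_on_fit)

lemma local_on_next_spacer: "local_on X (next_spacer n)"
  unfolding next_spacer_def by (rule local_on_gap)

lemma local_on_in_base_next_spacer: "local_on X (\<lambda>x. h (in_base n x) (next_spacer n x))"
  by (rule local_on_comp2[OF local_on_in_base local_on_next_spacer])

lemma Z_zero:
  assumes x: "x \<in> X" and "x 0 = 0"
  shows "Z x 0 = 0"
proof -
  obtain j where j: "0 = Z x j" using zero_obtains_Z[OF assms] .
  then have "-1 < j" using Z_less_iff[OF x, of "-1" j] Z_minus_1[OF x] by simp
  then have "Z x 0 \<le> 0" using Z_le_iff[OF x, of 0 j] j by simp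
  then show ?thesis using Z_0[OF x] by simp
qed

lemma gap_base:
  assumes "in_base n x" "i + 1 < Q 0 n"
  shows "gap x (int i) = sp 0 i"
proof -
  have "nat ((int i - 0) mod int (Q 0 n)) = i" using assms(2) by (simp add: zmod_int[symmetric])
  then show ?thesis using fit_filled[of n 0 x "int i"] assms by (simp add: in_base_def)
qed

lemma Z_base:
  assumes "x \<in> X" "in_base n x" "k < Q 0 n"
  shows "Z x (int k) = int (zero_pos k)"
proof -
  have "Z x (int k) = (\<Sum>i<k. int (gap x (int i)) + 1)"
    using Z_add[OF assms(1), of 0 k] Z_zero[OF assms(1)] assms(2) by (simp add: in_base_def)
  also have "\<dots> = (\<Sum>i<k. int (sp 0 i) + 1)"
    using assms gap_base by (intro sum.cong) auto
  finally show ?thesis by (simp add: zero_pos_def add.commute)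
qed

text \<open>\<open>Z x (int (Q 0 n))\<close> is the next cutting point after the origin, so the
  right-hand side is the height of the tower over the class of \<open>x\<close>.\<close>

lemma Z_return:
  assumes "x \<in> X" "in_base n x"
  shows "Z x (int (Q 0 n)) = int (word_length n + next_spacer n x)"
proof -
  have "Z x (int (Q 0 n - 1)) = int (zero_pos (Q 0 n - 1))"
    by (rule Z_base[OF assms]) (use Q_pos[of 0 n] in linarith)
  moreover have "int (Q 0 n - 1) = int (Q 0 n) - 1" using Q_pos[of 0 n] by linarith
  ultimately show ?thesis
    using Z_Suc[OF assms(1), of "int (Q 0 n) - 1"] by (simp add: next_spacer_def word_length_def)
qed

lemma in_base_shiftz:
  assumes "x \<in> X"
  shows "in_base n (shiftz p x) \<longleftrightarrow> (\<exists>j. p = Z x j \<and> fit n j x)"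
proof
  assume b: "in_base n (shiftz p x)"
  then have "x p = 0" by (simp add: in_base_def)
  then obtain j where "p = Z x j" by (rule zero_obtains_Z[OF assms])
  then show "\<exists>j. p = Z x j \<and> fit n j x" using b fit_shiftz[OF assms, of n 0 j] by (auto simp: in_base_def)
next
  assume "\<exists>j. p = Z x j \<and> fit n j x"
  then show "in_base n (shiftz p x)" using assms fit_shiftz[OF assms, of n 0] by (auto simp: in_base_def)
qed

lemma next_spacer_in_alphabet:
  assumes "in_base n x"
  shows "next_spacer n x \<in> alphabet q a (Suc n)"
proof -
  have "(int (Q 0 n) - 1 - 0) mod int (Q 0 n) = int (Q 0 n) - 1"
    using Q_pos[of 0 n] unfolding diff_zero by (intro mod_pos_pos_trivial) linarith+
  then have "\<not> nat ((int (Q 0 n) - 1 - 0) mod int (Q 0 n)) + 1 < Q 0 n" by simp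
  then show ?thesis using fit_hole[of n 0 x "int (Q 0 n) - 1"] assms by (simp add: in_base_def next_spacer_def)
qed

lemma next_spacer_le: "in_base n x \<Longrightarrow> next_spacer n x \<le> M"
  using next_spacer_in_alphabet alphabet_le by blast

text \<open>The floor containing \<open>x\<close> is found by going back from the origin to the last
  cutting point at or before it; the bound on \<open>k\<close> says that the next cutting point lies
  after the origin. Uniqueness of the residue of cutting points makes the floor unique.\<close>

lemma tower_unique:
  assumes x: "x \<in> X"
  shows "\<exists>!k. in_base n (shiftz (- int k) x) \<and> k < word_length n + next_spacer n (shiftz (- int k) x)"
proof -
  let ?Q = "int (Q 0 n)"
  have Q: "0 < ?Q" using Q_pos[of 0 n] by linarith
  obtain p where p: "fit n p x" using fit_exists[OF x] by blast
  have fit_iff: "fit n j x \<longleftrightarrow> j mod ?Q = p mod ?Q" for j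
    using fit_unique[OF x p] fit_mod_cong p by metis
  \<comment> \<open>The index of the last zero at or before the origin.\<close>
  define j0 where "j0 = (if Z x 0 = 0 then 0 else - 1 :: int)"
  have j0: "Z x j \<le> 0 \<longleftrightarrow> j \<le> j0" for j
  proof (cases "Z x 0 = 0")
    case True
    then show ?thesis using Z_le_iff[OF x, of j 0] by (simp add: j0_def)
  next
    case False
    then have "0 < Z x 0" using Z_0[OF x] by simp
    have "Z x j \<le> 0 \<longleftrightarrow> j \<le> - 1"
    proof
      assume "Z x j \<le> 0"
      then have "Z x j < Z x 0" using \<open>0 < Z x 0\<close> by simp
      then show "j \<le> - 1" using Z_less_iff[OF x] by simp
    next
      assume "j \<le> - 1"
      then show "Z x j \<le> 0" using Z_le_iff[OF x, of j "-1"] Z_minus_1[OF x] by simp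
    qed
    then show ?thesis using False by (simp add: j0_def)
  qed
  have cond: "(in_base n (shiftz (- int k) x) \<and> k < word_length n + next_spacer n (shiftz (- int k) x)) \<longleftrightarrow>
      (\<exists>j. - int k = Z x j \<and> j mod ?Q = p mod ?Q \<and> j0 < j + ?Q)" for k
  proof -
    have "int (word_length n + next_spacer n (shiftz (- int k) x)) = Z x (j + ?Q) + int k"
      if "- int k = Z x j" "fit n j x" for j
    proof -
      have "in_base n (shiftz (- int k) x)" using in_base_shiftz[OF x] that by blast
      from Z_return[OF X_shiftz[OF x] this] show ?thesis
        using Z_shiftz[OF x, of j ?Q] that(1) by (simp add: add.commute)
    qed
    then have "(k < word_length n + next_spacer n (shiftz (- int k) x)) \<longleftrightarrow> j0 < j + ?Q"
      if "- int k = Z x j" "fit n j x" for j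
      using that j0[of "j + ?Q"] by (smt (verit) of_nat_less_iff)
    then show ?thesis unfolding in_base_shiftz[OF x] fit_iff by blast
  qed
  \<comment> \<open>The largest index up to \<open>j0\<close> in the residue class of
    \<open>p\<close>.\<close>
  define j where "j = j0 - (j0 - p) mod ?Q"
  have j: "j mod ?Q = p mod ?Q" "j \<le> j0" "j0 < j + ?Q"
    unfolding j_def using Q by (auto simp: mod_diff_right_eq)
  have uniq: "j' = j" if "j' mod ?Q = p mod ?Q" "j' \<le> j0" "j0 < j' + ?Q" for j'
  proof -
    have "j' mod ?Q = j mod ?Q" using that(1) j(1) by simp
    then have "?Q dvd j' - j" by (simp only: mod_eq_dvd_iff)
    moreover have "\<bar>j' - j\<bar> < ?Q" using that j by linarith
    ultimately show ?thesis by (metis abs_of_pos dvd_imp_le_int eq_iff_diff_eq_0 linorder_not_less Q)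
  qed
  show ?thesis
    unfolding cond
  proof (rule ex1I[of _ "nat (- Z x j)"])
    show "\<exists>j'. - int (nat (- Z x j)) = Z x j' \<and> j' mod ?Q = p mod ?Q \<and> j0 < j' + ?Q"
      using j j0[of j] by (intro exI[of _ j]) simp
    fix k assume "\<exists>j'. - int k = Z x j' \<and> j' mod ?Q = p mod ?Q \<and> j0 < j' + ?Q"
    then obtain j' where j': "- int k = Z x j'" "j' mod ?Q = p mod ?Q" "j0 < j' + ?Q" by blast
    then have "j' = j" using uniq j0[of j'] by simp
    then show "k = nat (- Z x j)" using j'(1) by simp
  qed
qed

lemma sum_of_bool_unique:
  assumes "finite K" "\<exists>!k. k \<in> K \<and> P k"
  shows "(\<Sum>k\<in>K. of_bool (P k)) = (1 :: 'b :: semiring_1)"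
proof -
  obtain k where "K \<inter> {k. P k} = {k}" using assms(2) by blast
  then show ?thesis using assms(1) by (simp add: of_bool_def sum.If_cases)
qed

text \<open>Kac's formula: the tower floors partition \<open>X\<close>, and every floor is carried
  down to its base by invariance.\<close>

lemma kac:
  fixes f :: "(int \<Rightarrow> nat) \<Rightarrow> real"
  assumes mu: "\<mu> \<in> invariant_measures X shift_map" and f: "local_on X f"
  shows "(LINT x|\<mu>. f x) =
    (LINT x|\<mu>. of_bool (in_base n x) * (\<Sum>k<word_length n + next_spacer n x. f (shiftz (int k) x)))"
proof -
  \<comment> \<open>A common bound on all tower heights, which makes the index set of the floors
    independent of the point.\<close>
  let ?H = "word_length n + M"
  let ?E = "\<lambda>k x. in_base n x \<and> k < word_length n + next_spacer n x"
  have locE: "local_on X (?E k)" for k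
    by (rule local_on_in_base_next_spacer[where h = "\<lambda>b c. b \<and> k < word_length n + c"])
  have one: "(\<Sum>k<?H. of_bool (?E k (shiftz (- int k) x))) = (1::real)" if x: "x \<in> X" for x
  proof (rule sum_of_bool_unique)
    have "k < ?H" if "?E k (shiftz (- int k) x)" for k
      using that next_spacer_le[of n "shiftz (- int k) x"] by simp
    then show "\<exists>!k. k \<in> {..<?H} \<and> ?E k (shiftz (- int k) x)"
      using tower_unique[OF x, of n] by blast
  qed simp
  have "(LINT x|\<mu>. f x) = (\<Sum>k<?H. LINT x|\<mu>. of_bool (?E k x) * f (shiftz (int k) x))"
    using integral_transfer[where d = "\<lambda>k. k" and K = "{..<?H}" and E = ?E and \<phi> = "\<lambda>_. 1",
        OF mu compact_X X_shiftz _ f locE one] by simp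
  also have "\<dots> = (LINT x|\<mu>. (\<Sum>k<?H. of_bool (?E k x) * f (shiftz (int k) x)))"
    by (rule Bochner_Integration.integral_sum[symmetric], rule local_integrable[OF mu compact_X],
        rule local_on_comp2[where h = "\<lambda>b u. of_bool b * u"])
       (auto intro: locE local_on_shiftz[OF f] X_shiftz)
  also have "\<dots> = (LINT x|\<mu>. of_bool (in_base n x) * (\<Sum>k<word_length n + next_spacer n x. f (shiftz (int k) x)))"
  proof (rule Bochner_Integration.integral_cong)
    fix x
    show "(\<Sum>k<?H. of_bool (?E k x) * f (shiftz (int k) x))
        = of_bool (in_base n x) * (\<Sum>k<word_length n + next_spacer n x. f (shiftz (int k) x))"
    proof (cases "in_base n x")
      case True
      then have "{..<word_length n + next_spacer n x} \<subseteq> {..<?H}" using next_spacer_le by simp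
      then have "(\<Sum>k<word_length n + next_spacer n x. f (shiftz (int k) x)) = (\<Sum>k<?H. if k < word_length n + next_spacer n x then f (shiftz (int k) x) else 0)"
        by (simp add: sum.If_cases Int_absorb1 flip: lessThan_def)
      then show ?thesis using True by (simp add: of_bool_def if_distrib[of "\<lambda>b. b * _"] cong: if_cong)
    qed simp
  qed simp
  finally show ?thesis .
qed

text \<open>Every copy of \<open>w\<^sub>m\<close> in the cutting is, for exactly one
  \<open>j\<close>, the \<open>j\<close>-th copy inside a copy of \<open>w\<^sub>n\<close>, and
  \<open>zero_pos (j * Q 0 m)\<close> is its distance from the start of the latter.\<close>

lemma levels:
  assumes x: "x \<in> X" and mn: "m \<le> n"
  shows "(\<Sum>j<Q m n. of_bool (in_base n (shiftz (- int (zero_pos (j * Q 0 m))) x))) = (of_bool (in_base m x) :: real)"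
proof -
  have QQ: "Q 0 m * Q m n = Q 0 n" using mn by (simp add: Q_mult)
  have lt: "j * Q 0 m < Q 0 n" if "j < Q m n" for j
    using that by (simp flip: QQ)
  have fit_back: "fit n (- int (j * Q 0 m)) x \<and> x 0 = 0"
    if j: "j < Q m n" and b: "in_base n (shiftz (- int (zero_pos (j * Q 0 m))) x)" for j
  proof -
    define y where "y = shiftz (- int (zero_pos (j * Q 0 m))) x"
    have y: "y \<in> X" "in_base n y" using X_shiftz[OF x] b by (auto simp: y_def)
    have "Z y (int (j * Q 0 m)) = int (zero_pos (j * Q 0 m))" by (rule Z_base[OF y lt[OF j]])
    then have xy: "x = shiftz (Z y (int (j * Q 0 m))) y" by (simp add: y_def)
    have "fit n (- int (j * Q 0 m)) (shiftz (Z y (int (j * Q 0 m))) y)"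
      unfolding fit_shiftz[OF y(1)] using y(2) by (simp add: in_base_def)
    moreover have "shiftz (Z y (int (j * Q 0 m))) y 0 = 0" using y(1) by simp
    ultimately show ?thesis using xy by metis
  qed
  show ?thesis
  proof (cases "in_base m x")
    case False
    have "\<not> in_base n (shiftz (- int (zero_pos (j * Q 0 m))) x)" if "j < Q m n" for j
    proof
      assume "in_base n (shiftz (- int (zero_pos (j * Q 0 m))) x)"
      from fit_back[OF that this] have "fit m (- int (j * Q 0 m)) x" "x 0 = 0"
        using fit_antimono mn by blast+
      moreover have "(- int (j * Q 0 m)) mod int (Q 0 m) = 0 mod int (Q 0 m)" by simp
      ultimately show False using False fit_mod_cong[of "- int (j * Q 0 m)" m 0 x] by (simp add: in_base_def)
    qed
    then show ?thesis using False by simp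
  next
    case True
    have "\<exists>!j. j \<in> {..<Q m n} \<and> in_base n (shiftz (- int (zero_pos (j * Q 0 m))) x)"
    proof (rule ex_ex1I)
      obtain p where p: "fit n p x" using fit_exists[OF x] by blast
      then have "p mod int (Q 0 m) = 0"
        using fit_unique[OF x fit_antimono[OF p mn], of 0] True by (simp add: in_base_def)
      \<comment> \<open>The level-\<open>n\<close> copy around the origin begins \<open>t\<close>
        zeros before it; since the level-\<open>m\<close> cutting points have residue 0,
        \<open>t\<close> is a multiple of \<open>Q 0 m\<close>.\<close>
      define t where "t = (- p) mod int (Q 0 n)"
      have t: "0 \<le> t" "t < int (Q 0 n)" by (simp_all add: t_def)
      have "int (Q 0 m) dvd int (Q 0 n)" unfolding QQ[symmetric] by simp
      moreover have "int (Q 0 m) dvd - p"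
        using \<open>p mod int (Q 0 m) = 0\<close> by (simp only: dvd_minus_iff mod_0_imp_dvd)
      ultimately have "int (Q 0 m) dvd t" unfolding t_def by (rule dvd_mod[rotated])
      then obtain j where j: "t = int (Q 0 m) * j" by (rule dvdE)
      then have "0 \<le> j" using t Q_pos[of 0 m] by (metis zero_le_mult_iff of_nat_0_less_iff linorder_not_less)
      define j' where "j' = nat j"
      have tj: "t = int (j' * Q 0 m)" using j \<open>0 \<le> j\<close> by (simp add: j'_def)
      have "j' * Q 0 m < Q 0 n" using t(2) unfolding tj by (simp only: of_nat_less_iff)
      then have "j' * Q 0 m < Q m n * Q 0 m" using QQ by (simp add: mult.commute)
      then have j'Q: "j' < Q m n" by simp
      have "(- t) mod int (Q 0 n) = p mod int (Q 0 n)" by (simp add: t_def mod_minus_eq)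
      then have ft: "fit n (- t) x" using p fit_mod_cong by blast
      define y where "y = shiftz (Z x (- t)) x"
      have y: "y \<in> X" "in_base n y" using X_shiftz[OF x] in_base_shiftz[OF x] ft by (auto simp: y_def)
      have "int (zero_pos (j' * Q 0 m)) = Z y t" unfolding tj by (rule Z_base[OF y lt[OF j'Q], symmetric])
      also have "\<dots> = Z x 0 - Z x (- t)" unfolding y_def Z_shiftz[OF x] by simp
      also have "Z x 0 = 0" using Z_zero[OF x] True by (simp add: in_base_def)
      finally have "y = shiftz (- int (zero_pos (j' * Q 0 m))) x" by (simp add: y_def)
      then show "\<exists>j. j \<in> {..<Q m n} \<and> in_base n (shiftz (- int (zero_pos (j * Q 0 m))) x)"
        using y j'Q by blast
    next
      fix j k assume jk: "j \<in> {..<Q m n} \<and> in_base n (shiftz (- int (zero_pos (j * Q 0 m))) x)"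
        "k \<in> {..<Q m n} \<and> in_base n (shiftz (- int (zero_pos (k * Q 0 m))) x)"
      then have "(- int (j * Q 0 m)) mod int (Q 0 n) = (- int (k * Q 0 m)) mod int (Q 0 n)"
        using fit_back fit_unique[OF x] by blast
      then have "int (j * Q 0 m) mod int (Q 0 n) = int (k * Q 0 m) mod int (Q 0 n)"
        by (metis mod_minus_eq minus_minus)
      then have "j * Q 0 m mod Q 0 n = k * Q 0 m mod Q 0 n"
        by (simp only: zmod_int[symmetric] of_nat_eq_iff)
      then have "j * Q 0 m = k * Q 0 m"
        using jk lt by (metis lessThan_iff mod_less)
      then show "j = k" using Q_pos[of 0 m] by simp
    qed
    then show ?thesis using True by (subst sum_of_bool_unique) auto
  qed
qed

text \<open>The last of the \<open>Q m n\<close> copies of \<open>w\<^sub>m\<close> in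
  \<open>w\<^sub>n\<close> ends where \<open>w\<^sub>n\<close> ends, so its spacer is the one
  following \<open>w\<^sub>n\<close>; the others are followed by spacers inside
  \<open>w\<^sub>n\<close>.\<close>

lemma next_spacer_level:
  assumes y: "y \<in> X" "in_base n y" and mn: "m \<le> n" and j: "j < Q m n"
  shows "next_spacer m (shiftz (int (zero_pos (j * Q 0 m))) y) = (if j + 1 < Q m n then sp m j else next_spacer n y)"
proof -
  have QQ: "Q 0 n = Q m n * Q 0 m" using mn Q_mult[of 0 m n] by (simp add: mult.commute)
  have "j * Q 0 m < Q 0 n" using j by (simp add: QQ)
  then have eq: "next_spacer m (shiftz (int (zero_pos (j * Q 0 m))) y) = gap y (int (Q 0 m) - 1 + int (j * Q 0 m))"
    using Z_base[OF y, of "j * Q 0 m"] gap_shiftz[OF y(1), of "int (j * Q 0 m)"] by (simp add: next_spacer_def)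
  have idx: "int (Q 0 m) - 1 + int (j * Q 0 m) = int (j * Q 0 m + (Q 0 m - 1))"
    using Q_pos[of 0 m] by linarith
  show ?thesis
  proof (cases "j + 1 < Q m n")
    case True
    have "j * Q 0 m + (Q 0 m - 1) + 1 = (j + 1) * Q 0 m" using Q_pos[of 0 m] by (simp add: algebra_simps)
    also have "\<dots> < Q 0 n" using True by (simp only: QQ mult_less_cancel2 Q_pos simp_thms)
    finally have "gap y (int (j * Q 0 m + (Q 0 m - 1))) = sp 0 (j * Q 0 m + (Q 0 m - 1))"
      by (rule gap_base[OF y(2)])
    then show ?thesis
      unfolding eq idx using True sp_hole[of 0 m j] by (simp only: le0 if_True)
  next
    case False
    then have "Q m n = j + 1" using j by simp
    then have "int (Q 0 m) - 1 + int (j * Q 0 m) = int (Q 0 n) - 1"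
      by (simp add: QQ algebra_simps)
    then show ?thesis using False unfolding eq by (simp only: next_spacer_def if_False)
  qed
qed

end

section \<open>Measures of the bases and of their classes\<close>

context aperiodic_ferenczi
begin

lemma invariant_measures_nonempty: "invariant_measures X shift_map \<noteq> {}"
  unfolding ferenczi_subshift_def
proof (rule invariant_measure_exists)
  fix u assume "u \<in> range (gen_word q a)"
  then obtain n where u: "u = spaced (Q 0 n - 1) @ [0]" by (auto simp: gen_word_eq)
  have "set (spaced k) \<subseteq> {0, 1}" for k
    by (induction k) auto
  from this[of "Q 0 n - 1"] show "set u \<subseteq> {0, 1}" unfolding u by simp
next
  fix n
  have "Q 0 n - 1 \<le> zero_pos (Q 0 n - 1)" by (rule strict_mono_imp_increasing[OF strict_mono_zero_pos])
  then have "n \<le> length (gen_word q a n)"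
    using Q_ge[of n 0] unfolding length_gen_word by simp
  then show "\<exists>u\<in>range (gen_word q a). n \<le> length u" by blast
qed simp

lemma Q_neq_0: "Q m n \<noteq> 0"
  using Q_pos[of m n] by (simp del: Q_pos)

definition base_measure :: "(int \<Rightarrow> nat) measure \<Rightarrow> nat \<Rightarrow> real" where
  "base_measure \<mu> n = (LINT x|\<mu>. of_bool (in_base n x))"

definition class_measure :: "(int \<Rightarrow> nat) measure \<Rightarrow> nat \<Rightarrow> nat \<Rightarrow> real" where
  "class_measure \<mu> n c = (LINT x|\<mu>. of_bool (in_base n x \<and> next_spacer n x = c))"

text \<open>Refers to the spacers between consecutive copies of \<open>w\<^sub>m\<close> inside one
  \<open>w\<^sub>n\<close>. The last index is left out because the spacer after the final copy lies
  outside \<open>w\<^sub>n\<close>.\<close>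

definition occ :: "nat \<Rightarrow> nat \<Rightarrow> nat \<Rightarrow> nat" where
  "occ m n c = card {j. j + 1 < Q m n \<and> sp m j = c}"

context
  fixes \<mu> :: "(int \<Rightarrow> nat) measure"
  assumes mu: "\<mu> \<in> invariant_measures X shift_map"
begin

lemma integrable_local: "local_on X f \<Longrightarrow> integrable \<mu> (f :: _ \<Rightarrow> real)"
  by (rule local_integrable[OF mu compact_X])

lemma integrable_in_base_next_spacer: "integrable \<mu> (\<lambda>x. h (in_base n x) (next_spacer n x) :: real)"
  by (rule integrable_local[OF local_on_in_base_next_spacer])

lemma space_mu: "space \<mu> = X"
  by (rule space_invariant_measure[OF mu])

lemma integral_class:
  "(LINT x|\<mu>. of_bool (in_base n x) * g (next_spacer n x)) = (\<Sum>c\<in>alphabet q a (Suc n). g c * class_measure \<mu> n c)"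
proof -
  have "(LINT x|\<mu>. of_bool (in_base n x) * g (next_spacer n x))
      = (LINT x|\<mu>. (\<Sum>c\<in>alphabet q a (Suc n). g c * of_bool (in_base n x \<and> next_spacer n x = c)))"
  proof (rule Bochner_Integration.integral_cong)
    fix x
    show "of_bool (in_base n x) * g (next_spacer n x) = (\<Sum>c\<in>alphabet q a (Suc n). g c * of_bool (in_base n x \<and> next_spacer n x = c))"
    proof (cases "in_base n x")
      case True
      then have "(\<Sum>c\<in>alphabet q a (Suc n). g c * of_bool (in_base n x \<and> next_spacer n x = c))
          = (\<Sum>c\<in>alphabet q a (Suc n). if c = next_spacer n x then g c else 0)"
        by (intro sum.cong) auto
      then show ?thesis using True next_spacer_in_alphabet[OF True] finite_alphabet[of n]
        by (simp add: sum.delta del: alphabet.simps)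
    qed simp
  qed simp
  also have "\<dots> = (\<Sum>c\<in>alphabet q a (Suc n). LINT x|\<mu>. g c * of_bool (in_base n x \<and> next_spacer n x = c))"
    by (intro Bochner_Integration.integral_sum
        integrable_in_base_next_spacer[where h = "\<lambda>b c'. g c * of_bool (b \<and> c' = c)" for c])
  finally show ?thesis by (simp add: class_measure_def del: alphabet.simps)
qed

lemma base_measure_eq_sum: "base_measure \<mu> n = (\<Sum>c\<in>alphabet q a (Suc n). class_measure \<mu> n c)"
  using integral_class[of n "\<lambda>_. 1"] by (simp add: base_measure_def del: alphabet.simps)

text \<open>Kac's formula for the constant 1: the masses of all towers add up to 1.\<close>

lemma kac_one: "(\<Sum>c\<in>alphabet q a (Suc n). (real (word_length n) + real c) * class_measure \<mu> n c) = 1"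
proof -
  interpret prob_space \<mu> by (rule prob_space_invariant_measure[OF mu])
  have "(1::real) = (LINT x|\<mu>. 1)" using prob_space by simp
  also have "\<dots> = (LINT x|\<mu>. of_bool (in_base n x) * (real (word_length n) + real (next_spacer n x)))"
    using kac[OF mu local_on_const, of 1 n] by simp
  finally show ?thesis using integral_class[of n "\<lambda>c. real (word_length n) + real c"] by simp
qed

lemma level_integral:
  fixes f :: "(int \<Rightarrow> nat) \<Rightarrow> real"
  assumes "m \<le> n" "local_on X f"
  shows "(LINT x|\<mu>. of_bool (in_base m x) * f x)
    = (\<Sum>j<Q m n. LINT x|\<mu>. of_bool (in_base n x) * f (shiftz (int (zero_pos (j * Q 0 m))) x))"
  using integral_transfer[where d = "\<lambda>j. zero_pos (j * Q 0 m)" and K = "{..<Q m n}" and E = "\<lambda>_. in_base n"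
      and \<phi> = "\<lambda>x. of_bool (in_base m x)", OF mu compact_X X_shiftz _ assms(2) local_on_in_base levels[OF _ assms(1)]]
  by simp

lemma base_measure_level: "m \<le> n \<Longrightarrow> base_measure \<mu> m = real (Q m n) * base_measure \<mu> n"
  using level_integral[of m n "\<lambda>_. 1"] by (simp add: base_measure_def)

lemma class_measure_level:
  assumes mn: "m \<le> n"
  shows "class_measure \<mu> m c = real (occ m n c) * base_measure \<mu> n + class_measure \<mu> n c"
proof -
  have "class_measure \<mu> m c = (LINT x|\<mu>. of_bool (in_base m x) * of_bool (next_spacer m x = c))"
    by (simp add: class_measure_def of_bool_conj)
  also have "\<dots> = (\<Sum>j<Q m n. LINT x|\<mu>. of_bool (in_base n x) * of_bool (next_spacer m (shiftz (int (zero_pos (j * Q 0 m))) x) = c))"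
    by (rule level_integral[OF mn local_on_comp[OF local_on_next_spacer, of "\<lambda>c'. of_bool (c' = c)"]])
  also have "\<dots> = (\<Sum>j<Q m n. if j + 1 < Q m n then of_bool (sp m j = c) * base_measure \<mu> n else class_measure \<mu> n c)"
  proof (rule sum.cong)
    fix j assume j: "j \<in> {..<Q m n}"
    have "(LINT x|\<mu>. of_bool (in_base n x) * of_bool (next_spacer m (shiftz (int (zero_pos (j * Q 0 m))) x) = c))
        = (LINT x|\<mu>. (if j + 1 < Q m n then of_bool (sp m j = c) * of_bool (in_base n x)
            else of_bool (in_base n x \<and> next_spacer n x = c) :: real))"
    proof (rule Bochner_Integration.integral_cong)
      fix x assume "x \<in> space \<mu>"
      then have x: "x \<in> X" by (simp add: space_mu)
      show "of_bool (in_base n x) * of_bool (next_spacer m (shiftz (int (zero_pos (j * Q 0 m))) x) = c)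
        = (if j + 1 < Q m n then of_bool (sp m j = c) * of_bool (in_base n x)
            else of_bool (in_base n x \<and> next_spacer n x = c) :: real)"
        using next_spacer_level[OF x _ mn, of j] j by (cases "in_base n x") auto
    qed simp
    then show "(LINT x|\<mu>. of_bool (in_base n x) * of_bool (next_spacer m (shiftz (int (zero_pos (j * Q 0 m))) x) = c))
      = (if j + 1 < Q m n then of_bool (sp m j = c) * base_measure \<mu> n else class_measure \<mu> n c)"
      by (simp add: base_measure_def class_measure_def)
  qed simp
  also have "\<dots> = (\<Sum>j<Q m n - 1. of_bool (sp m j = c) * base_measure \<mu> n) + class_measure \<mu> n c"
  proof -
    obtain r where r: "Q m n = Suc r" using Q_pos[of m n] by (metis gr0_implies_Suc)
    show ?thesis unfolding r by simp
  qed
  also have "(\<Sum>j<Q m n - 1. of_bool (sp m j = c) * base_measure \<mu> n) = real (occ m n c) * base_measure \<mu> n"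
  proof -
    have "{..<Q m n - 1} \<inter> {j. sp m j = c} = {j. j + 1 < Q m n \<and> sp m j = c}" by auto
    then show ?thesis by (simp add: occ_def of_bool_def sum.If_cases flip: sum_distrib_right)
  qed
  finally show ?thesis .
qed

lemma class_measure_nonneg: "0 \<le> class_measure \<mu> n c"
  unfolding class_measure_def by (rule integral_nonneg_AE) simp

lemma class_measure_le: "class_measure \<mu> n c \<le> base_measure \<mu> n"
  unfolding class_measure_def base_measure_def
  by (rule integral_mono[OF integrable_in_base_next_spacer[where h = "\<lambda>b c'. of_bool (b \<and> c' = c)"]
        integrable_in_base_next_spacer[where h = "\<lambda>b c'. of_bool b"]]) simp

text \<open>With a null base all towers would be null, against \<open>kac_one\<close>.\<close>

lemma base_measure_pos: "0 < base_measure \<mu> n"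
proof (rule ccontr)
  assume "\<not> 0 < base_measure \<mu> n"
  then have "class_measure \<mu> n c = 0" for c
    using class_measure_nonneg[of n c] class_measure_le[of n c] by linarith
  then show False using kac_one[of n] by simp
qed

text \<open>The error is the share of class \<open>c\<close> in the level-\<open>n\<close> base, a
  number between 0 and 1, divided by \<open>Q m n\<close>. The approximating fractions are purely
  combinatorial, so their limit does not depend on \<open>\<mu>\<close>.\<close>

lemma ratio_bound:
  assumes "m \<le> n"
  shows "\<bar>class_measure \<mu> m c / base_measure \<mu> m - real (occ m n c) / real (Q m n)\<bar> \<le> 1 / real (Q m n)"
proof -
  have pos: "0 < base_measure \<mu> n" "0 < real (Q m n)" by (simp_all add: base_measure_pos)
  define r where "r = class_measure \<mu> n c / base_measure \<mu> n"
  have "class_measure \<mu> m c / base_measure \<mu> m - real (occ m n c) / real (Q m n) = r / real (Q m n)"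
    unfolding class_measure_level[OF assms, of c] base_measure_level[OF assms] r_def
    using pos by (simp add: field_simps Q_neq_0)
  moreover have "0 \<le> r" "r \<le> 1"
    using class_measure_nonneg[of n c] class_measure_le[of n c] pos by (simp_all add: r_def)
  then have "0 \<le> r / real (Q m n)" "r / real (Q m n) \<le> 1 / real (Q m n)"
    by (simp_all add: divide_right_mono)
  ultimately show ?thesis by linarith
qed

end

lemma Q_inverse_tendsto_0: "(\<lambda>d. C / real (Q m (m + d))) \<longlonglongrightarrow> 0"
proof (rule real_tendsto_divide_at_top[OF tendsto_const])
  show "filterlim (\<lambda>d. real (Q m (m + d))) at_top sequentially"
    by (rule filterlim_at_top_mono[OF filterlim_real_sequentially]) (simp add: Q_ge)
qed

text \<open>Identifies class shares of two measures, two measures on a derived subshift, and a class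
  share with a letter frequency: in each case both sides are approached by the same
  fractions.\<close>

lemma eq_if_both_approximated:
  fixes u v :: real
  assumes u: "\<And>n. m \<le> n \<Longrightarrow> \<bar>u - w n / real (Q m n)\<bar> \<le> C / real (Q m n)"
    and v: "\<And>n. m \<le> n \<Longrightarrow> \<bar>v - w n / real (Q m n)\<bar> \<le> D / real (Q m n)"
  shows "u = v"
proof -
  have "\<bar>u - v\<bar> \<le> (C + D) / real (Q m (m + d))" for d
    using u[of "m + d"] v[of "m + d"] unfolding add_divide_distrib by simp
  then have "\<bar>u - v\<bar> \<le> 0"
    by (intro LIMSEQ_le_const[OF Q_inverse_tendsto_0[of "C + D" m]]) auto
  then show ?thesis by simp
qed

context
  fixes \<mu> \<nu> :: "(int \<Rightarrow> nat) measure"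
  assumes mu: "\<mu> \<in> invariant_measures X shift_map" and nu: "\<nu> \<in> invariant_measures X shift_map"
begin

text \<open>Combinatorial counts fix the shares of the classes within the base, and Kac's formula
  then fixes the measure of the base.\<close>

lemma class_measure_unique: "class_measure \<mu> n c = class_measure \<nu> n c"
proof -
  have ratio: "class_measure \<mu> n c / base_measure \<mu> n = class_measure \<nu> n c / base_measure \<nu> n" for c
    by (rule eq_if_both_approximated[of n]) (fact ratio_bound[OF mu] ratio_bound[OF nu])+
  have total: "(\<Sum>c\<in>alphabet q a (Suc n). (real (word_length n) + real c) * (class_measure \<mu>' n c / base_measure \<mu>' n)) * base_measure \<mu>' n = 1"
    if "\<mu>' \<in> invariant_measures X shift_map" for \<mu>'
    using kac_one[OF that, of n] base_measure_pos[OF that, of n]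
    by (simp add: sum_distrib_right del: alphabet.simps)
  define S where "S = (\<Sum>c\<in>alphabet q a (Suc n). (real (word_length n) + real c) * (class_measure \<mu> n c / base_measure \<mu> n))"
  have "S * base_measure \<mu> n = 1" "S * base_measure \<nu> n = 1"
    using total[OF mu] total[OF nu] unfolding S_def ratio by simp_all
  then have "S * base_measure \<mu> n = S * base_measure \<nu> n" "S \<noteq> 0" by auto
  then have "base_measure \<mu> n = base_measure \<nu> n" by simp
  then show ?thesis using ratio[of c] base_measure_pos[OF nu, of n] by simp
qed

end

text \<open>The spacer after the first copy of \<open>w\<^sub>n\<close> is followed by another copy
  of \<open>w\<^sub>n\<close>, so agreement reaches beyond the top of the tower by at least
  \<open>Q 0 n - 1\<close> places. This look-ahead, unbounded in \<open>n\<close>, controls window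
  functions near the top.\<close>

lemma agree_tower:
  assumes x: "x \<in> X" "in_base n x" and y: "y \<in> X" "in_base n y" and next_spacer: "next_spacer n x = next_spacer n y"
    and p: "0 \<le> p" "p + 1 < int (word_length n + next_spacer n x + Q 0 n)"
  shows "x p = y p"
proof -
  let ?Q = "Q 0 n"
  \<comment> \<open>Among the gaps with index from 0 to \<open>2 * Q 0 n - 2\<close> the only hole
    is the one at \<open>Q 0 n - 1\<close>, which is \<open>next_spacer\<close>.\<close>
  have gap_eq: "gap x (int i) = gap y (int i)" if "i < 2 * ?Q - 1" for i
  proof (cases "i = ?Q - 1")
    case True
    then have "int i = int ?Q - 1" using Q_pos[of 0 n] by linarith
    then show ?thesis using next_spacer by (simp add: next_spacer_def)
  next
    case False
    have "i mod ?Q + 1 < ?Q"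
    proof (cases "i < ?Q")
      case True
      then show ?thesis using False by simp
    next
      case False
      then have "i mod ?Q = i - ?Q" using that by (simp add: le_mod_geq)
      then show ?thesis using that False by simp
    qed
    then have "nat ((int i - 0) mod int ?Q) + 1 < ?Q" by (simp add: zmod_int[symmetric])
    then show ?thesis
      using fit_filled[of n 0 x "int i"] fit_filled[of n 0 y "int i"] x y by (simp add: in_base_def)
  qed
  have Z_eq: "Z x (int k) = Z y (int k)" if "k \<le> 2 * ?Q - 1" for k
  proof -
    have "Z x (0 + int k) = Z x 0 + (\<Sum>i<k. int (gap x (0 + int i)) + 1)" by (rule Z_add[OF x(1)])
    also have "\<dots> = Z y 0 + (\<Sum>i<k. int (gap y (0 + int i)) + 1)"
      using that x y by (intro arg_cong2[where f = "(+)"] sum.cong) (auto simp: gap_eq Z_zero in_base_def)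
    also have "\<dots> = Z y (0 + int k)" by (rule Z_add[OF y(1), symmetric])
    finally show ?thesis by simp
  qed
  have far: "p \<le> Z z (int (2 * ?Q - 1))" if z: "z \<in> X" "in_base n z" "next_spacer n z = next_spacer n x" for z
  proof -
    have "int (2 * ?Q - 1) = int ?Q + int (?Q - 1)" using Q_pos[of 0 n] by linarith
    then have "Z z (int (2 * ?Q - 1)) = Z z (int ?Q) + (\<Sum>i<?Q - 1. int (gap z (int ?Q + int i)) + 1)"
      using Z_add[OF z(1), of "int ?Q" "?Q - 1"] by simp
    moreover have "(\<Sum>i<?Q - 1. 1) \<le> (\<Sum>i<?Q - 1. int (gap z (int ?Q + int i)) + 1)"
      by (rule sum_mono) simp
    ultimately have "int (word_length n + next_spacer n x) + int (?Q - 1) \<le> Z z (int (2 * ?Q - 1))"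
      using Z_return[OF z(1,2)] z(3) by simp
    then show ?thesis using p(2) Q_pos[of 0 n] by linarith
  qed
  have zero: "z' p = 0" if z: "z \<in> X" "in_base n z" "next_spacer n z = next_spacer n x" and z': "z' \<in> X" "z p = 0"
    and eq: "\<And>k. k \<le> 2 * ?Q - 1 \<Longrightarrow> Z z (int k) = Z z' (int k)" for z z'
  proof -
    obtain j where j: "p = Z z j" using zero_obtains_Z[OF z(1) z'(2)] .
    have "0 \<le> j" using j p(1) Z_zero[OF z(1)] z(2) Z_le_iff[OF z(1), of 0 j] by (simp add: in_base_def)
    moreover have "j \<le> int (2 * ?Q - 1)" using far[OF z] j Z_le_iff[OF z(1)] by metis
    ultimately have "Z z j = Z z' j" using eq[of "nat j"] by (simp add: nat_le_iff)
    then show "z' p = 0" using j z'(1) by simp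
  qed
  have "x p = 0 \<longleftrightarrow> y p = 0"
    using zero[OF x refl y(1)] zero[OF y next_spacer[symmetric] x(1)] Z_eq by metis
  moreover have "z p = 0 \<or> z p = 1" if "z \<in> X" for z
    using that by (auto simp: ferenczi_subshift_def subshift_of_words_def)
  ultimately show ?thesis using x(1) y(1) by metis
qed

text \<open>For deep enough \<open>n\<close> the sum of \<open>f\<close> along a tower, up to a
  fixed shift, depends only on the class of its base point, and it is an integer.\<close>

lemma integral_in_classes:
  fixes f :: "(int \<Rightarrow> nat) \<Rightarrow> int"
  assumes f: "local_on X f"
  shows "\<exists>N. \<forall>n\<ge>N. \<exists>m :: nat \<Rightarrow> int. \<forall>\<mu>\<in>invariant_measures X shift_map.
    (LINT x|\<mu>. real_of_int (f x)) = (\<Sum>c\<in>alphabet q a (Suc n). real_of_int (m c) * class_measure \<mu> n c)"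
proof -
  obtain R where R: "\<And>x y. x \<in> X \<Longrightarrow> y \<in> X \<Longrightarrow> agree R x y \<Longrightarrow> f x = f y"
    using f unfolding local_on_def by blast
  \<comment> \<open>After a shift by \<open>R\<close> the function reads coordinates 0 to
    \<open>2 * R\<close> only, so the windows never reach below the base of the tower.\<close>
  define g where "g x = f (shiftz (int R) x)" for x
  have "\<exists>m :: nat \<Rightarrow> int. \<forall>\<mu>\<in>invariant_measures X shift_map.
      (LINT x|\<mu>. real_of_int (f x)) = (\<Sum>c\<in>alphabet q a (Suc n). real_of_int (m c) * class_measure \<mu> n c)"
    if n: "n \<ge> 2 * R + 1" for n
  proof -
    have nQ: "2 * R + 1 \<le> Q 0 n" using n Q_ge[of n 0] by simp
    define G where "G x = (\<Sum>k<word_length n + next_spacer n x. g (shiftz (int k) x))" for x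
    have G_eq: "G x = G y" if x: "x \<in> X" "in_base n x" and y: "y \<in> X" "in_base n y" and next_spacer: "next_spacer n x = next_spacer n y" for x y
      unfolding G_def next_spacer[symmetric]
    proof (rule sum.cong)
      fix k assume k: "k \<in> {..<word_length n + next_spacer n x}"
      have "agree R (shiftz (int R + int k) x) (shiftz (int R + int k) y)"
        unfolding agree_def shiftz_apply
      proof (intro allI impI)
        fix i assume "\<bar>i\<bar> \<le> int R"
        then have "0 \<le> i + (int R + int k)" "i + (int R + int k) + 1 < int (word_length n + next_spacer n x + Q 0 n)"
          using k nQ by auto
        then show "x (i + (int R + int k)) = y (i + (int R + int k))"
          by (rule agree_tower[OF x y next_spacer])
      qed
      then show "g (shiftz (int k) x) = g (shiftz (int k) y)"
        unfolding g_def shiftz_shiftz by (rule R[OF X_shiftz[OF x(1)] X_shiftz[OF y(1)]])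
    qed simp
    \<comment> \<open>Any point of the class serves as representative; for an empty class the value
      is arbitrary.\<close>
    define m where "m c = G (SOME x. x \<in> X \<and> in_base n x \<and> next_spacer n x = c)" for c
    have m: "G x = m (next_spacer n x)" if "x \<in> X" "in_base n x" for x
    proof -
      let ?y = "SOME y. y \<in> X \<and> in_base n y \<and> next_spacer n y = next_spacer n x"
      have "?y \<in> X \<and> in_base n ?y \<and> next_spacer n ?y = next_spacer n x" by (rule someI[of _ x]) (use that in simp)
      then show ?thesis unfolding m_def using G_eq[OF that] by metis
    qed
    have "(LINT x|\<mu>. real_of_int (f x)) = (\<Sum>c\<in>alphabet q a (Suc n). real_of_int (m c) * class_measure \<mu> n c)"
      if mu: "\<mu> \<in> invariant_measures X shift_map" for \<mu>
    proof -
      have lf: "local_on X (\<lambda>x. real_of_int (f x))" by (rule local_on_comp[OF f])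
      have lg: "local_on X (\<lambda>x. real_of_int (g x))"
        unfolding g_def by (rule local_on_shiftz[OF lf X_shiftz])
      have "(LINT x|\<mu>. real_of_int (f x)) = (LINT x|\<mu>. real_of_int (g x))"
        using integral_shiftz[OF mu lf, of R] by (simp add: g_def)
      also have "\<dots> = (LINT x|\<mu>. of_bool (in_base n x) * real_of_int (G x))"
        unfolding G_def using kac[OF mu lg, of n] by simp
      also have "\<dots> = (LINT x|\<mu>. of_bool (in_base n x) * real_of_int (m (next_spacer n x)))"
        by (rule Bochner_Integration.integral_cong) (auto simp: space_mu[OF mu] m)
      also have "\<dots> = (\<Sum>c\<in>alphabet q a (Suc n). real_of_int (m c) * class_measure \<mu> n c)"
        by (rule integral_class[OF mu])
      finally show ?thesis .
    qed
    then show ?thesis by blast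
  qed
  then show ?thesis by blast
qed

lemma integral_unique:
  fixes f :: "(int \<Rightarrow> nat) \<Rightarrow> int"
  assumes f: "local_on X f" and mu: "\<mu> \<in> invariant_measures X shift_map"
    and nu: "\<nu> \<in> invariant_measures X shift_map"
  shows "(LINT x|\<mu>. real_of_int (f x)) = (LINT x|\<nu>. real_of_int (f x))"
proof -
  obtain n where "\<exists>m :: nat \<Rightarrow> int. \<forall>\<mu>\<in>invariant_measures X shift_map.
    (LINT x|\<mu>. real_of_int (f x)) = (\<Sum>c\<in>alphabet q a (Suc n). real_of_int (m c) * class_measure \<mu> n c)"
    using integral_in_classes[OF f] by (meson order.refl)
  then obtain m :: "nat \<Rightarrow> int" where m: "\<And>\<mu>. \<mu> \<in> invariant_measures X shift_map \<Longrightarrow>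
    (LINT x|\<mu>. real_of_int (f x)) = (\<Sum>c\<in>alphabet q a (Suc n). real_of_int (m c) * class_measure \<mu> n c)"
    by meson
  show ?thesis
    unfolding m[OF mu] m[OF nu] by (simp only: class_measure_unique[OF mu nu])
qed

end

section \<open>The derived subshift\<close>

context ferenczi
begin

lemma length_tau: "length (tau q a (Suc n) c) = q n + 1"
  using q_ge_2[of n] by simp

text \<open>The image word is the block \<open>a n 0\<close>, ..., \<open>a n (q n - 1)\<close>,
  hole, rotated by one place, with the letter \<open>c\<close> in the hole. This rotation is the
  source of every \<open>i + 1\<close> in \<open>tau_word_nth\<close> and of the phases
  \<open>d\<close> in \<open>tau_comp_fit\<close>.\<close>

lemma tau_nth:
  assumes "i \<le> q n"
  shows "tau q a (Suc n) c ! i = (if (i + 1) mod (q n + 1) < q n then a n ((i + 1) mod (q n + 1)) else c)"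
proof -
  consider "i + 1 < q n" | "i + 1 = q n" | "i = q n" using assms by linarith
  then show ?thesis
    by cases (use q_ge_2[of n] in \<open>auto simp: nth_append nth_Cons'\<close>)
qed

lemma length_tau_word: "length (tau_word q a (Suc n) w) = length w * (q n + 1)"
  by (induction w) (simp_all add: tau_word_def length_tau del: tau.simps)

lemma tau_word_nth:
  "i < length w * (q n + 1) \<Longrightarrow> tau_word q a (Suc n) w ! i =
    (if (i + 1) mod (q n + 1) < q n then a n ((i + 1) mod (q n + 1)) else w ! ((i + 1) div (q n + 1)))"
proof (induction w arbitrary: i)
  case (Cons c w)
  let ?q = "q n + 1"
  have eq: "tau_word q a (Suc n) (c # w) = tau q a (Suc n) c @ tau_word q a (Suc n) w"
    by (simp add: tau_word_def del: tau.simps)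
  show ?case
  proof (cases "i < ?q")
    case True
    have "(i + 1) div ?q = 0" if "\<not> (i + 1) mod ?q < q n"
      using that True q_ge_2[of n] by (cases "i = q n") auto
    then show ?thesis using True tau_nth[of i n c]
      unfolding eq by (simp add: nth_append length_tau del: tau.simps)
  next
    case False
    define i' where "i' = i - ?q"
    have i: "i = i' + ?q" using False by (simp add: i'_def)
    then have "i' < length w * ?q" using Cons.prems by simp
    from Cons.IH[OF this] have "tau_word q a (Suc n) (c # w) ! i =
        (if (i' + 1) mod ?q < q n then a n ((i' + 1) mod ?q) else w ! ((i' + 1) div ?q))"
      unfolding eq i by (simp add: nth_append length_tau del: tau.simps)
    moreover have "i + 1 = (i' + 1) + ?q" using i by simp
    then have "(i + 1) mod ?q = (i' + 1) mod ?q" "(i + 1) div ?q = Suc ((i' + 1) div ?q)"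
      by (simp_all only: mod_add_self2 div_add_self2 add_eq_0_iff_both_eq_0 one_neq_zero simp_thms Suc_eq_plus1 not_False_eq_True)
    ultimately show ?thesis by simp
  qed
qed simp

lemma tau_comp_refl [simp]: "tau_comp q a n n w = w"
  by (simp add: tau_comp_def)

lemma tau_comp_step: "m < n \<Longrightarrow> tau_comp q a m n w = tau_word q a m (tau_comp q a (Suc m) n w)"
  by (simp add: tau_comp_def upt_conv_Cons)

lemma length_tau_comp: "m \<le> n \<Longrightarrow> length (tau_comp q a (Suc m) (Suc n) w) = length w * Q m n"
proof (induction "n - m" arbitrary: m)
  case (Suc d)
  then have "m < n" "d = n - Suc m" by auto
  then show ?case
    using Suc.hyps(1)[of "Suc m"] tau_comp_step[of "Suc m" "Suc n" w] Q_step[of m n]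
    by (simp add: length_tau_word algebra_simps)
qed simp

lemma set_tau_comp: "m \<le> n \<Longrightarrow> set (tau_comp q a (Suc m) (Suc n) w) \<subseteq> set w \<union> alphabet q a (Suc m)"
proof (induction "n - m" arbitrary: m)
  case (Suc d)
  then have mn: "m < n" "d = n - Suc m" by auto
  have "set (tau q a (Suc m) e) \<subseteq> insert e (alphabet q a (Suc m))" for e
    using q_ge_2[of m] by force
  then have s1: "set (tau_word q a (Suc m) v) \<subseteq> set v \<union> alphabet q a (Suc m)" for v
    unfolding tau_word_def set_concat set_map by blast
  have s2: "set (tau_comp q a (Suc (Suc m)) (Suc n) w) \<subseteq> set w \<union> alphabet q a (Suc (Suc m))"
    using Suc.hyps(1)[of "Suc m"] mn by simp
  have s3: "alphabet q a (Suc (Suc m)) \<subseteq> alphabet q a (Suc m)"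
    by (rule alphabet_Suc_antimono) simp
  have eq: "tau_comp q a (Suc m) (Suc n) w = tau_word q a (Suc m) (tau_comp q a (Suc (Suc m)) (Suc n) w)"
    using mn by (simp add: tau_comp_step)
  show ?case unfolding eq
    using s1[of "tau_comp q a (Suc (Suc m)) (Suc n) w"] s2 s3 by blast
qed simp

text \<open>Up to a phase, substituted words carry the pattern of \<open>sp m\<close> away from the
  holes. In the induction on \<open>k - m\<close> one more substitution contributes its own rotation
  by 1 and multiplies the phase of the deeper level by \<open>q m + 1\<close>.\<close>

lemma tau_comp_fit:
  "m \<le> k \<Longrightarrow> k \<le> n \<Longrightarrow> \<exists>d. \<forall>i<length (tau_comp q a (Suc m) (Suc n) w).
    (i + d) mod Q m k + 1 < Q m k \<longrightarrow> tau_comp q a (Suc m) (Suc n) w ! i = sp m ((i + d) mod Q m k)"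
proof (induction "k - m" arbitrary: m)
  case (Suc l)
  then have mk: "m < k" "m < n" "l = k - Suc m" by auto
  let ?v = "tau_comp q a (Suc (Suc m)) (Suc n) w"
  obtain d where d: "\<And>i. i < length ?v \<Longrightarrow> (i + d) mod Q (Suc m) k + 1 < Q (Suc m) k
      \<Longrightarrow> ?v ! i = sp (Suc m) ((i + d) mod Q (Suc m) k)"
    using Suc.hyps(1)[of "Suc m"] mk Suc.prems by auto
  have eq: "tau_comp q a (Suc m) (Suc n) w = tau_word q a (Suc m) ?v"
    using mk by (simp add: tau_comp_step)
  let ?q = "q m + 1" and ?Q' = "Q (Suc m) k"
  have Qk: "Q m k = ?q * ?Q'" using Q_step[OF mk(1)] .
  have "tau_word q a (Suc m) ?v ! i = sp m ((i + (1 + d * ?q)) mod Q m k)"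
    if i: "i < length ?v * ?q" and r: "(i + (1 + d * ?q)) mod Q m k + 1 < Q m k" for i
  proof -
    define j t where "j = (i + 1) div ?q" and "t = (i + 1) mod ?q"
    have ij: "i + 1 = j * ?q + t" "t < ?q" unfolding j_def t_def by (simp_all only: div_mult_mod_eq) simp
    have idx: "i + (1 + d * ?q) = ?q * (j + d) + t" using ij(1) by (simp only: algebra_simps)
    define r' where "r' = (j + d) mod ?Q'"
    have mod_eq: "(i + (1 + d * ?q)) mod Q m k = r' * ?q + t"
    proof -
      have "(?q * (j + d) + t) div ?q = j + d" using ij(2) by (simp only: div_mult_self4) simp
      moreover have "(?q * (j + d) + t) mod ?q = t" using ij(2) by (simp only: mod_mult_self4) simp
      ultimately show ?thesis
        unfolding idx Qk mod_mult2_eq r'_def by (simp only: mult.commute)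
    qed
    show ?thesis
    proof (cases "t < q m")
      case True
      then show ?thesis
        unfolding mod_eq tau_word_nth[OF i] sp_low[OF True] by (simp only: t_def if_True)
    next
      case False
      then have t: "t = q m" using ij(2) by simp
      have "j < length ?v"
      proof -
        have "j * ?q < length ?v * ?q + 1 - q m" using i ij(1) t by linarith
        also have "\<dots> \<le> length ?v * ?q" using q_ge_2[of m] by linarith
        finally show ?thesis by (simp only: mult_less_cancel2)
      qed
      moreover have "r' + 1 < ?Q'"
      proof -
        have "r' * ?q + q m + 1 < ?q * ?Q'" using r unfolding mod_eq unfolding Qk t .
        then have "(r' + 1) * ?q < ?Q' * ?q" by (simp add: algebra_simps)
        then show ?thesis by (simp only: mult_less_cancel2)
      qed
      ultimately have "?v ! j = sp (Suc m) r'" using d unfolding r'_def by blast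
      then show ?thesis
        unfolding mod_eq tau_word_nth[OF i] t sp_high using False by (simp only: j_def t_def if_False)
    qed
  qed
  then show ?case unfolding eq length_tau_word by blast
qed simp

lemma Q_mono: "m \<le> k \<Longrightarrow> k \<le> n \<Longrightarrow> Q m k \<le> Q m n"
  using Q_mult[of m k n] Q_pos[of k n] by (metis Nat.le_add1 One_nat_def Suc_leI le_add1 mult.right_neutral mult_le_mono2)

text \<open>The index is shifted because the letters of \<open>alphabet q a (Suc m)\<close> are the
  spacers of levels \<open>m\<close> and above, so that \<open>Y m\<close> belongs with the towers
  of level \<open>m\<close>.\<close>

definition Y :: "nat \<Rightarrow> (int \<Rightarrow> nat) set" where "Y m = derived_subshift q a (Suc m)"

text \<open>The pigeonhole argument of \<open>fit_exists\<close>, with the offsets supplied by the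
  substituted words.\<close>

lemma Y_fit:
  assumes y: "y \<in> Y m" and mn: "m \<le> n"
  shows "\<exists>p. \<forall>i. nat ((i - p) mod int (Q m n)) + 1 < Q m n \<longrightarrow> y i = sp m (nat ((i - p) mod int (Q m n)))"
proof -
  let ?Q = "int (Q m n)"
  have "\<exists>t. \<forall>i. - int K \<le> i \<longrightarrow> i \<le> int K \<longrightarrow> nat ((i + t) mod ?Q) + 1 < Q m n \<longrightarrow>
      y i = sp m (nat ((i + t) mod ?Q))" for K
  proof -
    \<comment> \<open>A window longer than \<open>Q m n\<close> cannot occur in a word of level
      below \<open>n\<close>, so the word containing it carries the full level-\<open>n\<close>
      pattern.\<close>
    define K' where "K' = max K (Q m n)"
    let ?w = "window y (- int K') (2 * K' + 1)"
    have "\<exists>u\<in>{tau_comp q a (Suc m) N [c] |N c. N > Suc m \<and> c \<in> alphabet q a (Suc m)}. sublist ?w u"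
      using y unfolding Y_def derived_subshift_def subshift_of_words_def by blast
    then obtain N c where N: "Suc m < N" "sublist ?w (tau_comp q a (Suc m) N [c])" by blast
    then obtain N' where N': "N = Suc N'" "m \<le> N'" by (cases N) auto
    obtain ps ss where eq: "tau_comp q a (Suc m) (Suc N') [c] = ps @ ?w @ ss"
      using N(2) unfolding N' sublist_def by blast
    have len: "length ?w = 2 * K' + 1" by (simp add: window_def)
    have lenN: "length (ps @ ?w @ ss) = Q m N'" unfolding eq[symmetric] by (simp add: length_tau_comp N')
    have "n \<le> N'"
    proof (rule ccontr)
      assume "\<not> n \<le> N'"
      then have "Q m N' \<le> Q m n" using N' by (intro Q_mono) auto
      then show False using lenN len by (simp add: K'_def)
    qed
    from tau_comp_fit[OF mn this, of "[c]"] obtain d where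
      d: "\<And>i. i < Q m N' \<Longrightarrow> (i + d) mod Q m n + 1 < Q m n \<Longrightarrow> (ps @ ?w @ ss) ! i = sp m ((i + d) mod Q m n)"
      unfolding eq lenN by blast
    have "y i = sp m (nat ((i + (int K' + int (length ps) + int d)) mod ?Q))"
      if i: "- int K \<le> i" "i \<le> int K"
        and r: "nat ((i + (int K' + int (length ps) + int d)) mod ?Q) + 1 < Q m n" for i
    proof -
      define l where "l = nat (i + int K')"
      have l: "int l = i + int K'" "l < 2 * K' + 1" using i by (auto simp: l_def K'_def)
      have "i + (int K' + int (length ps) + int d) = int (length ps + l + d)" using l(1) by simp
      then have md: "nat ((i + (int K' + int (length ps) + int d)) mod ?Q) = (length ps + l + d) mod Q m n"
        by (simp only: zmod_int[symmetric] nat_int)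
      have "y i = ?w ! l" using l by (simp add: window_def del: upt_Suc)
      also have "\<dots> = (ps @ ?w @ ss) ! (length ps + l)" using l len by (simp add: nth_append)
      also have "\<dots> = sp m ((length ps + l + d) mod Q m n)"
      proof (rule d)
        show "length ps + l < Q m N'" using lenN len l by simp
        show "(length ps + l + d) mod Q m n + 1 < Q m n" using r unfolding md .
      qed
      finally show ?thesis unfolding md .
    qed
    then show ?thesis by blast
  qed
  then obtain t where t: "\<And>K i. - int K \<le> i \<Longrightarrow> i \<le> int K \<Longrightarrow> nat ((i + t K) mod ?Q) + 1 < Q m n \<Longrightarrow>
      y i = sp m (nat ((i + t K) mod ?Q))"
    by metis
  have "(\<lambda>K. t K mod ?Q) ` UNIV \<subseteq> {0..<?Q}" by (auto simp: of_nat_0_less_iff[THEN iffD2])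
  then have "finite ((\<lambda>K. t K mod ?Q) ` (UNIV :: nat set))" by (rule finite_subset) simp
  from pigeonhole_infinite[OF infinite_UNIV_nat this]
  obtain K0 where "infinite {K \<in> UNIV. t K mod ?Q = t K0 mod ?Q}" by blast
  then have inf: "\<exists>K>m. t K mod ?Q = t K0 mod ?Q" for m
    by (auto simp: infinite_nat_iff_unbounded)
  have "y i = sp m (nat ((i - - t K0) mod ?Q))" if r: "nat ((i - - t K0) mod ?Q) + 1 < Q m n" for i
  proof -
    obtain K where K: "nat \<bar>i\<bar> < K" "t K mod ?Q = t K0 mod ?Q" using inf by blast
    have "(i - - t K0) mod ?Q = (i + t K) mod ?Q"
      using K(2) by (metis diff_minus_eq_add mod_add_right_eq)
    then show ?thesis using t[of K i] K(1) r by simp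
  qed
  then show ?thesis by blast
qed

text \<open>Over \<open>Q m n\<close> consecutive shifts a window meets every residue exactly once.
  At most \<open>2 * R + 1\<close> of these windows contain the hole and all others read a fixed
  stretch of \<open>sp m\<close>, so at every point the number of hits differs from the count by at
  most \<open>2 * R + 1\<close>.\<close>

lemma Y_frequency:
  assumes nu: "\<nu> \<in> invariant_measures (Y m) shift_map" and mn: "m \<le> n"
    and P: "\<And>x y. agree R x y \<Longrightarrow> P x = P y"
  shows "\<bar>measure \<nu> {y \<in> Y m. P y}
      - real (card {r. r + 2 * R + 1 < Q m n \<and> P (\<lambda>i. sp m (nat (int r + int R + i)))}) / real (Q m n)\<bar>
    \<le> real (2 * R + 1) / real (Q m n)"
proof -
  interpret prob_space \<nu> by (rule prob_space_invariant_measure[OF nu])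
  let ?N = "Q m n" let ?Q = "int (Q m n)"
  have sp_nu: "space \<nu> = Y m" by (rule space_invariant_measure[OF nu])
  \<comment> \<open>The window starting at residue \<open>r\<close> is centred at
    \<open>r + R\<close>. As \<open>P\<close> sees only indices between \<open>- R\<close> and
    \<open>R\<close>, the truncation by \<open>nat\<close> of negative arguments stays
    invisible.\<close>
  define g where "g r = P (\<lambda>i. sp m (nat (int r + int R + i)))" for r
  define F :: "nat \<Rightarrow> real" where "F r = of_bool (r + 2 * R + 1 < ?N \<and> g r)" for r
  define cnt where "cnt = card {r. r + 2 * R + 1 < ?N \<and> g r}"
  define f :: "(int \<Rightarrow> nat) \<Rightarrow> real" where "f y = of_bool (P y)" for y
  have compact_Y: "compact (Y m)"
    unfolding Y_def derived_subshift_def by (rule compact_subshift) (rule finite_alphabet)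
  have loc: "local_on (Y m) f"
    unfolding f_def by (rule local_onI[of _ R]) (use P in auto)
  have shift_Y: "shiftz k y \<in> Y m" if "y \<in> Y m" for k y
    using that by (simp add: Y_def derived_subshift_def shiftz_in_subshift)
  have Fsum: "(\<Sum>r<?N. F r) = real cnt"
  proof -
    have "{..<?N} \<inter> {r. r + 2 * R + 1 < ?N \<and> g r} = {r. r + 2 * R + 1 < ?N \<and> g r}" by auto
    then show ?thesis by (simp add: F_def cnt_def of_bool_def sum.If_cases)
  qed
  have pointwise: "\<bar>(\<Sum>k<?N. f (shiftz (int (R + k)) y)) - real cnt\<bar> \<le> real (2 * R + 1)" if y: "y \<in> Y m" for y
  proof -
    obtain p where p: "\<And>i. nat ((i - p) mod ?Q) + 1 < ?N \<Longrightarrow> y i = sp m (nat ((i - p) mod ?Q))"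
      using Y_fit[OF y mn] by blast
    define \<rho> where "\<rho> k = nat ((int k - p) mod ?Q)" for k
    have rho: "int (\<rho> k) = (int k - p) mod ?Q" "\<rho> k < ?N" for k
      by (simp_all add: \<rho>_def nat_less_iff)
    have "inj_on \<rho> {..<?N}"
    proof (rule inj_onI)
      fix k l assume kl: "k \<in> {..<?N}" "l \<in> {..<?N}" "\<rho> k = \<rho> l"
      then have "(int k - p) mod ?Q = (int l - p) mod ?Q" using rho(1) by metis
      then have "(int k - p + p) mod ?Q = (int l - p + p) mod ?Q" by (metis mod_add_left_eq)
      then have "k mod ?N = l mod ?N" by (simp add: zmod_int[symmetric])
      then show "k = l" using kl by simp
    qed
    moreover have "\<rho> ` {..<?N} \<subseteq> {..<?N}" using rho(2) by auto
    ultimately have bij: "bij_betw \<rho> {..<?N} {..<?N}"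
      by (simp add: bij_betw_def endo_inj_surj)
    have good: "P (shiftz (int (R + k)) y) = g (\<rho> k)" if k: "\<rho> k + 2 * R + 1 < ?N" for k
      unfolding g_def
    proof (rule P, unfold agree_def, intro allI impI)
      fix i assume i: "\<bar>i\<bar> \<le> int R"
      define e where "e = int (\<rho> k) + int R + i"
      have e: "0 \<le> e" "e + 1 < ?Q" using i k by (auto simp: e_def)
      have "(i + int (R + k) - p) mod ?Q = ((int k - p) mod ?Q + (int R + i)) mod ?Q"
      proof -
        have "i + int (R + k) - p = (int k - p) + (int R + i)" by simp
        then show ?thesis by (simp only: mod_add_left_eq)
      qed
      also have "\<dots> = e mod ?Q" unfolding rho(1)[symmetric] by (simp only: e_def add.assoc)
      also have "\<dots> = e" using e by (intro mod_pos_pos_trivial) auto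
      finally have "nat ((i + int (R + k) - p) mod ?Q) = nat e" by simp
      then show "shiftz (int (R + k)) y i = sp m (nat (int (\<rho> k) + int R + i))"
        using p[of "i + int (R + k)"] e by (simp add: e_def nat_less_iff)
    qed
    have "\<bar>(\<Sum>k<?N. f (shiftz (int (R + k)) y)) - (\<Sum>k<?N. F (\<rho> k))\<bar>
        \<le> (\<Sum>k<?N. \<bar>f (shiftz (int (R + k)) y) - F (\<rho> k)\<bar>)"
      unfolding sum_subtractf[symmetric] by (rule sum_abs)
    also have "\<dots> \<le> (\<Sum>k<?N. of_bool (\<not> \<rho> k + 2 * R + 1 < ?N))"
      using good by (intro sum_mono) (auto simp: f_def F_def of_bool_def)
    also have "\<dots> = (\<Sum>r<?N. of_bool (\<not> r + 2 * R + 1 < ?N))"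
      by (rule sum.reindex_bij_betw[OF bij, of "\<lambda>r. of_bool (\<not> r + 2 * R + 1 < ?N)"])
    also have "\<dots> \<le> real (2 * R + 1)"
    proof -
      have "(\<Sum>r<?N. of_bool (\<not> r + 2 * R + 1 < ?N) :: real) = real (card ({..<?N} \<inter> {r. \<not> r + 2 * R + 1 < ?N}))"
        by (simp add: of_bool_def sum.If_cases)
      also have "card ({..<?N} \<inter> {r. \<not> r + 2 * R + 1 < ?N}) \<le> card {?N - (2 * R + 1)..<?N}"
        by (rule card_mono) auto
      finally show ?thesis by simp
    qed
    finally show ?thesis
      unfolding sum.reindex_bij_betw[OF bij, of F] Fsum .
  qed
  have loc': "local_on (Y m) (\<lambda>y. f (shiftz (int (R + k)) y))" for k
    by (rule local_on_shiftz[OF loc shift_Y])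
  have int: "integrable \<nu> (\<lambda>y. f (shiftz (int (R + k)) y))" for k
    by (rule local_integrable[OF nu compact_Y loc'])
  have "measure \<nu> {y \<in> Y m. P y} = (LINT y|\<nu>. f y)"
  proof -
    have "{y \<in> Y m. P y} \<in> sets \<nu>"
      using measurable_sets[OF local_measurable_invariant[OF nu local_onI[of "Y m" R P]], of "{True}"] P
      by (auto simp: sp_nu vimage_def Int_def conj_commute)
    moreover have "(LINT y|\<nu>. f y) = (LINT y|\<nu>. indicator {y \<in> Y m. P y} y)"
      by (rule Bochner_Integration.integral_cong) (auto simp: sp_nu f_def indicator_def)
    moreover have "{y \<in> Y m. P y} \<inter> space \<nu> = {y \<in> Y m. P y}" by (auto simp: sp_nu)
    ultimately show ?thesis by simp
  qed
  then have "real ?N * measure \<nu> {y \<in> Y m. P y} = (\<Sum>k<?N. LINT y|\<nu>. f (shiftz (int (R + k)) y))"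
    using integral_shiftz[OF nu loc, of "R + k" for k] by (simp del: of_nat_add)
  also have "\<dots> = (LINT y|\<nu>. (\<Sum>k<?N. f (shiftz (int (R + k)) y)))"
    by (rule Bochner_Integration.integral_sum[symmetric]) (rule int)
  finally have "real ?N * measure \<nu> {y \<in> Y m. P y} - real cnt
      = (LINT y|\<nu>. (\<Sum>k<?N. f (shiftz (int (R + k)) y)) - real cnt)"
    using int prob_space by simp
  also have "\<bar>\<dots>\<bar> \<le> real (2 * R + 1)"
  proof -
    have int': "integrable \<nu> (\<lambda>y. (\<Sum>k<?N. f (shiftz (int (R + k)) y)) - real cnt)"
      using int by simp
    have "(LINT y|\<nu>. (\<Sum>k<?N. f (shiftz (int (R + k)) y)) - real cnt) \<le> real (2 * R + 1)"
      by (rule integral_le_const[OF int'])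
         (auto intro!: AE_I2 dest!: pointwise simp: sp_nu abs_le_iff)
    moreover have "- real (2 * R + 1) \<le> (LINT y|\<nu>. (\<Sum>k<?N. f (shiftz (int (R + k)) y)) - real cnt)"
      by (rule integral_ge_const[OF int'])
         (auto intro!: AE_I2 dest!: pointwise simp: sp_nu abs_le_iff)
    ultimately show ?thesis by linarith
  qed
  finally have bound: "\<bar>real ?N * measure \<nu> {y \<in> Y m. P y} - real cnt\<bar> \<le> real (2 * R + 1)" .
  have N: "0 < real ?N" by simp
  have "measure \<nu> {y \<in> Y m. P y} - real cnt / real ?N = (real ?N * measure \<nu> {y \<in> Y m. P y} - real cnt) / real ?N"
    using N by (simp only: diff_divide_distrib nonzero_mult_div_cancel_left[OF less_imp_neq[OF N, symmetric]])
  then have "\<bar>measure \<nu> {y \<in> Y m. P y} - real cnt / real ?N\<bar> = \<bar>real ?N * measure \<nu> {y \<in> Y m. P y} - real cnt\<bar> / real ?N"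
    using N by (simp only: abs_divide abs_of_pos)
  then show ?thesis
    using bound N unfolding cnt_def g_def by (simp only: divide_right_mono less_imp_le)
qed

end

section \<open>Unique ergodicity of the derived subshift\<close>

context aperiodic_ferenczi
begin

lemma Y_measure_exists: "invariant_measures (Y m) shift_map \<noteq> {}"
  unfolding Y_def derived_subshift_def
proof (rule invariant_measure_exists)
  show "finite (alphabet q a (Suc m))" by (rule finite_alphabet)
  fix u assume "u \<in> {tau_comp q a (Suc m) N [c] |N c. N > Suc m \<and> c \<in> alphabet q a (Suc m)}"
  then obtain N c where u: "u = tau_comp q a (Suc m) N [c]" "Suc m < N" "c \<in> alphabet q a (Suc m)" by blast
  then obtain N' where N': "N = Suc N'" "m \<le> N'" by (cases N) auto
  show "set u \<subseteq> alphabet q a (Suc m)"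
    using set_tau_comp[OF N'(2), of "[c]"] u(3) unfolding u(1) N'(1) by auto
next
  fix n
  have "n \<le> length (tau_comp q a (Suc m) (Suc (m + Suc n)) [sp m 0])"
    using Q_ge[of "Suc n" m] by (simp add: length_tau_comp del: add_Suc_right)
  moreover have "Suc m < Suc (m + Suc n)" by simp
  ultimately show "\<exists>u\<in>{tau_comp q a (Suc m) N [c] |N c. N > Suc m \<and> c \<in> alphabet q a (Suc m)}. n \<le> length u"
    using sp_alphabet[of m 0] by blast
qed

lemma Y_measure_unique:
  assumes mu: "\<mu> \<in> invariant_measures (Y m) shift_map" and nu: "\<nu> \<in> invariant_measures (Y m) shift_map"
  shows "\<mu> = \<nu>"
proof (rule invariant_measures_eqI[OF mu nu])
  fix P :: "(int \<Rightarrow> nat) \<Rightarrow> bool" assume "local_on UNIV P"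
  then obtain R where R: "\<And>x y. agree R x y \<Longrightarrow> P x = P y" unfolding local_on_def by blast
  show "measure \<mu> {x \<in> Y m. P x} = measure \<nu> {x \<in> Y m. P x}"
    by (rule eq_if_both_approximated[of m]) (rule Y_frequency[OF mu _ R] Y_frequency[OF nu _ R]; assumption)+
qed

lemma mu_hat_invariant: "mu_hat q a (Suc m) \<in> invariant_measures (Y m) shift_map"
proof -
  have "\<exists>!\<mu>. \<mu> \<in> invariant_measures (Y m) shift_map"
    using Y_measure_exists Y_measure_unique by blast
  from theI'[OF this] show ?thesis by (simp add: mu_hat_def Y_def)
qed

text \<open>A letter of \<open>Y m\<close> is a spacer after a copy of \<open>w\<^sub>m\<close>, so
  the frequency of \<open>c\<close> and the share of class \<open>c\<close> in the base are limits
  of the same fractions. The frequency bound is used with radius 0.\<close>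

lemma mu_hat_letter:
  assumes mu: "\<mu> \<in> invariant_measures X shift_map"
  shows "measure (mu_hat q a (Suc m)) {y \<in> Y m. y 0 = c} = class_measure \<mu> m c / base_measure \<mu> m"
proof (rule eq_if_both_approximated[of m])
  fix n assume mn: "m \<le> n"
  show "\<bar>class_measure \<mu> m c / base_measure \<mu> m - real (occ m n c) / real (Q m n)\<bar> \<le> 1 / real (Q m n)"
    by (rule ratio_bound[OF mu mn])
  show "\<bar>measure (mu_hat q a (Suc m)) {y \<in> Y m. y 0 = c} - real (occ m n c) / real (Q m n)\<bar> \<le> 1 / real (Q m n)"
    using Y_frequency[OF mu_hat_invariant mn, of 0 "\<lambda>y. y 0 = c"] by (simp add: agree_def occ_def)
qed

end

section \<open>The dimension group\<close>

context aperiodic_ferenczi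
begin

lemma local_on_in_base_next_spacerass: "local_on X (\<lambda>x. of_bool (in_base n x) * (g (next_spacer n x) :: int))"
  by (rule local_on_in_base_next_spacer[where h = "\<lambda>b c. of_bool b * g c"])

context
  fixes \<mu> :: "(int \<Rightarrow> nat) measure" and m :: nat
  assumes mu: "\<mu> \<in> invariant_measures X shift_map"
    and stable: "\<And>n. m \<le> n \<Longrightarrow> alphabet q a (Suc n) = alphabet q a (Suc m)"
begin

abbreviation "A \<equiv> alphabet q a (Suc m)"
abbreviation "am \<equiv> min_letter q a (Suc m)"

lemma am_in_A: "am \<in> A"
  unfolding min_letter_def using sp_alphabet[of m 0] by (intro Min_in finite_alphabet) blast

lemma dot_split: "dot A x v = x am * v am + (\<Sum>c\<in>A - {am}. x c * v c)"
  unfolding dot_def using am_in_A finite_alphabet by (rule sum.remove[rotated])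

lemma z_vec_eq: "z_vec q a (Suc m) c = (if c = am then 1 else class_measure \<mu> m c / base_measure \<mu> m)"
  using mu_hat_letter[OF mu, of m c] by (simp add: z_vec_def Y_def)

text \<open>The shares of the classes sum to 1, so the \<open>am\<close> subtracted in
  \<open>u_vec\<close> at the other letters is restored by the last coordinate, and the product
  becomes the mean tower height over the base. By \<open>kac_one\<close> this is the inverse of the
  base measure.\<close>

lemma u_dot_z: "dot A (u_vec q a (Suc m)) (z_vec q a (Suc m)) = 1 / base_measure \<mu> m"
proof -
  have pos: "0 < base_measure \<mu> m" by (rule base_measure_pos[OF mu])
  let ?l = "real am" and ?h = "real (word_length m)"
  have "dot A (u_vec q a (Suc m)) (z_vec q a (Suc m))
      = ?l + ?h + (\<Sum>c\<in>A - {am}. (real c - ?l) * (class_measure \<mu> m c / base_measure \<mu> m))"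
    unfolding dot_split by (simp add: u_vec_def z_vec_eq length_gen_word word_length_def)
  also have "(\<Sum>c\<in>A - {am}. (real c - ?l) * (class_measure \<mu> m c / base_measure \<mu> m)) = (\<Sum>c\<in>A. (real c - ?l) * (class_measure \<mu> m c / base_measure \<mu> m))"
    using am_in_A finite_alphabet by (subst (2) sum.remove[of _ am]) simp_all
  finally have "dot A (u_vec q a (Suc m)) (z_vec q a (Suc m)) * base_measure \<mu> m
      = (?l + ?h) * base_measure \<mu> m + (\<Sum>c\<in>A. (real c - ?l) * class_measure \<mu> m c)"
    using pos by (simp add: distrib_right sum_distrib_right del: alphabet.simps)
  also have "(?l + ?h) * base_measure \<mu> m = (\<Sum>c\<in>A. (?l + ?h) * class_measure \<mu> m c)"
    unfolding base_measure_eq_sum[OF mu, of m] by (rule sum_distrib_left)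
  also have "(\<Sum>c\<in>A. (?l + ?h) * class_measure \<mu> m c) + (\<Sum>c\<in>A. (real c - ?l) * class_measure \<mu> m c)
      = (\<Sum>c\<in>A. (?h + real c) * class_measure \<mu> m c)"
    unfolding sum.distrib[symmetric] by (intro sum.cong) (simp_all add: algebra_simps)
  also have "\<dots> = 1" by (rule kac_one[OF mu])
  finally show ?thesis using pos by (simp add: field_simps)
qed

lemma z_tilde_eq: "z_tilde q a (Suc m) = (\<lambda>c. base_measure \<mu> m * z_vec q a (Suc m) c)"
proof -
  have dot_scale: "dot A (u_vec q a (Suc m)) (\<lambda>c. r * z_vec q a (Suc m) c) = r / base_measure \<mu> m" for r
  proof -
    have "dot A (u_vec q a (Suc m)) (\<lambda>c. r * z_vec q a (Suc m) c) = r * dot A (u_vec q a (Suc m)) (z_vec q a (Suc m))"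
      unfolding dot_def sum_distrib_left by (intro sum.cong) simp_all
    then show ?thesis by (simp add: u_dot_z del: alphabet.simps)
  qed
  show ?thesis
    unfolding z_tilde_def
  proof (rule the_equality)
    show "(\<exists>r. (\<lambda>c. base_measure \<mu> m * z_vec q a (Suc m) c) = (\<lambda>c. r * z_vec q a (Suc m) c)) \<and>
      dot A (u_vec q a (Suc m)) (\<lambda>c. base_measure \<mu> m * z_vec q a (Suc m) c) = 1"
      unfolding dot_scale using base_measure_pos[OF mu, of m] by auto
    fix v assume v: "(\<exists>r. v = (\<lambda>c. r * z_vec q a (Suc m) c)) \<and> dot A (u_vec q a (Suc m)) v = 1"
    then obtain r where r: "v = (\<lambda>c. r * z_vec q a (Suc m) c)" by blast
    then have "r / base_measure \<mu> m = 1" using v dot_scale[of r] by simp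
    then have "r = base_measure \<mu> m" using base_measure_pos[OF mu, of m] by simp
    then show "v = (\<lambda>c. base_measure \<mu> m * z_vec q a (Suc m) c)" using r by simp
  qed
qed

lemma dot_z_tilde: "dot A x (z_tilde q a (Suc m)) = base_measure \<mu> m * x am + (\<Sum>c\<in>A - {am}. x c * class_measure \<mu> m c)"
  unfolding dot_split z_tilde_eq using base_measure_pos[OF mu, of m]
  by (simp add: z_vec_eq del: alphabet.simps)

text \<open>The product in \<open>fraction_group\<close> includes its upper index, so the
  denominators are the \<open>Q m n\<close> with \<open>n\<close> strictly above
  \<open>m\<close>.\<close>

lemma fraction_group_Q:
  "r \<in> fraction_group (\<lambda>n. q n + 1) m \<longleftrightarrow> (\<exists>k n. m < n \<and> r = real_of_int k / real (Q m n))"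
proof -
  have Q: "(\<Prod>j = m..n. real (q j + 1)) = real (Q m (Suc n))" for n
    by (simp add: Q_def atLeastLessThanSuc_atLeastAtMost)
  show ?thesis
    unfolding fraction_group_def mem_Collect_eq Q
    by (metis Suc_le_D Suc_le_mono less_eq_Suc_le)
qed

text \<open>Class measures at level \<open>n\<close> are expressed through those at level
  \<open>m\<close> and \<open>base_measure \<mu> n\<close>, and the class of \<open>am\<close> is
  eliminated by the sum formula for the base.\<close>

lemma class_sum_in_J:
  assumes "m < n"
  shows "(\<Sum>c\<in>alphabet q a (Suc n). real_of_int (g c) * class_measure \<mu> n c) \<in> J_group q a (Suc m)"
proof -
  have mn: "m \<le> n" using assms by simp
  have Q: "0 < real (Q m n)" by simp
  \<comment> \<open>\<open>k\<close> collects the corrections in units of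
    \<open>base_measure \<mu> n\<close>, the \<open>Q m n\<close>-th part of
    \<open>base_measure \<mu> m\<close>; hence the denominator of \<open>x\<close> at
    \<open>am\<close>.\<close>
  define k where "k = (\<Sum>c\<in>A. g c * int (occ m n c))"
  define x where "x = (\<lambda>c\<in>A. if c = am then real_of_int (g am * int (Q m n) - k) / real (Q m n)
    else real_of_int (g c - g am))"
  have "(\<Sum>c\<in>alphabet q a (Suc n). real_of_int (g c) * class_measure \<mu> n c)
      = (\<Sum>c\<in>A. real_of_int (g c) * (class_measure \<mu> m c - real (occ m n c) * base_measure \<mu> n))"
    unfolding stable[OF mn] by (intro sum.cong) (simp_all add: class_measure_level[OF mu mn])
  also have "\<dots> = (\<Sum>c\<in>A. real_of_int (g c) * class_measure \<mu> m c) - real_of_int k * base_measure \<mu> n"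
    by (simp add: right_diff_distrib sum_subtractf k_def sum_distrib_right mult.assoc del: alphabet.simps)
  also have "(\<Sum>c\<in>A. real_of_int (g c) * class_measure \<mu> m c)
      = (\<Sum>c\<in>A. real_of_int (g c - g am) * class_measure \<mu> m c) + real_of_int (g am) * base_measure \<mu> m"
    unfolding base_measure_eq_sum[OF mu, of m] sum_distrib_left sum.distrib[symmetric]
    by (intro sum.cong) (simp_all add: algebra_simps)
  also have "(\<Sum>c\<in>A. real_of_int (g c - g am) * class_measure \<mu> m c) = (\<Sum>c\<in>A - {am}. x c * class_measure \<mu> m c)"
    using am_in_A finite_alphabet
    by (subst sum.remove[of _ am]) (auto simp: x_def simp del: alphabet.simps intro!: sum.cong)
  also have "real_of_int k * base_measure \<mu> n = real_of_int k / real (Q m n) * base_measure \<mu> m"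
    by (simp add: base_measure_level[OF mu mn] Q_neq_0)
  finally have "(\<Sum>c\<in>alphabet q a (Suc n). real_of_int (g c) * class_measure \<mu> n c) = dot A x (z_tilde q a (Suc m))"
    unfolding dot_z_tilde using am_in_A Q by (simp add: x_def field_simps del: alphabet.simps)
  moreover have "x \<in> G_group q a (Suc m)"
    unfolding G_group_def
  proof (rule PiE_I)
    fix c assume c: "c \<in> A"
    show "x c \<in> (if c = am then fraction_group (\<lambda>n. q n + 1) (Suc m - 1) else \<int>)"
    proof -
      have "real_of_int (g am * int (Q m n) - k) / real (Q m n) \<in> fraction_group (\<lambda>n. q n + 1) m"
        unfolding fraction_group_Q using assms by blast
      then show ?thesis using c by (simp add: x_def del: alphabet.simps)
    qed
  qed (simp add: x_def del: alphabet.simps)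
  ultimately show ?thesis unfolding J_group_def by blast
qed

text \<open>The numerator of the last coordinate multiplies the indicator of the
  level-\<open>n\<close> base, and every other coordinate multiplies the indicator of its class at
  level \<open>m\<close>.\<close>

lemma J_group_integral:
  assumes "y \<in> J_group q a (Suc m)"
  shows "\<exists>f :: (int \<Rightarrow> nat) \<Rightarrow> int. local_on X f \<and> (LINT x|\<mu>. real_of_int (f x)) = y"
proof -
  obtain x where x: "x \<in> G_group q a (Suc m)" "y = dot A x (z_tilde q a (Suc m))"
    using assms unfolding J_group_def by blast
  then have xc: "x c \<in> (if c = am then fraction_group (\<lambda>n. q n + 1) m else \<int>)" if "c \<in> A" for c
    using that unfolding G_group_def by (auto dest!: PiE_mem)
  obtain k n where kn: "m < n" "x am = real_of_int k / real (Q m n)"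
    using xc[OF am_in_A] fraction_group_Q by auto
  have "\<exists>j :: int. x c = real_of_int j" if "c \<in> A" "c \<noteq> am" for c
    using xc[OF that(1)] that(2) by (auto elim: Ints_cases)
  then obtain g where g: "\<And>c. c \<in> A \<Longrightarrow> c \<noteq> am \<Longrightarrow> x c = real_of_int (g c :: int)" by metis
  define g' where "g' c = (if c = am then 0 else g c)" for c
  define f where "f x = k * of_bool (in_base n x) + of_bool (in_base m x) * g' (next_spacer m x)" for x
  have loc: "local_on X f"
    unfolding f_def
    by (rule local_on_comp2[of X "\<lambda>x. k * of_bool (in_base n x)" _ "(+)"])
       (rule local_on_comp[OF local_on_in_base, of "\<lambda>b. k * of_bool b"], rule local_on_in_base_next_spacerass)
  have "(LINT x|\<mu>. real_of_int (f x)) = (LINT x|\<mu>. real_of_int k * of_bool (in_base n x) + of_bool (in_base m x) * real_of_int (g' (next_spacer m x)))"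
    by (simp add: f_def)
  also have "\<dots> = (LINT x|\<mu>. real_of_int k * of_bool (in_base n x)) + (LINT x|\<mu>. of_bool (in_base m x) * real_of_int (g' (next_spacer m x)))"
    by (rule Bochner_Integration.integral_add[OF
          integrable_in_base_next_spacer[OF mu, where h = "\<lambda>b c. real_of_int k * of_bool b"]
          integrable_in_base_next_spacer[OF mu, where h = "\<lambda>b c. of_bool b * real_of_int (g' c)"]])
  also have "\<dots> = real_of_int k * base_measure \<mu> n + (\<Sum>c\<in>A. real_of_int (g' c) * class_measure \<mu> m c)"
    by (simp only: integral_class[OF mu, where g = "\<lambda>c. real_of_int (g' c)"]) (simp add: base_measure_def)
  also have "(\<Sum>c\<in>A. real_of_int (g' c) * class_measure \<mu> m c) = (\<Sum>c\<in>A - {am}. x c * class_measure \<mu> m c)"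
    using am_in_A finite_alphabet g
    by (subst sum.remove[of _ am]) (auto simp: g'_def simp del: alphabet.simps intro!: sum.cong)
  also have "real_of_int k * base_measure \<mu> n = base_measure \<mu> m * x am"
    using kn(1) by (simp add: kn(2) base_measure_level[OF mu, of m n] Q_neq_0)
  finally have "(LINT x|\<mu>. real_of_int (f x)) = y"
    unfolding x(2) dot_z_tilde .
  with loc show ?thesis by blast
qed

lemma integral_in_J:
  fixes f :: "(int \<Rightarrow> nat) \<Rightarrow> int"
  assumes "local_on X f"
  shows "(LINT x|\<mu>. real_of_int (f x)) \<in> J_group q a (Suc m)"
proof -
  obtain N where N: "\<And>n. N \<le> n \<Longrightarrow> \<exists>g :: nat \<Rightarrow> int. \<forall>\<mu>\<in>invariant_measures X shift_map.
    (LINT x|\<mu>. real_of_int (f x)) = (\<Sum>c\<in>alphabet q a (Suc n). real_of_int (g c) * class_measure \<mu> n c)"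
    using integral_in_classes[OF assms] by meson
  from N[of "max N (Suc m)"] show ?thesis
    using class_sum_in_J[of "max N (Suc m)"] mu by (auto simp del: alphabet.simps)
qed

text \<open>Deep enough in the tower hierarchy every class carries a nonnegative coefficient, since the
  coefficients are all close to the integral divided by the measure of the base.\<close>

lemma nonneg_representative:
  fixes f :: "(int \<Rightarrow> nat) \<Rightarrow> int"
  assumes f: "local_on X f" and pos: "0 \<le> (LINT x|\<mu>. real_of_int (f x))"
  shows "\<exists>g :: (int \<Rightarrow> nat) \<Rightarrow> int. local_on X g \<and> (\<forall>x. 0 \<le> g x) \<and>
    (LINT x|\<mu>. real_of_int (g x)) = (LINT x|\<mu>. real_of_int (f x))"
proof (cases "(LINT x|\<mu>. real_of_int (f x)) = 0")
  case True
  then show ?thesis by (intro exI[of _ "\<lambda>_. 0"]) simp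
next
  case False
  define y where "y = (LINT x|\<mu>. real_of_int (f x))"
  have y: "0 < y" using False pos by (simp add: y_def)
  obtain N where N: "\<And>n. N \<le> n \<Longrightarrow> \<exists>g :: nat \<Rightarrow> int. \<forall>\<mu>\<in>invariant_measures X shift_map.
    (LINT x|\<mu>. real_of_int (f x)) = (\<Sum>c\<in>alphabet q a (Suc n). real_of_int (g c) * class_measure \<mu> n c)"
    using integral_in_classes[OF f] by meson
  define n where "n = max N m"
  have mn: "m \<le> n" by (simp add: n_def)
  have "N \<le> n" by (simp add: n_def)
  from N[OF this] obtain g :: "nat \<Rightarrow> int" where "\<forall>\<mu>\<in>invariant_measures X shift_map.
    (LINT x|\<mu>. real_of_int (f x)) = (\<Sum>c\<in>alphabet q a (Suc n). real_of_int (g c) * class_measure \<mu> n c)"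
    by blast
  from bspec[OF this mu] have g: "y = (\<Sum>c\<in>A. real_of_int (g c) * class_measure \<mu> n c)"
    unfolding y_def stable[OF mn] .
  define C where "C = (\<Sum>c\<in>A. \<bar>g c\<bar>)"
  have C: "\<bar>g c\<bar> \<le> C" if "c \<in> A" for c
    unfolding C_def using that finite_alphabet by (intro member_le_sum) auto
  \<comment> \<open>\<open>Q n L\<close> is at least \<open>d\<close>, so level \<open>L\<close>
    makes \<open>2 * C * base_measure \<mu> L\<close> smaller than \<open>y\<close>. One multiple of
    \<open>C\<close> absorbs the term with the class measures; the other remains as a lower bound
    for \<open>k\<close>.\<close>
  obtain d where d: "2 * real_of_int C * base_measure \<mu> n < real d * y"
    using reals_Archimedean3[OF y] by blast
  define L where "L = n + d"
  have nL: "n \<le> L" "m \<le> L" using mn by (simp_all add: L_def)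
  have posL: "0 < base_measure \<mu> L" by (rule base_measure_pos[OF mu])
  have "real d * y \<le> real (Q n L) * y"
    using y Q_ge[of d n] unfolding L_def by (intro mult_right_mono) auto
  then have "2 * real_of_int C * (real (Q n L) * base_measure \<mu> L) < real (Q n L) * y"
    using d unfolding base_measure_level[OF mu nL(1)] by linarith
  then have "real (Q n L) * (2 * real_of_int C * base_measure \<mu> L) < real (Q n L) * y" by (simp only: ac_simps)
  then have yC: "2 * real_of_int C * base_measure \<mu> L < y" by simp
  \<comment> \<open>At level \<open>L\<close> all classes share the coefficient \<open>k\<close>,
    and class \<open>c\<close> adds \<open>g c\<close> to it.\<close>
  define k where "k = (\<Sum>c\<in>A. g c * int (occ n L c))"
  have y_eq: "y = real_of_int k * base_measure \<mu> L + (\<Sum>c\<in>A. real_of_int (g c) * class_measure \<mu> L c)"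
    unfolding g class_measure_level[OF mu nL(1)]
    by (simp add: distrib_left sum.distrib k_def sum_distrib_right mult.assoc del: alphabet.simps)
  have sumL: "base_measure \<mu> L = (\<Sum>c\<in>A. class_measure \<mu> L c)"
    using base_measure_eq_sum[OF mu, of L] unfolding stable[OF nL(2)] .
  have "(\<Sum>c\<in>A. real_of_int (g c) * class_measure \<mu> L c) \<le> (\<Sum>c\<in>A. real_of_int C * class_measure \<mu> L c)"
    using C class_measure_nonneg[OF mu] by (intro sum_mono mult_right_mono) (auto simp del: alphabet.simps dest!: C)
  also have "\<dots> = real_of_int C * base_measure \<mu> L" unfolding sumL by (rule sum_distrib_left[symmetric])
  finally have "real_of_int C * base_measure \<mu> L \<le> real_of_int k * base_measure \<mu> L" using y_eq yC by linarith
  then have "C \<le> k" using posL by simp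
  then have nonneg: "0 \<le> k + g c" if "c \<in> A" for c
    using C[OF that] by linarith
  define h where "h x = of_bool (in_base L x) * (k + g (next_spacer L x))" for x
  have "local_on X h" unfolding h_def by (rule local_on_in_base_next_spacerass[where g = "\<lambda>c. k + g c"])
  moreover have "0 \<le> h x" for x
    using nonneg next_spacer_in_alphabet[of L x] unfolding stable[OF nL(2)] h_def by (cases "in_base L x") auto
  moreover have "(LINT x|\<mu>. real_of_int (h x)) = y"
  proof -
    have "(LINT x|\<mu>. real_of_int (h x)) = (LINT x|\<mu>. of_bool (in_base L x) * real_of_int (k + g (next_spacer L x)))"
      by (simp add: h_def)
    also have "\<dots> = (\<Sum>c\<in>A. real_of_int (k + g c) * class_measure \<mu> L c)"
      using integral_class[OF mu, of L "\<lambda>c. real_of_int (k + g c)"] unfolding stable[OF nL(2)] .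
    also have "\<dots> = y"
      unfolding y_eq sumL by (simp add: distrib_right sum.distrib sum_distrib_left del: alphabet.simps)
    finally show ?thesis .
  qed
  ultimately show ?thesis unfolding y_def by blast
qed

end
end

section \<open>Ordered quotients and kernels of real-valued homomorphisms\<close>

lemma the_elem_image_rcoset:
  fixes h :: "'g \<Rightarrow> real"
  assumes "group G" and N: "subgroup N G"
    and add: "\<And>x y. x \<in> carrier G \<Longrightarrow> y \<in> carrier G \<Longrightarrow> h (x \<otimes>\<^bsub>G\<^esub> y) = h x + h y"
    and zero: "\<And>x. x \<in> N \<Longrightarrow> h x = 0" and x: "x \<in> carrier G"
  shows "the_elem (h ` (N #>\<^bsub>G\<^esub> x)) = h x"
proof -
  interpret group G by fact
  have "h y = h x" if "y \<in> N #>\<^bsub>G\<^esub> x" for y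
    using that add x zero subgroup.mem_carrier[OF N] by (fastforce simp: r_coset_def)
  moreover have "x \<in> N #>\<^bsub>G\<^esub> x" by (rule rcos_self[OF x N])
  ultimately have "h ` (N #>\<^bsub>G\<^esub> x) = {h x}" by blast
  then show ?thesis by simp
qed

text \<open>The homomorphism theorem for an iterated quotient: \<open>h\<close> descends to
  \<open>h1\<close> on \<open>G Mod N\<close>, whose kernel is the second subgroup, and
  \<open>h1\<close> descends to an isomorphism \<open>\<phi>\<close>. Since \<open>\<phi>\<close>
  sends the double coset of \<open>x\<close> to \<open>h x\<close>, the order condition reduces to
  the image of \<open>P\<close> under \<open>h\<close>.\<close>

lemma unital_order_isomorphic_quotient_quotient:
  fixes G :: "'g monoid" and h :: "'g \<Rightarrow> real"
  assumes G: "comm_group G" and N: "subgroup N G"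
    and add: "\<And>x y. x \<in> carrier G \<Longrightarrow> y \<in> carrier G \<Longrightarrow> h (x \<otimes>\<^bsub>G\<^esub> y) = h x + h y"
    and zero: "\<And>x. x \<in> N \<Longrightarrow> h x = 0" and img: "h ` carrier G = J"
    and P: "P \<subseteq> carrier G" "h ` P = {y \<in> J. y \<ge> 0}" and u: "u \<in> carrier G" "h u = 1"
  shows "unital_order_isomorphic
    (unital_quotient (unital_quotient (G, P, u) N) ((\<lambda>f. N #>\<^bsub>G\<^esub> f) ` {x \<in> carrier G. h x = 0}))
    (real_unital_group J)"
proof -
  interpret G: comm_group G by fact
  interpret N: normal N G using G.subgroup_imp_normal[OF N] .
  let ?R = "\<lparr>carrier = J, mult = (+), one = 0\<rparr> :: real monoid"
  let ?G1 = "G Mod N"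
  let ?K = "(\<lambda>f. N #>\<^bsub>G\<^esub> f) ` {x \<in> carrier G. h x = 0}"
  have h_one: "h \<one>\<^bsub>G\<^esub> = 0" using add[of "\<one>\<^bsub>G\<^esub>" "\<one>\<^bsub>G\<^esub>"] by simp
  have R: "group ?R"
  proof (rule groupI)
    fix y assume "y \<in> carrier ?R"
    then obtain x where x: "x \<in> carrier G" "y = h x" using img by auto
    then have "h (inv\<^bsub>G\<^esub> x) + y = 0" using add[of "inv\<^bsub>G\<^esub> x" x] h_one by simp
    then show "\<exists>z\<in>carrier ?R. z \<otimes>\<^bsub>?R\<^esub> y = \<one>\<^bsub>?R\<^esub>" using x img by force
  next
    fix y z assume "y \<in> carrier ?R" "z \<in> carrier ?R"
    then obtain x x' where x: "x \<in> carrier G" "y = h x" "x' \<in> carrier G" "z = h x'" using img by auto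
    then have "y \<otimes>\<^bsub>?R\<^esub> z = h (x \<otimes>\<^bsub>G\<^esub> x')" by (simp add: add)
    moreover have "h (x \<otimes>\<^bsub>G\<^esub> x') \<in> J" using x img by blast
    ultimately show "y \<otimes>\<^bsub>?R\<^esub> z \<in> carrier ?R" by simp
  next
    have "h \<one>\<^bsub>G\<^esub> \<in> J" using img by blast
    then show "\<one>\<^bsub>?R\<^esub> \<in> carrier ?R" using h_one by simp
  qed auto
  define h1 where "h1 X = the_elem (h ` X)" for X
  have h1: "h1 (N #>\<^bsub>G\<^esub> x) = h x" if "x \<in> carrier G" for x
    unfolding h1_def by (rule the_elem_image_rcoset[OF G.is_group N add zero that])
  have carrier1: "carrier ?G1 = (\<lambda>x. N #>\<^bsub>G\<^esub> x) ` carrier G"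
    by (auto simp: FactGroup_def RCOSETS_def)
  have mult1: "(N #>\<^bsub>G\<^esub> x) \<otimes>\<^bsub>?G1\<^esub> (N #>\<^bsub>G\<^esub> y) = N #>\<^bsub>G\<^esub> (x \<otimes>\<^bsub>G\<^esub> y)"
    if "x \<in> carrier G" "y \<in> carrier G" for x y
    using N.rcos_sum[OF that] by (simp add: FactGroup_def)
  have add1: "h1 (X \<otimes>\<^bsub>?G1\<^esub> Y) = h1 X + h1 Y" if "X \<in> carrier ?G1" "Y \<in> carrier ?G1" for X Y
  proof -
    obtain x y where "X = N #>\<^bsub>G\<^esub> x" "x \<in> carrier G" "Y = N #>\<^bsub>G\<^esub> y" "y \<in> carrier G"
      using \<open>X \<in> carrier ?G1\<close> \<open>Y \<in> carrier ?G1\<close> unfolding carrier1 by blast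
    moreover from this have "X \<otimes>\<^bsub>?G1\<^esub> Y = N #>\<^bsub>G\<^esub> (x \<otimes>\<^bsub>G\<^esub> y)" using mult1 by simp
    ultimately show ?thesis by (simp only: h1 add G.m_closed)
  qed
  have img1: "h1 ` carrier ?G1 = J"
    unfolding carrier1 image_image img[symmetric] by (rule image_cong) (simp_all add: h1)
  interpret H: group_hom ?G1 ?R h1
    using N.factorgroup_is_group R add1 img1
    by (auto simp: group_hom_def group_hom_axioms_def hom_def)
  have kernel: "kernel ?G1 ?R h1 = ?K"
    unfolding kernel_def carrier1 by (auto simp: h1)
  have K: "subgroup ?K ?G1" using H.subgroup_kernel unfolding kernel .
  define \<phi> where "\<phi> X = the_elem (h1 ` X)" for X
  have "\<phi> \<in> iso (?G1 Mod ?K) ?R"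
    using H.FactGroup_iso_set img1 unfolding kernel \<phi>_def[abs_def] by simp
  moreover have phi: "\<phi> (?K #>\<^bsub>?G1\<^esub> (N #>\<^bsub>G\<^esub> x)) = h x" if "x \<in> carrier G" for x
    unfolding \<phi>_def
    by (subst the_elem_image_rcoset[OF N.factorgroup_is_group K add1])
       (use that h1 carrier1 in auto)
  have "\<phi> ` (\<lambda>g. ?K #>\<^bsub>?G1\<^esub> g) ` (\<lambda>g. N #>\<^bsub>G\<^esub> g) ` P = {y \<in> J. y \<ge> 0}"
    unfolding image_image P(2)[symmetric] using P(1) phi by (intro image_cong) auto
  ultimately show ?thesis
    using phi[OF u(1)] u(2) by (auto simp: real_unital_group_def)
qed

lemma comm_group_cont_int: "comm_group (cont_int X)"
proof (rule comm_groupI)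
  fix f assume "f \<in> carrier (cont_int X)"
  then have "continuous_on X f" by (simp add: cont_int_def)
  then have "continuous_on X (\<lambda>x. - f x)"
    using continuous_on_compose[OF _ Topological_Spaces.continuous_on_discrete[of _ uminus], of X f]
    by (simp add: o_def)
  with \<open>f \<in> carrier (cont_int X)\<close>
  have "(\<lambda>x\<in>X. - f x) \<in> carrier (cont_int X)" "(\<lambda>x\<in>X. - f x) \<otimes>\<^bsub>cont_int X\<^esub> f = \<one>\<^bsub>cont_int X\<^esub>"
    by (auto simp: cont_int_def cong: continuous_on_cong restrict_cong)
  then show "\<exists>g\<in>carrier (cont_int X). g \<otimes>\<^bsub>cont_int X\<^esub> f = \<one>\<^bsub>cont_int X\<^esub>" by blast
qed (auto simp: cont_int_def continuous_on_add add.assoc add.commute fun_eq_iff extensional_def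
      cong: continuous_on_cong restrict_cong)

section \<open>The isomorphism given by integration\<close>

context aperiodic_ferenczi
begin

lemma carrier_cont_int_X: "f \<in> carrier (cont_int X) \<longleftrightarrow> f \<in> extensional X \<and> local_on X f"
  by (simp add: cont_int_def local_on_iff_continuous[OF compact_X])

lemma restrict_in_cont_int: "local_on X f \<Longrightarrow> (\<lambda>x\<in>X. f x) \<in> carrier (cont_int X)"
  unfolding carrier_cont_int_X local_on_def by simp

lemma shift_map_X: "x \<in> X \<Longrightarrow> shift_map x \<in> X"
  by (simp only: shift_map_eq_shiftz X_shiftz)

lemma subgroup_coboundaries: "subgroup (coboundaries X shift_map) (cont_int X)"
proof -
  interpret comm_group "cont_int X" by (rule comm_group_cont_int)
  have "group_hom (cont_int X) (cont_int X) (\<lambda>f. \<lambda>x\<in>X. f (shift_map x) - f x)"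
  proof (intro group_hom.intro group_hom_axioms.intro is_group homI)
    fix f assume "f \<in> carrier (cont_int X)"
    then have "local_on X f" by (simp add: carrier_cont_int_X)
    then have "local_on X (\<lambda>x. f (shift_map x) - f x)"
      unfolding shift_map_eq_shiftz
      by (intro local_on_comp2[where h = "(-)"] local_on_shiftz[OF _ X_shiftz])
    then show "(\<lambda>x\<in>X. f (shift_map x) - f x) \<in> carrier (cont_int X)" by (rule restrict_in_cont_int)
  next
    fix f g
    show "(\<lambda>x\<in>X. (f \<otimes>\<^bsub>cont_int X\<^esub> g) (shift_map x) - (f \<otimes>\<^bsub>cont_int X\<^esub> g) x)
      = (\<lambda>x\<in>X. f (shift_map x) - f x) \<otimes>\<^bsub>cont_int X\<^esub> (\<lambda>x\<in>X. g (shift_map x) - g x)"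
      by (auto simp: cont_int_def fun_eq_iff shift_map_X)
  qed
  from group_hom.img_is_subgroup[OF this] show ?thesis by (simp add: coboundaries_def)
qed

text \<open>Integration against one fixed invariant measure is the homomorphism; invariance kills
  the coboundaries, and its image is pinned down from both sides by \<open>integral_in_J\<close> and
  \<open>J_group_integral\<close>.\<close>

lemma K0_mod_Inf_isomorphic:
  assumes "stable_index q a n0"
  shows "unital_order_isomorphic (K0_mod_Inf X shift_map) (real_unital_group (J_group q a n0))"
proof -
  obtain m where n0: "n0 = Suc m" using assms by (cases n0) (auto simp: stable_index_def)
  have stable: "alphabet q a (Suc n) = alphabet q a (Suc m)" if "m \<le> n" for n
    using assms that unfolding stable_index_def n0 by blast
  obtain \<mu> where mu: "\<mu> \<in> invariant_measures X shift_map" using invariant_measures_nonempty by blast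
  interpret prob_space \<mu> by (rule prob_space_invariant_measure[OF mu])
  define h where "h f = (LINT x|\<mu>. real_of_int (f x))" for f :: "(int \<Rightarrow> nat) \<Rightarrow> int"
  have restrict: "h (\<lambda>x\<in>X. f x) = h f" for f
    unfolding h_def by (rule Bochner_Integration.integral_cong) (auto simp: space_mu[OF mu])
  have integrable: "integrable \<mu> (\<lambda>x. real_of_int (f x))" if "local_on X f" for f :: "(int \<Rightarrow> nat) \<Rightarrow> int"
    by (rule integrable_local[OF mu local_on_comp[OF that]])
  \<comment> \<open>Integrals of continuous integer functions agree for all invariant measures, so
    the chosen one already detects infinitesimals.\<close>
  have inf: "infinitesimals X shift_map
      = (\<lambda>f. coboundaries X shift_map #>\<^bsub>cont_int X\<^esub> f) ` {f \<in> carrier (cont_int X). h f = 0}"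
  proof -
    have "(\<forall>\<nu>\<in>invariant_measures X shift_map. (LINT x|\<nu>. real_of_int (f x)) = 0) \<longleftrightarrow> h f = 0"
      if "f \<in> carrier (cont_int X)" for f
      using that integral_unique[of f, OF _ mu] mu unfolding h_def carrier_cont_int_X by metis
    then have "{f \<in> carrier (cont_int X). \<forall>\<nu>\<in>invariant_measures X shift_map. (LINT x|\<nu>. real_of_int (f x)) = 0}
      = {f \<in> carrier (cont_int X). h f = 0}" by blast
    then show ?thesis by (simp only: infinitesimals_def)
  qed
  have surj: "h ` carrier (cont_int X) = J_group q a n0"
  proof (intro equalityI subsetI)
    fix y assume "y \<in> h ` carrier (cont_int X)"
    then show "y \<in> J_group q a n0"
      using integral_in_J[OF mu stable] unfolding n0 h_def by (auto simp: carrier_cont_int_X)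
  next
    fix y assume "y \<in> J_group q a n0"
    then obtain f where f: "local_on X f" "h f = y"
      using J_group_integral[OF mu stable] unfolding n0 h_def by blast
    then show "y \<in> h ` carrier (cont_int X)"
      using restrict_in_cont_int[OF f(1)] restrict[of f] by (intro image_eqI[of _ _ "\<lambda>x\<in>X. f x"]) auto
  qed
  show ?thesis
    unfolding K0_mod_Inf_def K0_def inf
  proof (rule unital_order_isomorphic_quotient_quotient)
    show "comm_group (cont_int X)" by (rule comm_group_cont_int)
    show "subgroup (coboundaries X shift_map) (cont_int X)" by (rule subgroup_coboundaries)
    show "h ` carrier (cont_int X) = J_group q a n0" by (rule surj)
  next
    fix f g assume fg: "f \<in> carrier (cont_int X)" "g \<in> carrier (cont_int X)"
    have "h (f \<otimes>\<^bsub>cont_int X\<^esub> g) = h (\<lambda>x. f x + g x)"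
      using restrict[of "\<lambda>x. f x + g x"] by (simp add: cont_int_def)
    also have "\<dots> = h f + h g"
      using fg integrable[of f] integrable[of g] by (simp add: h_def carrier_cont_int_X)
    finally show "h (f \<otimes>\<^bsub>cont_int X\<^esub> g) = h f + h g" .
  next
    fix f assume "f \<in> coboundaries X shift_map"
    then obtain g where g: "local_on X g" "f = (\<lambda>x\<in>X. g (shift_map x) - g x)"
      by (auto simp: coboundaries_def carrier_cont_int_X)
    have gr: "local_on X (\<lambda>x. real_of_int (g x))" by (rule local_on_comp[OF g(1)])
    have "local_on X (\<lambda>x. g (shift_map x))"
      unfolding shift_map_eq_shiftz by (rule local_on_shiftz[OF g(1) X_shiftz])
    then have "h f = (LINT x|\<mu>. real_of_int (g (shift_map x))) - (LINT x|\<mu>. real_of_int (g x))"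
      using integrable[of "\<lambda>x. g (shift_map x)"] integrable[OF g(1)]
      unfolding g(2) restrict by (simp add: h_def)
    also have "\<dots> = 0"
      using integral_shiftz[OF mu gr, of 1] by (simp add: shift_map_eq_shiftz)
    finally show "h f = 0" .
  next
    show "cont_nonneg X \<subseteq> carrier (cont_int X)" by (auto simp: cont_nonneg_def)
    show "h ` cont_nonneg X = {y \<in> J_group q a n0. y \<ge> 0}"
    proof (intro equalityI subsetI)
      fix y assume "y \<in> h ` cont_nonneg X"
      then obtain f where f: "f \<in> carrier (cont_int X)" "\<And>x. x \<in> X \<Longrightarrow> 0 \<le> f x" "y = h f"
        by (auto simp: cont_nonneg_def)
      then have "0 \<le> y"
        unfolding h_def by (auto intro!: integral_nonneg_AE AE_I2 simp: space_mu[OF mu])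
      then show "y \<in> {y \<in> J_group q a n0. y \<ge> 0}" using f surj by blast
    next
      fix y assume "y \<in> {y \<in> J_group q a n0. y \<ge> 0}"
      then have "y \<in> h ` carrier (cont_int X)" "0 \<le> y" unfolding surj by auto
      then obtain f where f: "local_on X f" "h f = y" "0 \<le> y"
        by (auto simp: carrier_cont_int_X)
      \<comment> \<open>\<open>f\<close> may take negative values, so it is replaced by a
        nonnegative function with the same integral.\<close>
      then obtain g :: "(int \<Rightarrow> nat) \<Rightarrow> int" where g: "local_on X g" "\<And>x. 0 \<le> g x" "h g = y"
        using nonneg_representative[OF mu stable f(1)] unfolding h_def by auto
      have "(\<lambda>x\<in>X. g x) \<in> cont_nonneg X"
        using restrict_in_cont_int[OF g(1)] g(2) by (simp add: cont_nonneg_def)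
      then show "y \<in> h ` cont_nonneg X"
        using g(3) restrict[of g] by (intro image_eqI[of _ _ "\<lambda>x\<in>X. g x"]) auto
    qed
    show "(\<lambda>x\<in>X. 1) \<in> carrier (cont_int X)" by (rule restrict_in_cont_int) simp
    show "h (\<lambda>x\<in>X. 1) = 1"
      unfolding restrict by (simp add: h_def prob_space)
  qed
qed

end

theorem proposition4p13:
  fixes q :: "nat \<Rightarrow> nat" and a :: "nat \<Rightarrow> nat \<Rightarrow> nat" and n0 :: nat
  assumes "standard_cuts q"
    and "bounded_spacers q a"
    and "aperiodic_subshift (ferenczi_subshift q a)"
    and "stable_index q a n0"
  shows "unital_order_isomorphic (K0_mod_Inf (ferenczi_subshift q a) shift_map)
           (real_unital_group (J_group q a n0))"
proof -
  obtain M where M: "\<And>n i. i < q n \<Longrightarrow> a n i \<le> M"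
    using assms(2) unfolding bounded_spacers_def by blast
  interpret aperiodic_ferenczi q a M
    using assms(1,3) M by unfold_locales (auto simp: standard_cuts_def)
  show ?thesis by (rule K0_mod_Inf_isomorphic) fact
qed

end
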